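(* Consider the system and notation described in the context. If $a_1\ge\sqrt{4d_1r}$, or if $0<a_1<\sqrt{4d_1r}$ and $L<L_1^*$, then $(0,\bar w)$ is globally asymptotically stable. If $0<a_1<\sqrt{4d_1r}$ and $L>L_1^*$, then: (i) if $L-x_2\ge L^*$ (large protection zone), then $(0,\bar w)$ is unstable; (ii) if $L-x_2<L^*$ (small protection zone), then: (ii.1) fixing all parameters except $h$ and $m$, there is a function $\bar m(h)$ such that $(0,\bar w)$ is linearly stable for $(h,m)\in\{h>0,\ m>\bar m(h)\}$ and unstable for $(h,m)\in\{h>0,\ 0<m<\bar m(h)\}$; (ii.2) fixing all parameters except $q$ and $m$, there is a function $\bar q(m)$ such that $(0,\bar w)$ is linearly stable for $(q,m)\in\{0<q<\bar q(m),\ m>0\}$ and unstable for $(q,m)\in\{q>\bar q(m),\ m>0\}$.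
   Context: Let $d_1,d_2,r,m,p,q,h,L>0$, $a_1>0$, $a_2\ge0$ and $0<x_2\le L$. Let $\chi_{[0,x_2)}(x)=1$ for $0\le x<x_2$ and $0$ for $x_2\le x\le L$. Consider the system $u_t=d_1u_{xx}-a_1u_x+u(r-u-m\chi_{[0,x_2)}w)$, $x\in(0,L)$, $t>0$; $w_t=d_2w_{xx}-a_2w_x+h-qw-puw$, $x\in(0,x_2)$, $t>0$; $d_1u_x(0,t)-a_1u(0,t)=u_x(L,t)=0$; $d_2w_x(0,t)-a_2w(0,t)=d_2w_x(x_2,t)-a_2w(x_2,t)=0$; nonnegative, not identically zero initial data $u_0$ on $[0,L]$, $w_0$ on $[0,x_2]$. Let $\bar w$ be the unique positive solution of $d_2w''-a_2w'+h-qw=0$ on $(0,x_2)$, $d_2w'(0)-a_2w(0)=d_2w'(x_2)-a_2w(x_2)=0$; $(0,\bar w)$ is the semi-trivial steady state. For $0\le y_1<y_2\le L$, $d>0$, $a\ge0$, bounded $s$, $\lambda_1(d,a,s,(y_1,y_2))$ is the principal eigenvalue (with positive eigenfunction) of $d\varphi''-a\varphi'+s\varphi=\lambda\varphi$ on $(y_1,y_2)$, $d\varphi'(y_1)-a\varphi(y_1)=\varphi'(y_2)=0$. $(0,\bar w)$ is linearly stable if $\lambda_1(d_1,a_1,r-m\chi_{[0,x_2)}\bar w,(0,L))<0$ and unstable if it is $>0$; it is globally asymptotically stable if all solutions with nonnegative nontrivial initial data converge to it uniformly as $t\to\infty$. For $0<a_1<\sqrt{4d_1r}$: $L^*=2d_1\big(\pi-\arctan\frac{\sqrt{4d_1r-a_1^2}}{a_1}\big)/\sqrt{4d_1r-a_1^2}$;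 $L_1^*=2d_1\arctan\big(\frac{a_1\sqrt{4d_1r-a_1^2}}{2d_1r-a_1^2}\big)/\sqrt{4d_1r-a_1^2}$ if $a_1\le\sqrt{2d_1r}$ and $L_1^*=2d_1\big(\pi+\arctan\frac{a_1\sqrt{4d_1r-a_1^2}}{2d_1r-a_1^2}\big)/\sqrt{4d_1r-a_1^2}$ if $\sqrt{2d_1r}<a_1<\sqrt{4d_1r}$. *)

theory Defs
  imports "HOL-Analysis.Analysis"
begin

definition chi :: "real \<Rightarrow> real \<Rightarrow> real" where
  "chi x2 x = (if 0 \<le> x \<and> x < x2 then 1 else 0)"

text \<open>Principal eigenvalue lambda_1(d,a,s,(y1,y2)): the (unique) eigenvalue of
  d phi'' - a phi' + s phi = lam phi on (y1,y2), d phi'(y1) - a phi(y1) = phi'(y2) = 0,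
  admitting a positive eigenfunction. Since s may be discontinuous (it contains chi),
  the eigenfunction is C^1 on [y1,y2] and satisfies the equation classically off a finite set.\<close>
definition is_pos_eigenpair ::
  "real \<Rightarrow> real \<Rightarrow> (real \<Rightarrow> real) \<Rightarrow> real \<Rightarrow> real \<Rightarrow> real \<Rightarrow> (real \<Rightarrow> real) \<Rightarrow> bool" where
  "is_pos_eigenpair d a s y1 y2 lam phi =
     (\<exists>phi'. (\<forall>x\<in>{y1..y2}. (phi has_real_derivative phi' x) (at x within {y1..y2}) \<and> phi x > 0)
        \<and> continuous_on {y1..y2} phi'
        \<and> (\<exists>F. finite F \<and> (\<forall>x\<in>{y1<..<y2} - F. \<exists>phi''.
              (phi' has_real_derivative phi'') (at x) \<and>
              d * phi'' - a * phi' x + s x * phi x = lam * phi x))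
        \<and> d * phi' y1 - a * phi y1 = 0 \<and> phi' y2 = 0)"

definition lambda1 :: "real \<Rightarrow> real \<Rightarrow> (real \<Rightarrow> real) \<Rightarrow> real \<Rightarrow> real \<Rightarrow> real" where
  "lambda1 d a s y1 y2 = (THE lam. \<exists>phi. is_pos_eigenpair d a s y1 y2 lam phi)"

definition is_wsteady :: "real \<Rightarrow> real \<Rightarrow> real \<Rightarrow> real \<Rightarrow> real \<Rightarrow> (real \<Rightarrow> real) \<Rightarrow> bool" where
  "is_wsteady d2 a2 h q x2 w =
     (\<exists>w' w''. (\<forall>x\<in>{0..x2}. (w has_real_derivative w' x) (at x within {0..x2})
                 \<and> (w' has_real_derivative w'' x) (at x within {0..x2}) \<and> w x > 0)
        \<and> continuous_on {0..x2} w''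
        \<and> (\<forall>x\<in>{0<..<x2}. d2 * w'' x - a2 * w' x + h - q * w x = 0)
        \<and> d2 * w' 0 - a2 * w 0 = 0 \<and> d2 * w' x2 - a2 * w x2 = 0)"

text \<open>The semi-trivial steady state component wbar (the unique positive solution),
  normalised to 0 outside [0,x2] (these values are irrelevant).\<close>
definition wbar :: "real \<Rightarrow> real \<Rightarrow> real \<Rightarrow> real \<Rightarrow> real \<Rightarrow> real \<Rightarrow> real" where
  "wbar d2 a2 h q x2 = (THE w. is_wsteady d2 a2 h q x2 w \<and> (\<forall>x. x \<notin> {0..x2} \<longrightarrow> w x = 0))"

definition lam_sst :: "real \<Rightarrow> real \<Rightarrow> real \<Rightarrow> real \<Rightarrow> real \<Rightarrow> real \<Rightarrow> real \<Rightarrow> real \<Rightarrow> real \<Rightarrow> real \<Rightarrow> real" where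
  "lam_sst d1 d2 a1 a2 r m h q L x2 =
     lambda1 d1 a1 (\<lambda>x. r - m * chi x2 x * wbar d2 a2 h q x2 x) 0 L"

definition lin_stable where
  "lin_stable d1 d2 a1 a2 r m h q L x2 \<longleftrightarrow> lam_sst d1 d2 a1 a2 r m h q L x2 < 0"

definition unstable where
  "unstable d1 d2 a1 a2 r m h q L x2 \<longleftrightarrow> lam_sst d1 d2 a1 a2 r m h q L x2 > 0"

text \<open>(Strong) solution of the predator-prey system on [0,L] x [0,oo), resp. [0,x2] x [0,oo).
  u, w are continuous up to t = 0 with the given initial data; u_x is continuous on
  [0,L] x (0,oo); u_xx and u_t exist and are continuous off the interface x = x2 where the
  coefficient chi jumps; w is classical on (0,x2) x (0,oo).\<close>
definition is_solution ::
  "real \<Rightarrow> real \<Rightarrow> real \<Rightarrow> real \<Rightarrow> real \<Rightarrow> real \<Rightarrow> real \<Rightarrow> real \<Rightarrow> real \<Rightarrow> real \<Rightarrow> real \<Rightarrow>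
   (real \<Rightarrow> real) \<Rightarrow> (real \<Rightarrow> real) \<Rightarrow> (real \<Rightarrow> real \<Rightarrow> real) \<Rightarrow> (real \<Rightarrow> real \<Rightarrow> real) \<Rightarrow> bool" where
  "is_solution d1 d2 a1 a2 r m p q h L x2 u0 w0 u w =
     (continuous_on ({0..L} \<times> {0..}) (\<lambda>(x,t). u x t)
      \<and> continuous_on ({0..x2} \<times> {0..}) (\<lambda>(x,t). w x t)
      \<and> (\<forall>x\<in>{0..L}. u x 0 = u0 x) \<and> (\<forall>x\<in>{0..x2}. w x 0 = w0 x)
      \<and> (\<exists>ux uxx ut.
           (\<forall>t>0. \<forall>x\<in>{0..L}. ((\<lambda>y. u y t) has_real_derivative ux x t) (at x within {0..L}))
         \<and> continuous_on ({0..L} \<times> {0<..}) (\<lambda>(x,t). ux x t)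
         \<and> (\<forall>t>0. \<forall>x\<in>{0<..<L} - {x2}.
               ((\<lambda>y. ux y t) has_real_derivative uxx x t) (at x)
             \<and> ((\<lambda>s. u x s) has_real_derivative ut x t) (at t)
             \<and> ut x t = d1 * uxx x t - a1 * ux x t + u x t * (r - u x t - m * chi x2 x * w x t))
         \<and> continuous_on (({0<..<L} - {x2}) \<times> {0<..}) (\<lambda>(x,t). uxx x t)
         \<and> continuous_on (({0<..<L} - {x2}) \<times> {0<..}) (\<lambda>(x,t). ut x t)
         \<and> (\<forall>t>0. d1 * ux 0 t - a1 * u 0 t = 0 \<and> ux L t = 0))
      \<and> (\<exists>wx wxx wt.
           (\<forall>t>0. \<forall>x\<in>{0..x2}. ((\<lambda>y. w y t) has_real_derivative wx x t) (at x within {0..x2}))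
         \<and> continuous_on ({0..x2} \<times> {0<..}) (\<lambda>(x,t). wx x t)
         \<and> (\<forall>t>0. \<forall>x\<in>{0<..<x2}.
               ((\<lambda>y. wx y t) has_real_derivative wxx x t) (at x)
             \<and> ((\<lambda>s. w x s) has_real_derivative wt x t) (at t)
             \<and> wt x t = d2 * wxx x t - a2 * wx x t + h - q * w x t - p * u x t * w x t)
         \<and> continuous_on ({0<..<x2} \<times> {0<..}) (\<lambda>(x,t). wxx x t)
         \<and> continuous_on ({0<..<x2} \<times> {0<..}) (\<lambda>(x,t). wt x t)
         \<and> (\<forall>t>0. d2 * wx 0 t - a2 * w 0 t = 0 \<and> d2 * wx x2 t - a2 * w x2 t = 0)))"

definition glob_asym_stable where
  "glob_asym_stable d1 d2 a1 a2 r m p q h L x2 \<longleftrightarrow>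
     (\<forall>u0 w0 u w.
        continuous_on {0..L} u0 \<and> (\<forall>x\<in>{0..L}. u0 x \<ge> 0) \<and> (\<exists>x\<in>{0..L}. u0 x \<noteq> 0)
      \<and> continuous_on {0..x2} w0 \<and> (\<forall>x\<in>{0..x2}. w0 x \<ge> 0) \<and> (\<exists>x\<in>{0..x2}. w0 x \<noteq> 0)
      \<and> is_solution d1 d2 a1 a2 r m p q h L x2 u0 w0 u w
      \<longrightarrow> (\<forall>\<epsilon>>0. \<exists>T. \<forall>t\<ge>T.
             (\<forall>x\<in>{0..L}. \<bar>u x t\<bar> < \<epsilon>)
           \<and> (\<forall>x\<in>{0..x2}. \<bar>w x t - wbar d2 a2 h q x2 x\<bar> < \<epsilon>)))"

text \<open>Critical lengths L^* and L_1^* (for 0 < a1 < sqrt(4 d1 r)). At a1 = sqrt(2 d1 r) the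
  arctan argument is +infinity, so arctan is read as pi/2 (continuous extension of both branches).\<close>
definition Lstar :: "real \<Rightarrow> real \<Rightarrow> real \<Rightarrow> real" where
  "Lstar d1 r a1 = 2 * d1 * (pi - arctan (sqrt (4*d1*r - a1^2) / a1)) / sqrt (4*d1*r - a1^2)"

definition L1star :: "real \<Rightarrow> real \<Rightarrow> real \<Rightarrow> real" where
  "L1star d1 r a1 =
     (if a1 < sqrt (2*d1*r) then
        2 * d1 * arctan (a1 * sqrt (4*d1*r - a1^2) / (2*d1*r - a1^2)) / sqrt (4*d1*r - a1^2)
      else if a1 = sqrt (2*d1*r) then
        2 * d1 * (pi/2) / sqrt (4*d1*r - a1^2)
      else
        2 * d1 * (pi + arctan (a1 * sqrt (4*d1*r - a1^2) / (2*d1*r - a1^2))) / sqrt (4*d1*r - a1^2))"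

end

theory Submission
  imports Defs
begin

text \<open>
  Every sign statement about the principal eigenvalue is a Sturm comparison: for positive solutions of
  \<open>d f'' - a f' + k f = 0\<close> the Wronskian weighted with \<open>exp (- (a/d) x)\<close> is monotone as soon as the
  potentials \<open>k\<close> are ordered, and the boundary conditions make it vanish at the ends. The comparison
  functions are explicit. \<open>exp (\<alpha> x) sin (\<omega> (x - y))\<close>, which vanishes at distance \<open>Lstar\<close> to the left of \<open>L\<close>,
  decides the role of the protection zone; in the small-zone case it is continued to the left of \<open>x2\<close> by
  \<open>exp (k x\<^sup>2)\<close>, which is a supersolution there once \<open>m\<close> is large.
  \<open>exp (\<alpha> x) cos (\<omega> x - \<theta>)\<close> with \<open>tan \<theta> = \<alpha> / \<omega>\<close> has slope zero at \<open>2 \<theta> / \<omega>\<close>, which is \<open>L1star\<close> for the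
  critical frequency; slightly perturbed it is a strict sub- or supersolution on \<open>[0, L]\<close>.
  The thresholds exist because the eigenvalue is strictly monotone in \<open>m\<close> and in \<open>q\<close>.

  The eigenvalue itself is found by shooting from 0: it is the infimum of the parameters for which the
  solution stays positive with positive slope at \<open>L\<close>.

  The convergence statement follows from parabolic comparison with exponentially decaying multiples of a
  strict supersolution. As \<open>u\<close> is only of class \<open>C\<^sup>1\<close> across the interface, the maximum principle is applied
  with a barrier that has a concave kink there, which excludes a touching point on the interface.
\<close>

section \<open>Sturm comparison\<close>

lemma continuous_on_Icc_bounded:
  fixes f :: "real \<Rightarrow> real"
  assumes "continuous_on {a..b} f"
  shows "\<exists>M. \<forall>x\<in>{a..b}. \<bar>f x\<bar> \<le> M"
  using compact_imp_bounded[OF compact_continuous_image[OF assms compact_Icc]]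
  by (auto simp: bounded_iff)

lemma nondecreasing_off_finite:
  fixes f :: "real \<Rightarrow> real"
  assumes "a \<le> b" "finite F" "continuous_on {a..b} f"
    and der: "\<And>x. x \<in> {a<..<b} - F \<Longrightarrow> \<exists>D. (f has_real_derivative D) (at x) \<and> 0 \<le> D"
  shows "f a \<le> f b"
proof -
  obtain f0 where f0: "\<And>x. x \<in> {a<..<b} - F \<Longrightarrow> (f has_real_derivative f0 x) (at x) \<and> 0 \<le> f0 x"
    using der by metis
  define f' where "f' x = (if x \<in> {a<..<b} - F then f0 x else 0)" for x
  have "(f' has_integral (f b - f a)) {a..b}"
  proof (rule fundamental_theorem_of_calculus_interior_strong[OF assms(2,1) _ assms(3)])
    fix x assume "x \<in> {a<..<b} - F"
    then show "(f has_vector_derivative f' x) (at x)"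
      using f0 by (auto simp: f'_def has_real_derivative_iff_has_vector_derivative)
  qed
  then have "0 \<le> f b - f a"
    by (rule has_integral_nonneg) (use f0 in \<open>auto simp: f'_def\<close>)
  then show ?thesis by simp
qed

lemma increasing_off_finite:
  fixes f :: "real \<Rightarrow> real"
  assumes "a < b" "finite F" "continuous_on {a..b} f"
    and der: "\<And>x. x \<in> {a<..<b} - F \<Longrightarrow> \<exists>D. (f has_real_derivative D) (at x) \<and> 0 < D"
  shows "f a < f b"
proof -
  have le: "f y \<le> f z" if "a \<le> y" "y \<le> z" "z \<le> b" for y z
  proof (rule nondecreasing_off_finite[OF that(2) assms(2)])
    show "continuous_on {y..z} f"
      using assms(3) that by (auto intro: continuous_on_subset)
    fix x assume "x \<in> {y<..<z} - F"
    then have "x \<in> {a<..<b} - F" using that by auto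
    then show "\<exists>D. (f has_real_derivative D) (at x) \<and> 0 \<le> D"
      using der less_imp_le by blast
  qed
  have "infinite ({a<..<b} - F)"
    using assms(1,2) by (simp add: infinite_Ioo)
  then obtain x where x: "x \<in> {a<..<b} - F"
    by (metis finite.emptyI ex_in_conv)
  then obtain D where D: "(f has_real_derivative D) (at x)" "0 < D" using der by blast
  obtain e where e: "e > 0" "\<And>h. 0 < h \<Longrightarrow> h < e \<Longrightarrow> f x < f (x + h)"
    using DERIV_pos_inc_right[OF D] by blast
  define h where "h = min (e/2) (b - x)"
  have "f x < f (x + h)" "x + h \<le> b" "0 < h"
    using e x by (auto simp: h_def)
  then show ?thesis
    using le[of a x] le[of "x+h" b] x by auto
qed

definition solves_ode ::
  "real \<Rightarrow> real \<Rightarrow> (real \<Rightarrow> real) \<Rightarrow> real \<Rightarrow> real \<Rightarrow> (real \<Rightarrow> real) \<Rightarrow> (real \<Rightarrow> real) \<Rightarrow> bool" where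
  "solves_ode d a k y1 y2 f f' \<longleftrightarrow>
     (\<forall>x\<in>{y1..y2}. (f has_real_derivative f' x) (at x within {y1..y2}))
   \<and> continuous_on {y1..y2} f'
   \<and> (\<exists>F. finite F \<and> (\<forall>x\<in>{y1<..<y2} - F. \<exists>f''.
         (f' has_real_derivative f'') (at x) \<and> d * f'' - a * f' x + k x * f x = 0))"

lemma solves_ode_subinterval:
  assumes "solves_ode d a k y1 y2 f f'" "y1 \<le> z1" "z2 \<le> y2"
    and "\<And>x. z1 < x \<Longrightarrow> x < z2 \<Longrightarrow> k x = k' x"
  shows "solves_ode d a k' z1 z2 f f'"
proof -
  have sub: "{z1..z2} \<subseteq> {y1..y2}" using assms by auto
  from assms(1) obtain F where F: "finite F" "\<forall>x\<in>{y1<..<y2} - F. \<exists>f''.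
         (f' has_real_derivative f'') (at x) \<and> d * f'' - a * f' x + k x * f x = 0"
    unfolding solves_ode_def by blast
  have "\<forall>x\<in>{z1<..<z2} - F. \<exists>f''.
         (f' has_real_derivative f'') (at x) \<and> d * f'' - a * f' x + k' x * f x = 0"
  proof
    fix x assume x: "x \<in> {z1<..<z2} - F"
    then have "x \<in> {y1<..<y2} - F" using assms by auto
    moreover have "k x = k' x" using x assms(4) by auto
    ultimately show "\<exists>f''.
         (f' has_real_derivative f'') (at x) \<and> d * f'' - a * f' x + k' x * f x = 0"
      using F(2) by metis
  qed
  with F(1) show ?thesis
    using assms(1) sub unfolding solves_ode_def
    by (blast intro: DERIV_subset continuous_on_subset)
qed

lemma solves_ode_smooth:
  assumes "\<And>x. (f has_real_derivative f' x) (at x)"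
    and "\<And>x. (f' has_real_derivative f'' x) (at x)"
    and "\<And>x. d * f'' x - a * f' x + k x * f x = 0"
  shows "solves_ode d a k y1 y2 f f'"
proof -
  have "continuous_on {y1..y2} f'"
    using assms(2) by (meson DERIV_continuous continuous_at_imp_continuous_on)
  moreover have "\<forall>x\<in>{y1<..<y2} - {}. \<exists>f''.
         (f' has_real_derivative f'') (at x) \<and> d * f'' - a * f' x + k x * f x = 0"
    using assms(2,3) by blast
  ultimately show ?thesis unfolding solves_ode_def
    using assms(1) has_field_derivative_at_within finite.emptyI by blast
qed

definition weighted_wronskian ::
  "real \<Rightarrow> real \<Rightarrow> (real \<Rightarrow> real) \<Rightarrow> (real \<Rightarrow> real) \<Rightarrow> (real \<Rightarrow> real) \<Rightarrow> (real \<Rightarrow> real) \<Rightarrow> real \<Rightarrow> real" where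
  "weighted_wronskian d a f f' g g' x = exp (- (a/d) * x) * (f' x * g x - f x * g' x)"

lemma weighted_wronskian_derivative:
  assumes "d > 0" "solves_ode d a k1 y1 y2 f f'" "solves_ode d a k2 y1 y2 g g'"
  shows "continuous_on {y1..y2} (weighted_wronskian d a f f' g g')"
    and "\<exists>F. finite F \<and> (\<forall>x\<in>{y1<..<y2} - F. (weighted_wronskian d a f f' g g'
          has_real_derivative exp (- (a/d) * x) / d * ((k2 x - k1 x) * (f x * g x))) (at x))"
proof -
  have "continuous_on {y1..y2} f" "continuous_on {y1..y2} f'"
    "continuous_on {y1..y2} g" "continuous_on {y1..y2} g'"
    using assms(2,3) unfolding solves_ode_def by (auto intro: DERIV_continuous_on)
  then show "continuous_on {y1..y2} (weighted_wronskian d a f f' g g')"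
    unfolding weighted_wronskian_def[abs_def] by (intro continuous_intros)
  obtain F where F: "finite F" "\<forall>x\<in>{y1<..<y2} - F. \<exists>f''.
         (f' has_real_derivative f'') (at x) \<and> d * f'' - a * f' x + k1 x * f x = 0"
    using assms(2) unfolding solves_ode_def by blast
  obtain G where G: "finite G" "\<forall>x\<in>{y1<..<y2} - G. \<exists>f''.
         (g' has_real_derivative f'') (at x) \<and> d * f'' - a * g' x + k2 x * g x = 0"
    using assms(3) unfolding solves_ode_def by blast
  have "(weighted_wronskian d a f f' g g'
          has_real_derivative exp (- (a/d) * x) / d * ((k2 x - k1 x) * (f x * g x))) (at x)"
    if x: "x \<in> {y1<..<y2} - (F \<union> G)" for x
  proof -
    have in_int: "x \<in> interior {y1..y2}" using x by simp
    have f: "(f has_real_derivative f' x) (at x)" and g: "(g has_real_derivative g' x) (at x)"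
      using assms(2,3) x at_within_interior[OF in_int] unfolding solves_ode_def
      by (metis Diff_iff atLeastAtMost_iff greaterThanLessThan_iff less_imp_le)+
    obtain f'' where f'': "(f' has_real_derivative f'') (at x)" "d * f'' - a * f' x + k1 x * f x = 0"
      using F x by blast
    obtain g'' where g'': "(g' has_real_derivative g'') (at x)" "d * g'' - a * g' x + k2 x * g x = 0"
      using G x by blast
    have ff: "f'' = (a * f' x - k1 x * f x) / d" and gg: "g'' = (a * g' x - k2 x * g x) / d"
      using f''(2) g''(2) assms(1) by (auto simp: field_simps)
    show ?thesis unfolding weighted_wronskian_def[abs_def]
      by (rule derivative_eq_intros f g f''(1) g''(1) refl)+
        (use assms(1) in \<open>simp add: ff gg field_simps\<close>)
  qed
  then show "\<exists>F. finite F \<and> (\<forall>x\<in>{y1<..<y2} - F. (weighted_wronskian d a f f' g g'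
          has_real_derivative exp (- (a/d) * x) / d * ((k2 x - k1 x) * (f x * g x))) (at x))"
    using F(1) G(1) by (intro exI[of _ "F \<union> G"]) auto
qed

lemma sturm_comparison:
  assumes "d > 0" "y1 \<le> y2" "solves_ode d a k1 y1 y2 f f'" "solves_ode d a k2 y1 y2 g g'"
    and "\<And>x. y1 < x \<Longrightarrow> x < y2 \<Longrightarrow> 0 \<le> f x \<and> 0 \<le> g x \<and> k1 x \<le> k2 x"
  shows "weighted_wronskian d a f f' g g' y1 \<le> weighted_wronskian d a f f' g g' y2"
proof -
  from weighted_wronskian_derivative(2)[OF assms(1,3,4)]
  obtain F where F: "finite F" "\<forall>x\<in>{y1<..<y2} - F. (weighted_wronskian d a f f' g g'
          has_real_derivative exp (- (a/d) * x) / d * ((k2 x - k1 x) * (f x * g x))) (at x)"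
    by blast
  show ?thesis
    by (rule nondecreasing_off_finite[OF assms(2) F(1) weighted_wronskian_derivative(1)[OF assms(1,3,4)]])
      (use F(2) assms(1,5) in \<open>force intro!: exI conjI\<close>)
qed

lemma sturm_comparison_strict:
  assumes "d > 0" "y1 < y2" "solves_ode d a k1 y1 y2 f f'" "solves_ode d a k2 y1 y2 g g'"
    and "\<And>x. y1 < x \<Longrightarrow> x < y2 \<Longrightarrow> 0 < f x \<and> 0 < g x \<and> k1 x < k2 x"
  shows "weighted_wronskian d a f f' g g' y1 < weighted_wronskian d a f f' g g' y2"
proof -
  from weighted_wronskian_derivative(2)[OF assms(1,3,4)]
  obtain F where F: "finite F" "\<forall>x\<in>{y1<..<y2} - F. (weighted_wronskian d a f f' g g'
          has_real_derivative exp (- (a/d) * x) / d * ((k2 x - k1 x) * (f x * g x))) (at x)"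
    by blast
  show ?thesis
    by (rule increasing_off_finite[OF assms(2) F(1) weighted_wronskian_derivative(1)[OF assms(1,3,4)]])
      (use F(2) assms(1,5) in \<open>force intro!: exI conjI\<close>)
qed

lemma derivative_nonpos_at_right_end_min:
  fixes f :: "real \<Rightarrow> real"
  assumes "a < b" "(f has_real_derivative D) (at b within {a..b})"
    and "\<And>y. y \<in> {a..b} \<Longrightarrow> f b \<le> f y"
  shows "D \<le> 0"
proof (rule ccontr)
  assume "\<not> D \<le> 0"
  then obtain e where e: "e > 0" "\<And>h. 0 < h \<Longrightarrow> b - h \<in> {a..b} \<Longrightarrow> h < e \<Longrightarrow> f (b - h) < f b"
    using has_real_derivative_pos_inc_left[OF assms(2)] by auto
  define h where "h = min (e/2) (b - a)"
  have "0 < h" "h < e" "b - h \<in> {a..b}" using e(1) assms(1) by (auto simp: h_def)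
  then show False using e(2)[of h] assms(3)[of "b - h"] by auto
qed

lemma derivative_nonneg_at_left_end_min:
  fixes f :: "real \<Rightarrow> real"
  assumes "a < b" "(f has_real_derivative D) (at a within {a..b})"
    and "\<And>y. y \<in> {a..b} \<Longrightarrow> f a \<le> f y"
  shows "0 \<le> D"
proof (rule ccontr)
  assume "\<not> 0 \<le> D"
  then obtain e where e: "e > 0" "\<And>h. 0 < h \<Longrightarrow> a + h \<in> {a..b} \<Longrightarrow> h < e \<Longrightarrow> f (a + h) < f a"
    using has_real_derivative_neg_dec_right[OF assms(2)] by auto
  define h where "h = min (e/2) (b - a)"
  have "0 < h" "h < e" "a + h \<in> {a..b}" using e(1) assms(1) by (auto simp: h_def)
  then show False using e(2)[of h] assms(3)[of "a + h"] by auto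
qed

lemma second_derivative_nonneg_at_local_min:
  fixes f :: "real \<Rightarrow> real"
  assumes "e > 0" and der: "\<And>y. \<bar>y - x\<bar> < e \<Longrightarrow> (f has_real_derivative f' y) (at y)"
    and "(f' has_real_derivative f'') (at x)"
    and min: "\<And>y. \<bar>y - x\<bar> < e \<Longrightarrow> f x \<le> f y"
  shows "f' x = 0" "0 \<le> f''"
proof -
  show f'x: "f' x = 0"
    by (rule DERIV_local_min[OF der[of x] \<open>e > 0\<close>]) (use assms in \<open>auto simp: abs_minus_commute\<close>)
  show "0 \<le> f''"
  proof (rule ccontr)
    assume "\<not> 0 \<le> f''"
    then obtain \<delta> where \<delta>: "\<delta> > 0" "\<And>h. 0 < h \<Longrightarrow> h < \<delta> \<Longrightarrow> f' (x + h) < f' x"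
      using DERIV_neg_dec_right[OF assms(3)] by auto
    define h where "h = min e \<delta> / 2"
    have h: "0 < h" "h < e" "h < \<delta>" using \<open>e > 0\<close> \<delta> by (auto simp: h_def)
    obtain z where z: "x < z" "z < x + h" "f (x + h) - f x = h * f' z"
      using MVT2[of x "x+h" f f'] der h by auto
    have "f' (x + (z - x)) < f' x" using \<delta>(2)[of "z - x"] z h by simp
    then have "h * f' z < 0" using f'x h by (simp add: mult_pos_neg)
    then show False using z(3) min[of "x+h"] h by auto
  qed
qed

section \<open>Linear systems with one jump\<close>

lemma piecewise_continuous_integrable:
  fixes B1 B2 f :: "real \<Rightarrow> real"
  assumes "continuous_on {0..L} B1" "continuous_on {0..L} B2" "continuous_on {0..L} f" "x \<le> L"
  shows "(\<lambda>t. (if t < c then B1 t else B2 t) * f t) integrable_on {0..x}"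
proof -
  have sub: "{0..x} \<subseteq> {0..L}" "{..c} \<inter> {0..x} = {0..min c x}" "{0..min c x} \<subseteq> {0..L}"
    using assms(4) by auto
  have "(\<lambda>t. B2 t * f t) integrable_on {0..x}"
    by (intro integrable_continuous_real continuous_intros continuous_on_subset[OF _ sub(1)] assms)
  moreover have "(\<lambda>t. if t \<in> {..c} then (B1 t - B2 t) * f t else 0) integrable_on {0..x}"
    unfolding integrable_restrict_Int sub(2)
    by (intro integrable_continuous_real continuous_intros continuous_on_subset[OF _ sub(3)] assms)
  ultimately have "(\<lambda>t. B2 t * f t + (if t \<in> {..c} then (B1 t - B2 t) * f t else 0)) integrable_on {0..x}"
    by (rule integrable_add)
  then show ?thesis
    by (rule integrable_spike[where S="{c}"]) (auto simp: algebra_simps)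
qed

lemma linear_system_exists:
  fixes A B1 B2 :: "real \<Rightarrow> real" and c u0 v0 :: real
  assumes "0 < L" and A: "continuous_on {0..L} A"
    and B12: "continuous_on {0..L} B1" "continuous_on {0..L} B2"
  defines "B \<equiv> (\<lambda>x. if x < c then B1 x else B2 x)"
  shows "\<exists>u v. (\<forall>x\<in>{0..L}. (u has_real_derivative A x * v x) (at x within {0..L}))
      \<and> continuous_on {0..L} v
      \<and> (\<forall>x\<in>{0<..<L} - {c}. (v has_real_derivative B x * u x) (at x))
      \<and> u 0 = u0 \<and> v 0 = v0"
proof -
  have int: "(\<lambda>t. B t * f t) integrable_on {0..x}" if "continuous_on {0..L} f" "x \<le> L" for f x
    unfolding B_def by (rule piecewise_continuous_integrable[OF B12 that])
  define I where "I f t = integral {0..t} (\<lambda>s. B s * f s)" for f t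
  define K where "K f x = integral {0..x} (\<lambda>t. A t * I f t)" for f x
  have I_cont: "continuous_on {0..L} (I f)" if "continuous_on {0..L} f" for f
    unfolding I_def[abs_def] by (rule indefinite_integral_continuous_1[OF int[OF that order_refl]])
  have AI_cont: "continuous_on {0..L} (\<lambda>t. A t * I f t)" if "continuous_on {0..L} f" for f
    by (intro continuous_intros A I_cont that)
  have AI_int: "(\<lambda>t. A t * I f t) integrable_on {0..x}" if "continuous_on {0..L} f" "x \<le> L" for f x
    using AI_cont[OF that(1)] that(2) by (auto intro!: integrable_continuous_real intro: continuous_on_subset)
  have K_cont: "continuous_on {0..L} (K f)" if "continuous_on {0..L} f" for f
    unfolding K_def[abs_def] by (rule indefinite_integral_continuous_1[OF AI_int[OF that order_refl]])
  have I_diff: "I f t - I g t = I (\<lambda>x. f x - g x) t"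
    if "continuous_on {0..L} f" "continuous_on {0..L} g" "t \<le> L" for f g t
    unfolding I_def using integral_diff[OF int[OF that(1,3)] int[OF that(2,3)]]
    by (simp add: right_diff_distrib)
  have K_diff: "K f t - K g t = K (\<lambda>x. f x - g x) t"
    if "continuous_on {0..L} f" "continuous_on {0..L} g" "t \<le> L" for f g t
  proof -
    have "K f t - K g t = integral {0..t} (\<lambda>x. A x * I f x - A x * I g x)"
      unfolding K_def using integral_diff[OF AI_int[OF that(1,3)] AI_int[OF that(2,3)]] by simp
    also have "\<dots> = K (\<lambda>x. f x - g x) t" unfolding K_def
      by (rule integral_cong) (use I_diff[OF that(1,2)] that(3) in \<open>simp flip: right_diff_distrib\<close>)
    finally show ?thesis .
  qed
  note bdd = continuous_on_Icc_bounded
  obtain MA where MA: "\<And>x. x \<in> {0..L} \<Longrightarrow> \<bar>A x\<bar> \<le> MA" using bdd[OF A] by blast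
  obtain M1 where M1: "\<And>x. x \<in> {0..L} \<Longrightarrow> \<bar>B1 x\<bar> \<le> M1" using bdd[OF B12(1)] by blast
  obtain M2 where M2: "\<And>x. x \<in> {0..L} \<Longrightarrow> \<bar>B2 x\<bar> \<le> M2" using bdd[OF B12(2)] by blast
  define MB where "MB = max M1 M2"
  have MB: "\<bar>B x\<bar> \<le> MB" if "x \<in> {0..L}" for x
    using M1[OF that] M2[OF that] by (auto simp: B_def MB_def)
  have nn: "0 \<le> MA" "0 \<le> MB" using MA[of 0] MB[of 0] \<open>0 < L\<close> by auto
  define M where "M = MA * MB * L"
  have "0 \<le> M" using nn \<open>0 < L\<close> by (simp add: M_def)
  have K_bound: "\<bar>K f x\<bar> \<le> C * (M * x) ^ Suc n / fact (Suc n)"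
    if f: "continuous_on {0..L} f" and fb: "\<And>x. x \<in> {0..L} \<Longrightarrow> \<bar>f x\<bar> \<le> C * (M * x) ^ n / fact n"
      and x: "x \<in> {0..L}" and "0 \<le> C" for f C n x
  proof -
    have Ib: "\<bar>A t * I f t\<bar> \<le> C * M ^ Suc n / fact n * t ^ n" if t: "t \<in> {0..x}" for t
    proof -
      have "norm (I f t) \<le> (MB * (C * (M * t) ^ n / fact n)) * measure lborel (cbox 0 t)"
        unfolding I_def cbox_interval[symmetric]
      proof (rule integrable_bound)
        show "0 \<le> MB * (C * (M * t) ^ n / fact n)"
          using nn \<open>0 \<le> C\<close> \<open>0 \<le> M\<close> t by simp
        show "(\<lambda>s. B s * f s) integrable_on cbox 0 t" using int[OF f, of t] x t by simp
        fix s assume s: "s \<in> cbox 0 t"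
        have "\<bar>f s\<bar> \<le> C * (M * s) ^ n / fact n" using fb[of s] s t x by auto
        also have "\<dots> \<le> C * (M * t) ^ n / fact n"
          using s \<open>0 \<le> C\<close> \<open>0 \<le> M\<close> by (auto intro!: divide_right_mono mult_left_mono power_mono)
        finally have "\<bar>B s\<bar> * \<bar>f s\<bar> \<le> MB * (C * (M * t) ^ n / fact n)"
          using MB[of s] s t x nn by (intro mult_mono) auto
        then show "norm (B s * f s) \<le> MB * (C * (M * t) ^ n / fact n)"
          by (simp add: abs_mult)
      qed
      also have "\<dots> = MB * t * (C * (M * t) ^ n / fact n)" using t by simp
      also have "\<dots> \<le> MB * L * (C * (M * t) ^ n / fact n)"
        using t x nn \<open>0 \<le> C\<close> \<open>0 \<le> M\<close> by (intro mult_right_mono mult_left_mono) auto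
      finally have "\<bar>A t\<bar> * \<bar>I f t\<bar> \<le> MA * (MB * L * (C * (M * t) ^ n / fact n))"
        using MA[of t] t x nn by (intro mult_mono) auto
      also have "\<dots> = C * M ^ Suc n / fact n * t ^ n"
        by (simp add: M_def power_mult_distrib)
      finally show ?thesis by (simp add: abs_mult)
    qed
    have hi: "((\<lambda>t. C * M ^ Suc n / fact n * t ^ n) has_integral
        C * M ^ Suc n / fact n * (x ^ Suc n / Suc n) - C * M ^ Suc n / fact n * (0 ^ Suc n / Suc n)) {0..x}"
    proof (rule fundamental_theorem_of_calculus)
      fix t
      show "((\<lambda>t. C * M ^ Suc n / fact n * (t ^ Suc n / Suc n)) has_vector_derivative
          C * M ^ Suc n / fact n * t ^ n) (at t within {0..x})"
        using DERIV_cmult[OF DERIV_cdivide[OF DERIV_pow[of "Suc n" t "{0..x}"]],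
            of "C * M ^ Suc n / fact n" "real (Suc n)"]
        unfolding has_real_derivative_iff_has_vector_derivative
        by (simp del: power_Suc of_nat_Suc)
    qed (use x in auto)
    have "norm (K f x) \<le> integral {0..x} (\<lambda>t. C * M ^ Suc n / fact n * t ^ n)"
      unfolding K_def
      by (rule integral_norm_bound_integral) (use AI_int[OF f] x hi Ib in \<open>auto simp: has_integral_integrable\<close>)
    also have "\<dots> = C * M ^ Suc n / fact n * (x ^ Suc n / Suc n)"
      using integral_unique[OF hi] by simp
    also have "\<dots> = C * (M * x) ^ Suc n / fact (Suc n)"
      by (simp add: power_mult_distrib mult_ac)
    finally show ?thesis by simp
  qed
  define U0 where "U0 x = u0 + integral {0..x} (\<lambda>t. A t * v0)" for x
  have Av0: "continuous_on {0..L} (\<lambda>t. A t * v0)" by (intro continuous_intros A)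
  have U0_cont: "continuous_on {0..L} U0" unfolding U0_def[abs_def]
    by (intro continuous_intros indefinite_integral_continuous_1 integrable_continuous_real A)
  define X where "X = rec_nat U0 (\<lambda>_ f x. U0 x + K f x)"
  have X0: "X 0 = U0" and XS: "X (Suc n) = (\<lambda>x. U0 x + K (X n) x)" for n
    by (simp_all add: X_def)
  have X_cont: "continuous_on {0..L} (X n)" for n
    by (induction n) (auto simp: X0 XS intro!: continuous_intros U0_cont K_cont)
  have D_cont: "continuous_on {0..L} (\<lambda>x. X (Suc n) x - X n x)" for n
    by (intro continuous_intros X_cont)
  obtain C where C: "\<And>x. x \<in> {0..L} \<Longrightarrow> \<bar>X (Suc 0) x - X 0 x\<bar> \<le> C" using bdd[OF D_cont] by blast
  have "0 \<le> C" using C[of 0] \<open>0 < L\<close> by auto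
  have D_bound: "\<bar>X (Suc n) x - X n x\<bar> \<le> C * (M * x) ^ n / fact n" if "x \<in> {0..L}" for n x
    using that
  proof (induction n arbitrary: x)
    case 0 then show ?case using C by simp
  next
    case (Suc n)
    have "X (Suc (Suc n)) x - X (Suc n) x = K (X (Suc n)) x - K (X n) x"
      by (simp add: XS[of "Suc n"] XS[of n])
    also have "\<dots> = K (\<lambda>x. X (Suc n) x - X n x) x"
      using Suc.prems by (intro K_diff X_cont) auto
    finally show ?case using K_bound[OF D_cont Suc.IH Suc.prems \<open>0 \<le> C\<close>] by simp
  qed
  have "uniform_limit {0..L} (\<lambda>N x. \<Sum>n<N. X (Suc n) x - X n x) (\<lambda>x. \<Sum>n. X (Suc n) x - X n x) sequentially"
  proof (rule Weierstrass_m_test)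
    fix n x assume x: "x \<in> {0..L}"
    have "\<bar>X (Suc n) x - X n x\<bar> \<le> C * (M * x) ^ n / fact n" by (rule D_bound[OF x])
    also have "\<dots> \<le> C * ((M * L) ^ n / fact n)"
      using x \<open>0 \<le> C\<close> \<open>0 \<le> M\<close> by (auto intro!: divide_right_mono mult_left_mono power_mono)
    finally show "norm (X (Suc n) x - X n x) \<le> C * ((M * L) ^ n / fact n)" by simp
  next
    show "summable (\<lambda>n. C * ((M * L) ^ n / fact n))"
      using summable_exp[of "M * L"] by (intro summable_mult) (simp add: field_simps)
  qed
  moreover have tel: "(\<Sum>n<N. X (Suc n) x - X n x) = X N x - U0 x" for N x
    using sum_lessThan_telescope[of "\<lambda>n. X n x" N] by (simp add: X0)
  moreover define u where "u x = U0 x + (\<Sum>n. X (Suc n) x - X n x)" for x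
  ultimately have lim: "uniform_limit {0..L} X u sequentially"
    unfolding uniform_limit_iff u_def tel dist_real_def by (simp add: algebra_simps)
  have u_cont: "continuous_on {0..L} u"
    by (rule uniform_limit_theorem[OF _ lim]) (auto simp: X_cont)
  have u_eq: "u x = U0 x + K u x" if x: "x \<in> {0..L}" for x
  proof -
    have "(\<lambda>n. K (X n) x) \<longlonglongrightarrow> K u x"
    proof (rule LIMSEQ_I)
      fix e :: real assume "e > 0"
      define e' where "e' = e / (M * L + 1)"
      have pos: "M * L + 1 > 0" using \<open>0 \<le> M\<close> \<open>0 < L\<close> by (simp add: add_nonneg_pos)
      then have "e' > 0" using \<open>e > 0\<close> by (simp add: e'_def)
      then obtain N where N: "\<And>n x. n \<ge> N \<Longrightarrow> x \<in> {0..L} \<Longrightarrow> \<bar>X n x - u x\<bar> < e'"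
        using lim unfolding uniform_limit_iff eventually_sequentially dist_real_def by blast
      have "norm (K (X n) x - K u x) < e" if "n \<ge> N" for n
      proof -
        have "K (X n) x - K u x = K (\<lambda>x. X n x - u x) x"
          using x by (intro K_diff X_cont u_cont) auto
        moreover have "\<bar>K (\<lambda>x. X n x - u x) x\<bar> \<le> e' * (M * x) ^ Suc 0 / fact (Suc 0)"
          using N[OF that] x \<open>e' > 0\<close>
          by (intro K_bound continuous_intros X_cont u_cont) (auto intro: less_imp_le)
        moreover have "e' * (M * x) \<le> e' * (M * L)"
          using x \<open>0 \<le> M\<close> \<open>e' > 0\<close> by (intro mult_left_mono) auto
        moreover have "e' * (M * L) < e"
          using pos \<open>e > 0\<close> by (simp add: e'_def field_simps)
        ultimately show ?thesis by simp
      qed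
      then show "\<exists>N. \<forall>n\<ge>N. norm (K (X n) x - K u x) < e" by blast
    qed
    then have "(\<lambda>n. X (Suc n) x) \<longlonglongrightarrow> U0 x + K u x"
      unfolding XS by (intro tendsto_intros)
    moreover have "(\<lambda>n. X (Suc n) x) \<longlonglongrightarrow> u x"
      using tendsto_uniform_limitI[OF lim x] by (rule LIMSEQ_Suc)
    ultimately show ?thesis by (rule LIMSEQ_unique[symmetric])
  qed
  define v where "v x = v0 + I u x" for x
  have v_cont: "continuous_on {0..L} v" unfolding v_def by (intro continuous_intros I_cont u_cont)
  have u_int: "u x = u0 + integral {0..x} (\<lambda>t. A t * v t)" if x: "x \<in> {0..L}" for x
  proof -
    have "(\<lambda>t. A t * v0) integrable_on {0..x}"
      using x continuous_on_subset[OF Av0] by (intro integrable_continuous_real) auto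
    then show ?thesis
      using u_eq[OF x] integral_add[OF _ AI_int[OF u_cont], of "\<lambda>t. A t * v0" x] x
      by (simp add: v_def U0_def K_def distrib_left)
  qed
  have du: "(u has_real_derivative A x * v x) (at x within {0..L})" if x: "x \<in> {0..L}" for x
  proof -
    have "((\<lambda>x. u0 + integral {0..x} (\<lambda>t. A t * v t)) has_real_derivative 0 + A x * v x) (at x within {0..L})"
      by (intro derivative_intros integral_has_real_derivative continuous_intros A v_cont x)
    then show ?thesis
      by (rule has_field_derivative_transform_within[where d=1, THEN DERIV_cong]) (use x u_int in auto)
  qed
  have dv: "(v has_real_derivative B x * u x) (at x)" if x: "x \<in> {0<..<L} - {c}" for x
  proof -
    have "continuous (at x within {0..L} - {c}) (\<lambda>s. B s * u s)"
    proof -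
      have op: "open ({0<..<L} - {c})" by (simp add: open_Diff)
      have "continuous (at x within {0..L}) B1" "continuous (at x within {0..L}) B2"
        "continuous (at x within {0..L}) u"
        using B12 u_cont x by (auto simp: continuous_on_eq_continuous_within)
      moreover have at: "at x within {0..L} = at x" "at x within {0..L} - {c} = at x"
        using x by (auto intro!: at_within_interior simp: interior_diff)
      ultimately have ct: "isCont B1 x" "isCont B2 x" "isCont u x" by auto
      have "isCont B x"
      proof (cases "x < c")
        case True
        then have "eventually (\<lambda>y. B y = B1 y) (nhds x)"
          by (intro eventually_nhds_in_open[of "{..<c}", THEN eventually_mono]) (auto simp: B_def)
        then show ?thesis using ct(1) isCont_cong by blast
      next
        case False
        then have "x > c" using x by auto
        then have "eventually (\<lambda>y. B y = B2 y) (nhds x)"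
          by (intro eventually_nhds_in_open[of "{c<..}", THEN eventually_mono]) (auto simp: B_def)
        then show ?thesis using ct(2) isCont_cong by blast
      qed
      then show ?thesis using ct(3) at by (auto intro!: continuous_intros)
    qed
    then have "((\<lambda>t. integral {0..t} (\<lambda>s. B s * u s)) has_vector_derivative B x * u x)
        (at x within {0..L} - {c})"
      using x by (intro integral_has_vector_derivative_continuous_at int u_cont) auto
    moreover have "at x within {0..L} - {c} = at x"
      using x by (auto intro!: at_within_interior simp: interior_diff)
    ultimately have "(I u has_real_derivative B x * u x) (at x)"
      by (simp add: I_def[abs_def] has_real_derivative_iff_has_vector_derivative)
    then show ?thesis unfolding v_def[abs_def] by (auto intro!: derivative_eq_intros)
  qed
  show ?thesis
    using du dv v_cont u_int[of 0] \<open>0 < L\<close>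
    by (intro exI[of _ u] exI[of _ v]) (auto simp: v_def I_def)
qed

section \<open>The principal eigenvalue\<close>

lemma linear_system_growth:
  fixes A B g u v :: "real \<Rightarrow> real"
  assumes "0 \<le> x" "x \<le> L" "finite F" "0 \<le> M"
    and u: "continuous_on {0..L} u" and v: "continuous_on {0..L} v"
    and du: "\<And>x. x \<in> {0<..<L} - F \<Longrightarrow> (u has_real_derivative A x * v x) (at x)"
    and dv: "\<And>x. x \<in> {0<..<L} - F \<Longrightarrow> (v has_real_derivative B x * u x + g x) (at x)"
    and bnd: "\<And>x. x \<in> {0<..<L} - F \<Longrightarrow> \<bar>A x\<bar> \<le> M \<and> \<bar>B x\<bar> \<le> M \<and> \<bar>g x\<bar> \<le> \<delta>"
  shows "(u x)\<^sup>2 + (v x)\<^sup>2 + \<delta>\<^sup>2 \<le> exp ((2*M+1) * x) * ((u 0)\<^sup>2 + (v 0)\<^sup>2 + \<delta>\<^sup>2)"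
    and "(u 0)\<^sup>2 + (v 0)\<^sup>2 + \<delta>\<^sup>2 \<le> exp ((2*M+1) * x) * ((u x)\<^sup>2 + (v x)\<^sup>2 + \<delta>\<^sup>2)"
proof -
  define E where "E x = (u x)\<^sup>2 + (v x)\<^sup>2 + \<delta>\<^sup>2" for x
  have E_cont: "continuous_on {0..x} E"
    using assms(2) unfolding E_def[abs_def]
    by (intro continuous_intros continuous_on_subset[OF u] continuous_on_subset[OF v]) auto
  have dE: "\<exists>D. (E has_real_derivative D) (at y) \<and> \<bar>D\<bar> \<le> (2*M+1) * E y"
    if y: "y \<in> {0<..<L} - F" for y
  proof (intro exI conjI)
    show "(E has_real_derivative 2 * u y * (A y * v y) + 2 * v y * (B y * u y + g y)) (at y)"
      unfolding E_def[abs_def] by (rule derivative_eq_intros du dv y refl)+ simp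
    have am: "2 * \<bar>p * q\<bar> \<le> p\<^sup>2 + q\<^sup>2" for p q :: real
      using sum_squares_bound[of "\<bar>p\<bar>" "\<bar>q\<bar>"] by (simp add: abs_mult)
    have "\<bar>2 * u y * (A y * v y) + 2 * v y * (B y * u y + g y)\<bar>
        \<le> \<bar>2 * u y * (A y * v y)\<bar> + \<bar>2 * v y * (B y * u y)\<bar> + \<bar>2 * v y * g y\<bar>"
      unfolding distrib_left by linarith
    moreover have "\<bar>2 * u y * (A y * v y)\<bar> = \<bar>A y\<bar> * (2 * \<bar>u y * v y\<bar>)"
      "\<bar>2 * v y * (B y * u y)\<bar> = \<bar>B y\<bar> * (2 * \<bar>u y * v y\<bar>)"
      by (simp_all add: abs_mult mult_ac)
    moreover have "\<bar>A y\<bar> * (2 * \<bar>u y * v y\<bar>) \<le> M * ((u y)\<^sup>2 + (v y)\<^sup>2)"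
      "\<bar>B y\<bar> * (2 * \<bar>u y * v y\<bar>) \<le> M * ((u y)\<^sup>2 + (v y)\<^sup>2)"
      using bnd[OF y] am[of "u y" "v y"] \<open>0 \<le> M\<close> by (auto intro!: mult_mono)
    moreover have "\<bar>2 * v y * g y\<bar> \<le> (v y)\<^sup>2 + (g y)\<^sup>2"
      using am[of "v y" "g y"] by (simp add: abs_mult)
    moreover have "(g y)\<^sup>2 \<le> \<delta>\<^sup>2"
      using bnd[OF y] by (intro abs_le_square_iff[THEN iffD1]) auto
    moreover have "0 \<le> 2 * M * \<delta>\<^sup>2" "0 \<le> (u y)\<^sup>2" using \<open>0 \<le> M\<close> by auto
    moreover have "(2*M+1) * E y = 2 * (M * ((u y)\<^sup>2 + (v y)\<^sup>2)) + (u y)\<^sup>2 + (v y)\<^sup>2 + \<delta>\<^sup>2 + 2 * M * \<delta>\<^sup>2"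
      unfolding E_def by (simp add: algebra_simps)
    ultimately show "\<bar>2 * u y * (A y * v y) + 2 * v y * (B y * u y + g y)\<bar> \<le> (2*M+1) * E y"
      by linarith
  qed
  have "- (exp (-(2*M+1) * 0) * E 0) \<le> - (exp (-(2*M+1) * x) * E x)"
  proof (rule nondecreasing_off_finite[OF assms(1,3)])
    show "continuous_on {0..x} (\<lambda>x. - (exp (-(2*M+1) * x) * E x))"
      by (intro continuous_intros E_cont)
    fix y assume "y \<in> {0<..<x} - F"
    then obtain D where D: "(E has_real_derivative D) (at y)" "\<bar>D\<bar> \<le> (2*M+1) * E y"
      using dE[of y] assms(2) by auto
    have "((\<lambda>x. - (exp (-(2*M+1) * x) * E x)) has_real_derivative
        exp (-(2*M+1) * y) * ((2*M+1) * E y - D)) (at y)"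
      by (rule derivative_eq_intros D refl)+ (simp add: algebra_simps)
    moreover have "0 \<le> (2*M+1) * E y - D" using D(2) by linarith
    ultimately show "\<exists>D. ((\<lambda>x. - (exp (-(2*M+1) * x) * E x)) has_real_derivative D) (at y) \<and> 0 \<le> D"
      by (meson exp_ge_zero mult_nonneg_nonneg)
  qed
  then have "exp (-(2*M+1) * x) * E x \<le> E 0" by simp
  then have "exp ((2*M+1) * x) * (exp (-(2*M+1) * x) * E x) \<le> exp ((2*M+1) * x) * E 0"
    by (intro mult_left_mono) auto
  then show "(u x)\<^sup>2 + (v x)\<^sup>2 + \<delta>\<^sup>2 \<le> exp ((2*M+1) * x) * ((u 0)\<^sup>2 + (v 0)\<^sup>2 + \<delta>\<^sup>2)"
    using exp_minus_inverse[of "(2*M+1) * x"]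
    by (metis E_def mult.assoc mult_1 minus_mult_left)
  have "exp ((2*M+1) * 0) * E 0 \<le> exp ((2*M+1) * x) * E x"
  proof (rule nondecreasing_off_finite[OF assms(1,3)])
    show "continuous_on {0..x} (\<lambda>x. exp ((2*M+1) * x) * E x)"
      by (intro continuous_intros E_cont)
    fix y assume "y \<in> {0<..<x} - F"
    then obtain D where D: "(E has_real_derivative D) (at y)" "\<bar>D\<bar> \<le> (2*M+1) * E y"
      using dE[of y] assms(2) by auto
    have "((\<lambda>x. exp ((2*M+1) * x) * E x) has_real_derivative
        exp ((2*M+1) * y) * ((2*M+1) * E y + D)) (at y)"
      by (rule derivative_eq_intros D refl)+ (simp add: algebra_simps)
    moreover have "0 \<le> (2*M+1) * E y + D" using D(2) by linarith
    ultimately show "\<exists>D. ((\<lambda>x. exp ((2*M+1) * x) * E x) has_real_derivative D) (at y) \<and> 0 \<le> D"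
      by (meson exp_ge_zero mult_nonneg_nonneg)
  qed
  then show "(u 0)\<^sup>2 + (v 0)\<^sup>2 + \<delta>\<^sup>2 \<le> exp ((2*M+1) * x) * ((u x)\<^sup>2 + (v x)\<^sup>2 + \<delta>\<^sup>2)"
    by (simp add: E_def)
qed

lemma principal_eigenpair_exists:
  fixes s s1 s2 :: "real \<Rightarrow> real" and c :: real
  assumes "d > 0" "a > 0" "L > 0"
    and s12: "continuous_on {0..L} s1" "continuous_on {0..L} s2"
    and s: "\<And>x. x \<in> {0..L} \<Longrightarrow> s x = (if x < c then s1 x else s2 x)"
  shows "\<exists>lam phi. is_pos_eigenpair d a s 0 L lam phi"
proof -
  define \<kappa> where "\<kappa> = a / d"
  have "\<kappa> > 0" using assms by (simp add: \<kappa>_def)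
  define B where "B lam x = exp (- \<kappa> * x) * (lam - s x) / d" for lam x
  define Q where "Q lam u v \<longleftrightarrow> (\<forall>x\<in>{0..L}. (u has_real_derivative exp (\<kappa> * x) * v x) (at x within {0..L}))
      \<and> continuous_on {0..L} v
      \<and> (\<forall>x\<in>{0<..<L} - {c}. (v has_real_derivative B lam x * u x) (at x))
      \<and> u 0 = 1 \<and> v 0 = \<kappa>" for lam u v
  have "\<exists>u v. Q lam u v" for lam
  proof -
    let ?B1 = "\<lambda>x. exp (- \<kappa> * x) * (lam - s1 x) / d" and ?B2 = "\<lambda>x. exp (- \<kappa> * x) * (lam - s2 x) / d"
    have cts: "continuous_on {0..L} (\<lambda>x. exp (\<kappa> * x))" "continuous_on {0..L} ?B1"
      "continuous_on {0..L} ?B2"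
      using \<open>d > 0\<close> by (auto intro!: continuous_intros s12)
    obtain u v where uv: "\<forall>x\<in>{0..L}. (u has_real_derivative exp (\<kappa> * x) * v x) (at x within {0..L})"
      "continuous_on {0..L} v"
      "\<forall>x\<in>{0<..<L} - {c}. (v has_real_derivative (if x < c then ?B1 x else ?B2 x) * u x) (at x)"
      "u 0 = 1" "v 0 = \<kappa>"
      using linear_system_exists[OF \<open>L > 0\<close> cts, of c 1 \<kappa>] by blast
    have eq: "(if x < c then ?B1 x else ?B2 x) = B lam x" if "x \<in> {0<..<L} - {c}" for x
      using that s[of x] by (simp add: B_def)
    have "\<forall>x\<in>{0<..<L} - {c}. (v has_real_derivative B lam x * u x) (at x)"
    proof
      fix x assume x: "x \<in> {0<..<L} - {c}"
      show "(v has_real_derivative B lam x * u x) (at x)"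
        using bspec[OF uv(3) x] unfolding eq[OF x] .
    qed
    with uv(1,2,4,5) have "Q lam u v" unfolding Q_def by (intro conjI)
    then show ?thesis by (intro exI)
  qed
  then have "\<forall>lam. \<exists>p. Q lam (fst p) (snd p)" by simp
  then obtain p where p: "\<And>lam. Q lam (fst (p lam)) (snd (p lam))" by (metis choice)
  define U where "U = (\<lambda>lam. fst (p lam))"
  define V where "V = (\<lambda>lam. snd (p lam))"
  have UV: "Q lam (U lam) (V lam)" for lam unfolding U_def V_def by (rule p)
  have dU: "\<And>lam x. x \<in> {0..L} \<Longrightarrow> (U lam has_real_derivative exp (\<kappa> * x) * V lam x) (at x within {0..L})"
    and V_cont: "\<And>lam. continuous_on {0..L} (V lam)"
    and dV: "\<And>lam x. x \<in> {0<..<L} - {c} \<Longrightarrow> (V lam has_real_derivative B lam x * U lam x) (at x)"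
    and init: "\<And>lam. U lam 0 = 1" "\<And>lam. V lam 0 = \<kappa>"
    using UV by (simp_all add: Q_def)
  have U_cont: "continuous_on {0..L} (U lam)" for lam
    using dU by (rule DERIV_continuous_on)
  have dU': "(U lam has_real_derivative exp (\<kappa> * x) * V lam x) (at x)" if "x \<in> {0<..<L}" for lam x
  proof -
    have "at x within {0..L} = at x" using that by (auto intro!: at_within_interior)
    then show ?thesis using dU[of x lam] that by auto
  qed
  note bdd = continuous_on_Icc_bounded
  obtain S1 where S1: "\<And>x. x \<in> {0..L} \<Longrightarrow> \<bar>s1 x\<bar> \<le> S1" using bdd[OF s12(1)] by blast
  obtain S2 where S2: "\<And>x. x \<in> {0..L} \<Longrightarrow> \<bar>s2 x\<bar> \<le> S2" using bdd[OF s12(2)] by blast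
  define S where "S = max S1 S2"
  have S: "\<bar>s x\<bar> \<le> S" if "x \<in> {0..L}" for x
    using S1[OF that] S2[OF that] s[OF that] by (auto simp: S_def)
  define P where "P = {lam. (\<forall>x\<in>{0..L}. 0 < U lam x) \<and> 0 < V lam L}"

  have "S \<in> P"
  proof -
    have UV: "\<kappa> \<le> U S x * V S x" if x: "x \<in> {0..L}" for x
    proof -
      have "U S 0 * V S 0 \<le> U S x * V S x"
      proof (rule nondecreasing_off_finite[of 0 x "{c}" "\<lambda>x. U S x * V S x"])
        show "continuous_on {0..x} (\<lambda>x. U S x * V S x)"
          using x by (intro continuous_intros continuous_on_subset[OF U_cont] continuous_on_subset[OF V_cont]) auto
        fix y assume y: "y \<in> {0<..<x} - {c}"
        then have y': "y \<in> {0<..<L} - {c}" "y \<in> {0<..<L}" using x by auto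
        have "((\<lambda>x. U S x * V S x) has_real_derivative
            exp (\<kappa> * y) * (V S y)\<^sup>2 + B S y * (U S y)\<^sup>2) (at y)"
          by (rule derivative_eq_intros dU'[OF y'(2)] dV[OF y'(1)] refl)+ (simp add: power2_eq_square)
        moreover have "0 \<le> B S y" using S[of y] y' \<open>d > 0\<close> by (auto simp: B_def)
        then have "0 \<le> exp (\<kappa> * y) * (V S y)\<^sup>2 + B S y * (U S y)\<^sup>2" by simp
        ultimately show "\<exists>D. ((\<lambda>x. U S x * V S x) has_real_derivative D) (at y) \<and> 0 \<le> D"
          by blast
      qed (use x in auto)
      then show ?thesis by (simp add: init)
    qed
    have pos: "0 < U S x" if x: "x \<in> {0..L}" for x
    proof (rule ccontr)
      assume "\<not> 0 < U S x"
      then have "\<exists>y\<ge>0. y \<le> x \<and> U S y = 0"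
        using x by (intro IVT2' continuous_on_subset[OF U_cont]) (auto simp: init)
      then obtain y where "0 \<le> y" "y \<le> x" "U S y = 0" by blast
      then show False using UV[of y] \<open>\<kappa> > 0\<close> x by simp
    qed
    have "0 < V S L"
      using UV[of L] \<open>\<kappa> > 0\<close> \<open>L > 0\<close> pos[of L] zero_less_mult_pos[of "U S L" "V S L"] by simp
    with pos show ?thesis by (simp add: P_def)
  qed

  define m where "m = - S - d * \<kappa> * exp (\<kappa> * L) / L"
  have P_lower: "m \<le> lam" if "lam \<in> P" for lam
  proof (rule ccontr)
    assume "\<not> m \<le> lam"
    define b where "b = exp (- \<kappa> * L) * (- S - lam) / d"
    have "d * \<kappa> * exp (\<kappa> * L) / L < - S - lam" using \<open>\<not> m \<le> lam\<close> by (simp add: m_def)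
    then have "exp (- \<kappa> * L) * (d * \<kappa> * exp (\<kappa> * L) / L) < exp (- \<kappa> * L) * (- S - lam)"
      by (intro mult_strict_left_mono) auto
    then have "\<kappa> < b * L" using \<open>d > 0\<close> \<open>L > 0\<close>
      by (simp add: b_def field_simps flip: exp_add)
    have neg: "lam + S < 0"
      using \<open>d * \<kappa> * exp (\<kappa> * L) / L < - S - lam\<close> \<open>d > 0\<close> \<open>\<kappa> > 0\<close> \<open>L > 0\<close>
      by (smt (verit) divide_pos_pos exp_gt_zero mult_pos_pos)
    have Bneg: "B lam x \<le> - b" if "x \<in> {0..L}" for x
    proof -
      have "exp (- \<kappa> * L) \<le> exp (- \<kappa> * x)" using that \<open>\<kappa> > 0\<close> by simp
      then have "exp (- \<kappa> * L) * (- S - lam) \<le> exp (- \<kappa> * x) * (s x - lam)"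
        using neg S[OF that] by (intro mult_mono) auto
      then show ?thesis using divide_right_mono[OF _ less_imp_le[OF \<open>d > 0\<close>]]
        by (fastforce simp: B_def b_def right_diff_distrib diff_divide_distrib)
    qed
    have "b > 0" using neg \<open>d > 0\<close> by (simp add: b_def)
    have Vpos: "0 < V lam x" if x: "x \<in> {0..L}" for x
    proof -
      have "- V lam x \<le> - V lam L"
      proof (rule nondecreasing_off_finite[of x L "{c}" "\<lambda>x. - V lam x"])
        show "continuous_on {x..L} (\<lambda>x. - V lam x)"
          using x by (intro continuous_intros continuous_on_subset[OF V_cont]) auto
        fix y assume "y \<in> {x<..<L} - {c}"
        then have y: "y \<in> {0<..<L} - {c}" using x by auto
        have "0 < U lam y" using \<open>lam \<in> P\<close> y by (auto simp: P_def)
        then have "0 \<le> - (B lam y * U lam y)"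
          using Bneg[of y] \<open>b > 0\<close> y by (simp add: mult_nonpos_nonneg)
        then show "\<exists>D. ((\<lambda>x. - V lam x) has_real_derivative D) (at y) \<and> 0 \<le> D"
          using DERIV_minus[OF dV[OF y]] by blast
      qed (use x in auto)
      then show ?thesis using \<open>lam \<in> P\<close> by (auto simp: P_def)
    qed
    have Uge: "1 \<le> U lam x" if x: "x \<in> {0..L}" for x
    proof -
      have "U lam 0 \<le> U lam x"
      proof (rule nondecreasing_off_finite[of 0 x "{}"])
        show "continuous_on {0..x} (U lam)"
          using x by (intro continuous_on_subset[OF U_cont]) auto
        fix y assume "y \<in> {0<..<x} - {}"
        then have y: "y \<in> {0<..<L}" using x by auto
        then have "0 \<le> exp (\<kappa> * y) * V lam y" using Vpos[of y] by simp
        then show "\<exists>D. (U lam has_real_derivative D) (at y) \<and> 0 \<le> D"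
          using dU'[OF y] by blast
      qed (use x in auto)
      then show ?thesis by (simp add: init)
    qed
    have "- V lam 0 - b * 0 \<le> - V lam L - b * L"
    proof (rule nondecreasing_off_finite[of 0 L "{c}" "\<lambda>x. - V lam x - b * x"])
      show "continuous_on {0..L} (\<lambda>x. - V lam x - b * x)"
        by (intro continuous_intros V_cont)
      fix y assume y: "y \<in> {0<..<L} - {c}"
      have "((\<lambda>x. - V lam x - b * x) has_real_derivative - (B lam y * U lam y) - b) (at y)"
        by (rule derivative_eq_intros dV[OF y] refl)+ simp
      moreover have "b * 1 \<le> (- B lam y) * U lam y"
        using Bneg[of y] Uge[of y] \<open>b > 0\<close> y by (intro mult_mono) auto
      then have "0 \<le> - (B lam y * U lam y) - b" by simp
      ultimately show "\<exists>D. ((\<lambda>x. - V lam x - b * x) has_real_derivative D) (at y) \<and> 0 \<le> D"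
        by blast
    qed (use \<open>L > 0\<close> in auto)
    then have "V lam L \<le> \<kappa> - b * L" by (simp add: init)
    then show False using Vpos[of L] \<open>\<kappa> < b * L\<close> \<open>L > 0\<close> by simp
  qed

  have cont: "\<exists>\<delta>>0. \<forall>mu. \<bar>mu - lam\<bar> < \<delta> \<longrightarrow> (\<forall>x\<in>{0..L}. \<bar>U mu x - U lam x\<bar> < e \<and> \<bar>V mu x - V lam x\<bar> < e)"
    if "e > 0" for lam e
  proof -
    obtain G where G: "\<And>x. x \<in> {0..L} \<Longrightarrow> \<bar>U lam x\<bar> \<le> G" using bdd[OF U_cont] by blast
    have "G \<ge> 0" using G[of 0] \<open>L > 0\<close> by auto
    define M where "M = max (exp (\<kappa> * L)) ((\<bar>lam\<bar> + 1 + S) / d)"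
    have "M \<ge> 0" unfolding M_def by (simp add: le_max_iff_disj)
    define C where "C = exp ((2*M+1) * L) * (G / d + 1)"
    have "C > 0" using \<open>G \<ge> 0\<close> \<open>d > 0\<close> by (simp add: C_def add_nonneg_pos)
    have est: "\<bar>U mu x - U lam x\<bar> \<le> C * \<bar>mu - lam\<bar> \<and> \<bar>V mu x - V lam x\<bar> \<le> C * \<bar>mu - lam\<bar>"
      if mu: "\<bar>mu - lam\<bar> < 1" and x: "x \<in> {0..L}" for mu x
    proof -
      define \<delta> where "\<delta> = \<bar>mu - lam\<bar> * (G / d + 1)"
      have "\<delta> \<ge> 0" using \<open>G \<ge> 0\<close> \<open>d > 0\<close> by (simp add: \<delta>_def)
      have "(U mu x - U lam x)\<^sup>2 + (V mu x - V lam x)\<^sup>2 + \<delta>\<^sup>2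
          \<le> exp ((2*M+1) * x) * ((U mu 0 - U lam 0)\<^sup>2 + (V mu 0 - V lam 0)\<^sup>2 + \<delta>\<^sup>2)"
      proof (rule linear_system_growth(1)[where F="{c}" and A="\<lambda>x. exp (\<kappa> * x)" and B="B mu"
            and g="\<lambda>x. (B mu x - B lam x) * U lam x" and L=L
            and u="\<lambda>x. U mu x - U lam x" and v="\<lambda>x. V mu x - V lam x"])
        fix y assume y: "y \<in> {0<..<L} - {c}"
        show "((\<lambda>x. U mu x - U lam x) has_real_derivative exp (\<kappa> * y) * (V mu y - V lam y)) (at y)"
          using DERIV_diff[OF dU' dU', of y mu lam] y by (auto simp: right_diff_distrib)
        show "((\<lambda>x. V mu x - V lam x) has_real_derivative
            B mu y * (U mu y - U lam y) + (B mu y - B lam y) * U lam y) (at y)"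
          using DERIV_diff[OF dV[OF y] dV[OF y], of mu lam] by (simp add: algebra_simps)
        have e1: "exp (- \<kappa> * y) \<le> 1" using y \<open>\<kappa> > 0\<close> by simp
        have "\<bar>mu - s y\<bar> \<le> \<bar>lam\<bar> + 1 + S" using S[of y] mu y by auto
        then have "exp (- \<kappa> * y) * \<bar>mu - s y\<bar> / d \<le> 1 * (\<bar>lam\<bar> + 1 + S) / d"
          using e1 \<open>d > 0\<close> by (intro divide_right_mono mult_mono) auto
        then have "\<bar>B mu y\<bar> \<le> (\<bar>lam\<bar> + 1 + S) / d"
          using \<open>d > 0\<close> by (simp add: B_def abs_mult)
        then have "\<bar>B mu y\<bar> \<le> M" by (simp add: M_def le_max_iff_disj)
        moreover have "B mu y - B lam y = exp (- \<kappa> * y) * ((mu - lam) / d)"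
          by (simp add: B_def right_diff_distrib diff_divide_distrib)
        then have "\<bar>B mu y - B lam y\<bar> \<le> 1 * (\<bar>mu - lam\<bar> / d)"
          using e1 \<open>d > 0\<close> by (simp add: abs_mult divide_right_mono mult_left_le_one_le)
        then have "\<bar>(B mu y - B lam y) * U lam y\<bar> \<le> (\<bar>mu - lam\<bar> / d) * G"
          unfolding abs_mult using G[of y] y \<open>d > 0\<close> by (intro mult_mono) auto
        then have "\<bar>(B mu y - B lam y) * U lam y\<bar> \<le> \<delta>"
          by (simp add: \<delta>_def algebra_simps)
        moreover have "\<bar>exp (\<kappa> * y)\<bar> \<le> M"
          using y \<open>\<kappa> > 0\<close> by (simp add: M_def le_max_iff_disj)
        ultimately show "\<bar>exp (\<kappa> * y)\<bar> \<le> M \<and> \<bar>B mu y\<bar> \<le> M \<and> \<bar>(B mu y - B lam y) * U lam y\<bar> \<le> \<delta>"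
          by blast
      qed (use x \<open>M \<ge> 0\<close> in \<open>auto intro!: continuous_intros U_cont V_cont\<close>)
      also have "\<dots> = exp ((2*M+1) * x) * \<delta>\<^sup>2" by (simp add: init)
      also have "\<dots> \<le> (exp ((2*M+1) * L))\<^sup>2 * \<delta>\<^sup>2"
      proof (rule mult_right_mono)
        have "exp ((2*M+1) * x) \<le> exp ((2*M+1) * L)" using x \<open>M \<ge> 0\<close> by (simp add: mult_left_mono)
        also have "\<dots> \<le> (exp ((2*M+1) * L))\<^sup>2"
          using \<open>M \<ge> 0\<close> \<open>L > 0\<close> by (intro self_le_power) auto
        finally show "exp ((2*M+1) * x) \<le> (exp ((2*M+1) * L))\<^sup>2" .
      qed simp
      also have "\<dots> = (C * \<bar>mu - lam\<bar>)\<^sup>2" by (simp add: C_def \<delta>_def power_mult_distrib)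
      finally have "(U mu x - U lam x)\<^sup>2 + (V mu x - V lam x)\<^sup>2 + \<delta>\<^sup>2 \<le> (C * \<bar>mu - lam\<bar>)\<^sup>2" .
      then have "(U mu x - U lam x)\<^sup>2 \<le> (C * \<bar>mu - lam\<bar>)\<^sup>2" "(V mu x - V lam x)\<^sup>2 \<le> (C * \<bar>mu - lam\<bar>)\<^sup>2"
        by (smt (verit) zero_le_power2)+
      then show ?thesis using \<open>C > 0\<close>
        by (metis abs_le_square_iff abs_mult abs_of_pos abs_abs)
    qed
    show ?thesis
    proof (intro exI conjI allI impI ballI)
      show "0 < min 1 (e / C)" using \<open>C > 0\<close> \<open>e > 0\<close> by simp
      fix mu x assume mu: "\<bar>mu - lam\<bar> < min 1 (e / C)" and x: "x \<in> {0..L}"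
      have "C * \<bar>mu - lam\<bar> < e" using mu \<open>C > 0\<close> by (simp add: field_simps)
      then show "\<bar>U mu x - U lam x\<bar> < e" "\<bar>V mu x - V lam x\<bar> < e"
        using est[OF _ x, of mu] mu by auto
    qed
  qed

  define lam where "lam = Inf P"
  have bdd_P: "bdd_below P" using P_lower by (auto simp: bdd_below_def)
  have L_in: "L \<in> {0..L}" using \<open>L > 0\<close> by simp
  have "lam \<notin> P"
  proof
    assume "lam \<in> P"
    obtain x0 where x0: "x0 \<in> {0..L}" "\<And>y. y \<in> {0..L} \<Longrightarrow> U lam x0 \<le> U lam y"
      using continuous_attains_inf[OF compact_Icc _ U_cont, of lam] \<open>L > 0\<close> by fastforce
    define e where "e = min (U lam x0) (V lam L)"
    have "e > 0" using \<open>lam \<in> P\<close> x0 by (simp add: e_def P_def)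
    then obtain \<delta> where \<delta>: "\<delta> > 0" "\<And>mu x. \<bar>mu - lam\<bar> < \<delta> \<Longrightarrow> x \<in> {0..L} \<Longrightarrow>
        \<bar>U mu x - U lam x\<bar> < e \<and> \<bar>V mu x - V lam x\<bar> < e"
      using cont by blast
    have "0 < U (lam - \<delta>/2) x" if "x \<in> {0..L}" for x
      using \<delta>(2)[of "lam - \<delta>/2" x] \<delta>(1) that x0(2)[OF that] by (auto simp: e_def)
    moreover have "0 < V (lam - \<delta>/2) L"
      using \<delta>(2)[of "lam - \<delta>/2" L] \<delta>(1) L_in by (auto simp: e_def)
    ultimately have "lam - \<delta>/2 \<in> P" by (simp add: P_def)
    then have "lam \<le> lam - \<delta>/2" unfolding lam_def by (rule cInf_lower[OF _ bdd_P])
    then show False using \<delta>(1) by simp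
  qed
  have approx: "\<exists>mu\<in>P. \<forall>x\<in>{0..L}. \<bar>U mu x - U lam x\<bar> < e \<and> \<bar>V mu x - V lam x\<bar> < e" if e: "e > 0" for e
  proof -
    obtain \<delta> where \<delta>: "\<delta> > 0" "\<And>mu x. \<bar>mu - lam\<bar> < \<delta> \<Longrightarrow> x \<in> {0..L} \<Longrightarrow>
        \<bar>U mu x - U lam x\<bar> < e \<and> \<bar>V mu x - V lam x\<bar> < e"
      using cont[OF e] by blast
    obtain mu where "mu \<in> P" "mu < lam + \<delta>"
      using cInf_lessD[of P "lam + \<delta>"] \<open>S \<in> P\<close> \<delta>(1) by (auto simp: lam_def)
    moreover have "lam \<le> mu" unfolding lam_def by (rule cInf_lower[OF \<open>mu \<in> P\<close> bdd_P])
    ultimately show ?thesis using \<delta>(2)[of mu] by (intro bexI[of _ mu]) auto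
  qed
  have U_nonneg: "0 \<le> U lam x" if x: "x \<in> {0..L}" for x
  proof (rule ccontr)
    assume "\<not> 0 \<le> U lam x"
    then obtain mu where "mu \<in> P" "\<bar>U mu x - U lam x\<bar> < - U lam x"
      using approx[of "- U lam x"] x by force
    moreover from \<open>mu \<in> P\<close> have "0 < U mu x" using x by (auto simp: P_def)
    ultimately show False by linarith
  qed
  have V_nonneg: "0 \<le> V lam L"
  proof (rule ccontr)
    assume "\<not> 0 \<le> V lam L"
    then obtain mu where "mu \<in> P" "\<bar>V mu L - V lam L\<bar> < - V lam L"
      using approx[of "- V lam L"] L_in by auto
    then show False by (auto simp: P_def)
  qed
  have U_pos: "0 < U lam x" if x: "x \<in> {0..L}" for x
  proof (rule ccontr)
    assume "\<not> 0 < U lam x"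
    then have Ux: "U lam x = 0" using U_nonneg[OF x] by simp
    then have "x \<noteq> 0" using init(1)[of lam] by auto
    have "V lam x = 0"
    proof (cases "x = L")
      case True
      have "exp (\<kappa> * L) * V lam L \<le> 0"
        by (rule derivative_nonpos_at_right_end_min[OF \<open>L > 0\<close> dU[OF L_in]])
          (use True Ux U_nonneg in auto)
      then have "V lam L \<le> 0" by (simp add: mult_le_0_iff)
      then show ?thesis using V_nonneg True by simp
    next
      case False
      then have x': "x \<in> {0<..<L}" using x \<open>x \<noteq> 0\<close> by auto
      have "exp (\<kappa> * x) * V lam x = 0"
      proof (rule DERIV_local_min[OF dU'[OF x']])
        show "0 < min x (L - x)" using x' by auto
        show "\<forall>y. \<bar>x - y\<bar> < min x (L - x) \<longrightarrow> U lam x \<le> U lam y"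
          unfolding Ux by (intro allI impI U_nonneg) auto
      qed
      then show ?thesis by simp
    qed
    define M where "M = max (exp (\<kappa> * L)) ((\<bar>lam\<bar> + S) / d)"
    have "M \<ge> 0" unfolding M_def by (simp add: le_max_iff_disj)
    have "(U lam 0)\<^sup>2 + (V lam 0)\<^sup>2 + 0\<^sup>2 \<le> exp ((2*M+1) * x) * ((U lam x)\<^sup>2 + (V lam x)\<^sup>2 + 0\<^sup>2)"
    proof (rule linear_system_growth(2)[where F="{c}" and A="\<lambda>x. exp (\<kappa> * x)" and B="B lam"
            and g="\<lambda>x. 0" and L=L])
      fix y assume y: "y \<in> {0<..<L} - {c}"
      show "(U lam has_real_derivative exp (\<kappa> * y) * V lam y) (at y)" using dU' y by auto
      show "(V lam has_real_derivative B lam y * U lam y + 0) (at y)" using dV[OF y] by simp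
      have e1: "exp (- \<kappa> * y) \<le> 1" using y \<open>\<kappa> > 0\<close> by simp
      have "\<bar>lam - s y\<bar> \<le> \<bar>lam\<bar> + S" using S[of y] y by auto
      then have "exp (- \<kappa> * y) * \<bar>lam - s y\<bar> / d \<le> 1 * (\<bar>lam\<bar> + S) / d"
        using e1 \<open>d > 0\<close> by (intro divide_right_mono mult_mono) auto
      then have "\<bar>B lam y\<bar> \<le> (\<bar>lam\<bar> + S) / d"
        using \<open>d > 0\<close> by (simp add: B_def abs_mult)
      then show "\<bar>exp (\<kappa> * y)\<bar> \<le> M \<and> \<bar>B lam y\<bar> \<le> M \<and> \<bar>0::real\<bar> \<le> 0"
        using y \<open>\<kappa> > 0\<close> by (auto simp: M_def le_max_iff_disj)
    qed (use x \<open>M \<ge> 0\<close> U_cont V_cont in auto)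
    then have "1 + \<kappa>\<^sup>2 \<le> 0" by (simp add: Ux \<open>V lam x = 0\<close> init)
    then show False using zero_le_power2[of \<kappa>] by linarith
  qed
  have VL: "V lam L = 0" using \<open>lam \<notin> P\<close> U_pos V_nonneg by (auto simp: P_def)
  have "is_pos_eigenpair d a s 0 L lam (U lam)"
    unfolding is_pos_eigenpair_def
  proof (intro exI[of _ "\<lambda>x. exp (\<kappa> * x) * V lam x"] conjI ballI)
    show "continuous_on {0..L} (\<lambda>x. exp (\<kappa> * x) * V lam x)" by (intro continuous_intros V_cont)
    show "d * (exp (\<kappa> * 0) * V lam 0) - a * U lam 0 = 0"
      using \<open>d > 0\<close> by (simp add: init \<kappa>_def)
    show "\<exists>F. finite F \<and> (\<forall>x\<in>{0<..<L} - F. \<exists>phi''.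
        ((\<lambda>x. exp (\<kappa> * x) * V lam x) has_real_derivative phi'') (at x) \<and>
        d * phi'' - a * (exp (\<kappa> * x) * V lam x) + s x * U lam x = lam * U lam x)"
    proof (intro exI[of _ "{c}"] conjI ballI)
      fix x assume x: "x \<in> {0<..<L} - {c}"
      have "((\<lambda>x. exp (\<kappa> * x) * V lam x) has_real_derivative
          \<kappa> * exp (\<kappa> * x) * V lam x + (lam - s x) / d * U lam x) (at x)"
        by (rule derivative_eq_intros dV[OF x] refl)+ (simp add: B_def exp_minus)
      moreover have "d * (\<kappa> * exp (\<kappa> * x) * V lam x + (lam - s x) / d * U lam x)
          - a * (exp (\<kappa> * x) * V lam x) + s x * U lam x = lam * U lam x"
        using \<open>d > 0\<close> by (simp add: \<kappa>_def field_simps)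
      ultimately show "\<exists>phi''. ((\<lambda>x. exp (\<kappa> * x) * V lam x) has_real_derivative phi'') (at x) \<and>
        d * phi'' - a * (exp (\<kappa> * x) * V lam x) + s x * U lam x = lam * U lam x" by blast
    qed simp
  qed (use dU U_pos VL in auto)
  then show ?thesis by blast
qed

lemma is_pos_eigenpair_iff:
  "is_pos_eigenpair d a s y1 y2 lam phi \<longleftrightarrow>
     (\<exists>phi'. solves_ode d a (\<lambda>x. s x - lam) y1 y2 phi phi' \<and> (\<forall>x\<in>{y1..y2}. phi x > 0)
        \<and> d * phi' y1 - a * phi y1 = 0 \<and> phi' y2 = 0)"
proof -
  have *: "d * p - a * q + s x * f = lam * f \<longleftrightarrow> d * p - a * q + (s x - lam) * f = 0" for p q f x
    by (simp add: algebra_simps)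
  show ?thesis unfolding is_pos_eigenpair_def solves_ode_def * by blast
qed

lemma robin_wronskian_zero:
  assumes "d > 0" "d * f' y - a * f y = (0::real)" "d * g' y - a * g y = 0"
  shows "weighted_wronskian d a f f' g g' y = 0"
proof -
  have "f' y = a * f y / d" "g' y = a * g y / d"
    using assms by (auto simp: field_simps)
  then show ?thesis by (simp add: weighted_wronskian_def)
qed

lemma pos_eigenpair_unique:
  assumes "d > 0" "L > 0" "is_pos_eigenpair d a s 0 L lam phi" "is_pos_eigenpair d a s 0 L mu psi"
  shows "lam = mu"
proof -
  have False if "lam < mu" and that': "is_pos_eigenpair d a s 0 L lam phi" "is_pos_eigenpair d a s 0 L mu psi"
    for lam mu phi psi
  proof -
    obtain phi' where p: "solves_ode d a (\<lambda>x. s x - lam) 0 L phi phi'" "\<forall>x\<in>{0..L}. phi x > 0"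
        "d * phi' 0 - a * phi 0 = 0" "phi' L = 0"
      using that'(1) unfolding is_pos_eigenpair_iff by blast
    obtain psi' where q: "solves_ode d a (\<lambda>x. s x - mu) 0 L psi psi'" "\<forall>x\<in>{0..L}. psi x > 0"
        "d * psi' 0 - a * psi 0 = 0" "psi' L = 0"
      using that'(2) unfolding is_pos_eigenpair_iff by blast
    have "weighted_wronskian d a psi psi' phi phi' 0 < weighted_wronskian d a psi psi' phi phi' L"
      using p q \<open>lam < mu\<close> by (intro sturm_comparison_strict[OF assms(1,2) q(1) p(1)]) auto
    then show False
      using robin_wronskian_zero[of d psi' 0 a psi phi' phi] assms(1) q(3,4) p(3,4)
      by (simp add: weighted_wronskian_def)
  qed
  then show ?thesis using assms(3,4) by (metis linorder_neqE_linordered_idom)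
qed

lemma lambda1_eigenpair:
  fixes s s1 s2 :: "real \<Rightarrow> real" and c :: real
  assumes "d > 0" "a > 0" "L > 0"
    and "continuous_on {0..L} s1" "continuous_on {0..L} s2"
    and "\<And>x. x \<in> {0..L} \<Longrightarrow> s x = (if x < c then s1 x else s2 x)"
  shows "\<exists>phi. is_pos_eigenpair d a s 0 L (lambda1 d a s 0 L) phi"
proof -
  have "\<exists>!lam. \<exists>phi. is_pos_eigenpair d a s 0 L lam phi"
    using principal_eigenpair_exists[OF assms] pos_eigenpair_unique[OF assms(1,3)] by blast
  then show ?thesis unfolding lambda1_def by (rule theI')
qed

section \<open>Parabolic and elliptic comparison\<close>

lemma parabolic_comparison:
  fixes z zx :: "real \<Rightarrow> real \<Rightarrow> real"
  assumes "d \<ge> 0" "0 < l" "0 < c" "c \<le> l"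
    and cont: "continuous_on ({0..l} \<times> {0..T}) (\<lambda>(x,t). z x t)"
    and init: "\<And>x. x \<in> {0..l} \<Longrightarrow> 0 \<le> z x 0"
    and dx: "\<And>x t. 0 < t \<Longrightarrow> t \<le> T \<Longrightarrow> x \<in> {0..l} \<Longrightarrow>
        ((\<lambda>y. z y t) has_real_derivative zx x t) (at x within {0..l})"
    and pde: "\<And>x t. 0 < t \<Longrightarrow> t \<le> T \<Longrightarrow> x \<in> {0<..<l} - {c} \<Longrightarrow>
        \<exists>zxx zt k. ((\<lambda>y. zx y t) has_real_derivative zxx) (at x)
          \<and> ((\<lambda>s. z x s) has_real_derivative zt) (at t)
          \<and> \<bar>k\<bar> \<le> K \<and> zt \<ge> d * zxx - a * zx x t + k * z x t"
    and bl: "\<And>t. 0 < t \<Longrightarrow> t \<le> T \<Longrightarrow> zx 0 t \<le> b0 * z 0 t"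
    and br: "\<And>t. 0 < t \<Longrightarrow> t \<le> T \<Longrightarrow> zx l t \<ge> b1 * z l t"
    and x: "x \<in> {0..l}" and t: "t \<in> {0..T}"
  shows "0 \<le> z x t"
proof (rule ccontr)
  assume neg: "\<not> 0 \<le> z x t"
  define N where "N = (2 + \<bar>b0\<bar> + \<bar>b1\<bar>) / l"
  have Nl: "N * l = 2 + \<bar>b0\<bar> + \<bar>b1\<bar>" and "N > 0" using \<open>0 < l\<close> by (auto simp: N_def add_pos_nonneg)
  define G where "G = 3 + \<bar>b0\<bar> + \<bar>b1\<bar>"
  define \<Lambda> where "\<Lambda> = d * (G\<^sup>2 + 2 * N) + \<bar>a\<bar> * G + K + 1"
  define g where "g \<sigma> x = N * (x - l/2)\<^sup>2 + \<sigma> * (x - c)" for \<sigma> x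
  define g' where "g' \<sigma> x = 2 * N * (x - l/2) + \<sigma>" for \<sigma> x
  define \<psi> where "\<psi> x t = exp (\<Lambda> * t + N * (x - l/2)\<^sup>2 - \<bar>x - c\<bar>)" for x t
  have "continuous_on ({0..l} \<times> {0..T}) (\<lambda>p. z (fst p) (snd p) / \<psi> (fst p) (snd p))"
    unfolding \<psi>_def using cont by (intro continuous_intros) (auto simp: case_prod_beta)
  moreover have "compact ({0..l} \<times> {0..T})" "{0..l} \<times> {0..T} \<noteq> {}"
    using x t by (auto intro: compact_Times)
  ultimately obtain p where p: "p \<in> {0..l} \<times> {0..T}"
    "\<And>q. q \<in> {0..l} \<times> {0..T} \<Longrightarrow> z (fst p) (snd p) / \<psi> (fst p) (snd p) \<le> z (fst q) (snd q) / \<psi> (fst q) (snd q)"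
    using continuous_attains_inf by (metis (no_types, lifting))
  define x0 where "x0 = fst p"
  define t0 where "t0 = snd p"
  define \<epsilon> where "\<epsilon> = - (z x0 t0 / \<psi> x0 t0)"
  have x0: "x0 \<in> {0..l}" and t0: "t0 \<in> {0..T}" using p(1) by (auto simp: x0_def t0_def)
  have \<psi>_pos: "\<psi> x t > 0" for x t by (simp add: \<psi>_def)
  have min: "z y s \<ge> - \<epsilon> * \<psi> y s" if "y \<in> {0..l}" "s \<in> {0..T}" for y s
  proof -
    have "- \<epsilon> \<le> z y s / \<psi> y s" using p(2)[of "(y, s)"] that by (simp add: \<epsilon>_def x0_def t0_def)
    then show ?thesis using \<psi>_pos[of y s] by (simp add: pos_le_divide_eq)
  qed
  have "\<epsilon> > 0"
  proof -
    have "- \<epsilon> * \<psi> x t < 0" using min[OF x t] neg by linarith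
    then show ?thesis using \<psi>_pos[of x t] by (simp add: zero_less_mult_iff)
  qed
  have z0: "z x0 t0 = - \<epsilon> * \<psi> x0 t0" using \<psi>_pos[of x0 t0] by (simp add: \<epsilon>_def)
  have "t0 \<noteq> 0"
  proof
    assume "t0 = 0"
    then have "0 \<le> - \<epsilon> * \<psi> x0 t0" using z0 init[OF x0] by simp
    then show False using \<psi>_pos[of x0 t0] \<open>\<epsilon> > 0\<close> by (simp add: mult_le_0_iff)
  qed
  then have t0': "0 < t0" "t0 \<le> T" using t0 by auto
  define Y where "Y \<sigma> x t = z x t + \<epsilon> * exp (\<Lambda> * t + g \<sigma> x)" for \<sigma> x t
  have Y_nonneg: "0 \<le> Y \<sigma> y s" if "\<bar>\<sigma>\<bar> = 1" "y \<in> {0..l}" "s \<in> {0..T}" for \<sigma> y s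
  proof -
    have "\<psi> y s \<le> exp (\<Lambda> * s + g \<sigma> y)"
      using that(1) by (auto simp: \<psi>_def g_def abs_if split: if_splits)
    then have "\<epsilon> * \<psi> y s \<le> \<epsilon> * exp (\<Lambda> * s + g \<sigma> y)" using \<open>\<epsilon> > 0\<close> by simp
    then show ?thesis using min[OF that(2,3)] by (simp add: Y_def)
  qed
  have Y_zero: "z x0 t0 = - \<epsilon> * exp (\<Lambda> * t0 + g \<sigma> x0)" "Y \<sigma> x0 t0 = 0"
    if "\<sigma> * (x0 - c) = - \<bar>x0 - c\<bar>" for \<sigma>
    using z0 that by (simp_all add: Y_def g_def \<psi>_def add.assoc)
  have dg: "((\<lambda>y. exp (C + g \<sigma> y)) has_real_derivative exp (C + g \<sigma> y) * g' \<sigma> y) (at y within S)" for C \<sigma> y S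
    unfolding g_def g'_def by (rule derivative_eq_intros refl)+ simp
  have dg2: "((\<lambda>y. exp (C + g \<sigma> y) * g' \<sigma> y) has_real_derivative
      exp (C + g \<sigma> y) * ((g' \<sigma> y)\<^sup>2 + 2 * N)) (at y)" for C \<sigma> y
  proof -
    have "(g' \<sigma> has_real_derivative 2 * N) (at y)"
      unfolding g'_def by (rule derivative_eq_intros refl)+ simp
    from DERIV_mult[OF dg this] show ?thesis
      by (simp add: algebra_simps power2_eq_square)
  qed
  have dY: "((\<lambda>y. Y \<sigma> y t0) has_real_derivative zx y t0 + \<epsilon> * (exp (\<Lambda> * t0 + g \<sigma> y) * g' \<sigma> y)) (at y within {0..l})"
    if "y \<in> {0..l}" for \<sigma> y
    unfolding Y_def by (rule derivative_intros dx[OF t0' that] dg DERIV_cmult)+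
  consider "x0 = 0" | "x0 = l" | "x0 = c" "x0 \<in> {0<..<l}" | "x0 \<in> {0<..<l} - {c}"
    using x0 by fastforce
  then show False
  proof cases
    case 1
    define E where "E = \<epsilon> * exp (\<Lambda> * t0 + g 1 0)"
    have "E > 0" using \<open>\<epsilon> > 0\<close> by (simp add: E_def)
    have s: "1 * (x0 - c) = - \<bar>x0 - c\<bar>" using 1 \<open>0 < c\<close> by simp
    have "0 \<le> zx 0 t0 + \<epsilon> * (exp (\<Lambda> * t0 + g 1 0) * g' 1 0)"
      by (rule derivative_nonneg_at_left_end_min[OF \<open>0 < l\<close> dY])
        (use Y_nonneg[of 1] Y_zero(2)[OF s] t0 \<open>0 < l\<close> 1 in auto)
    moreover have "zx 0 t0 \<le> b0 * (- E)"
      using bl[OF t0'] Y_zero(1)[OF s] 1 by (simp add: E_def)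
    ultimately have "0 \<le> E * (g' 1 0 - b0)" by (simp add: E_def algebra_simps)
    moreover have "g' 1 0 = - (N * l) + 1" by (simp add: g'_def)
    then have "g' 1 0 - b0 < 0" unfolding Nl by linarith
    ultimately show False using \<open>E > 0\<close> by (simp add: zero_le_mult_iff)
  next
    case 2
    define \<sigma> :: real where "\<sigma> = (if c = l then 1 else - 1)"
    define E where "E = \<epsilon> * exp (\<Lambda> * t0 + g \<sigma> l)"
    have "E > 0" using \<open>\<epsilon> > 0\<close> by (simp add: E_def)
    have s: "\<sigma> * (x0 - c) = - \<bar>x0 - c\<bar>" using 2 \<open>c \<le> l\<close> by (simp add: \<sigma>_def)
    have s1: "\<bar>\<sigma>\<bar> = 1" by (simp add: \<sigma>_def)
    have "zx l t0 + \<epsilon> * (exp (\<Lambda> * t0 + g \<sigma> l) * g' \<sigma> l) \<le> 0"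
      by (rule derivative_nonpos_at_right_end_min[OF \<open>0 < l\<close> dY])
        (use Y_nonneg[OF s1] Y_zero(2)[OF s] t0 \<open>0 < l\<close> 2 in auto)
    moreover have "zx l t0 \<ge> b1 * (- E)"
      using br[OF t0'] Y_zero(1)[OF s] 2 by (simp add: E_def)
    ultimately have "E * (g' \<sigma> l - b1) \<le> 0" by (simp add: E_def algebra_simps)
    moreover have "g' \<sigma> l = N * l + \<sigma>" by (simp add: g'_def)
    then have "g' \<sigma> l - b1 > 0" using s1 unfolding Nl by linarith
    ultimately show False using \<open>E > 0\<close> by (simp add: mult_le_0_iff)
  next
    case 3
    \<comment> \<open>The two smooth branches of the barrier both touch at the kink, with different slopes.\<close>
    have "zx c t0 + \<epsilon> * (exp (\<Lambda> * t0 + g \<sigma> c) * g' \<sigma> c) = 0" if "\<bar>\<sigma>\<bar> = 1" for \<sigma>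
    proof (rule DERIV_local_min)
      have "at x0 within {0..l} = at x0" using 3 by (auto intro!: at_within_interior)
      then show "((\<lambda>y. Y \<sigma> y t0) has_real_derivative zx c t0 + \<epsilon> * (exp (\<Lambda> * t0 + g \<sigma> c) * g' \<sigma> c)) (at c)"
        using dY[OF x0, of \<sigma>] 3(1) by simp
      show "0 < min c (l - c)" using 3 by auto
      have "Y \<sigma> c t0 = 0" using Y_zero(2)[of \<sigma>] 3 by simp
      then show "\<forall>y. \<bar>c - y\<bar> < min c (l - c) \<longrightarrow> Y \<sigma> c t0 \<le> Y \<sigma> y t0"
        by (auto intro!: Y_nonneg[OF that _ t0])
    qed
    moreover have "g 1 c = g (-1) c" by (simp add: g_def)
    ultimately have "\<epsilon> * (exp (\<Lambda> * t0 + g 1 c) * g' 1 c) = \<epsilon> * (exp (\<Lambda> * t0 + g 1 c) * g' (-1) c)"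
      by (smt (verit))
    then show False using \<open>\<epsilon> > 0\<close> by (simp add: g'_def)
  next
    case 4
    define \<sigma> :: real where "\<sigma> = (if x0 < c then 1 else - 1)"
    define E where "E = \<epsilon> * exp (\<Lambda> * t0 + g \<sigma> x0)"
    have "E > 0" using \<open>\<epsilon> > 0\<close> by (simp add: E_def)
    have s: "\<sigma> * (x0 - c) = - \<bar>x0 - c\<bar>" by (simp add: \<sigma>_def)
    have s1: "\<bar>\<sigma>\<bar> = 1" by (simp add: \<sigma>_def)
    have zE: "z x0 t0 = - E" using Y_zero(1)[OF s] by (simp add: E_def)
    obtain zxx zt k where k: "((\<lambda>y. zx y t0) has_real_derivative zxx) (at x0)"
      "((\<lambda>s. z x0 s) has_real_derivative zt) (at t0)" "\<bar>k\<bar> \<le> K" "zt \<ge> d * zxx - a * zx x0 t0 + k * z x0 t0"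
      using pde[OF t0' 4] by blast
    have near: "y \<in> {0<..<l}" if "\<bar>y - x0\<bar> < min x0 (l - x0)" for y
      using that by auto
    have e: "0 < min x0 (l - x0)" using 4 by auto
    have d1: "((\<lambda>y. Y \<sigma> y t0) has_real_derivative
          zx y t0 + \<epsilon> * (exp (\<Lambda> * t0 + g \<sigma> y) * g' \<sigma> y)) (at y)"
      if "\<bar>y - x0\<bar> < min x0 (l - x0)" for y
    proof -
      have "at y within {0..l} = at y" using near[OF that] by (auto intro!: at_within_interior)
      then show ?thesis using dY[of y \<sigma>] near[OF that] by auto
    qed
    have d2: "((\<lambda>y. zx y t0 + \<epsilon> * (exp (\<Lambda> * t0 + g \<sigma> y) * g' \<sigma> y)) has_real_derivative
        zxx + \<epsilon> * (exp (\<Lambda> * t0 + g \<sigma> x0) * ((g' \<sigma> x0)\<^sup>2 + 2 * N))) (at x0)"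
      by (rule derivative_intros k(1) DERIV_cmult dg2)+
    have m: "Y \<sigma> x0 t0 \<le> Y \<sigma> y t0" if "\<bar>y - x0\<bar> < min x0 (l - x0)" for y
      using Y_nonneg[OF s1 _ t0, of y] near[OF that] Y_zero(2)[OF s] by auto
    have "zx x0 t0 + \<epsilon> * (exp (\<Lambda> * t0 + g \<sigma> x0) * g' \<sigma> x0) = 0"
      by (rule second_derivative_nonneg_at_local_min(1)[OF e d1 d2 m])
    then have zx: "zx x0 t0 = - E * g' \<sigma> x0" by (simp add: E_def)
    have "0 \<le> zxx + \<epsilon> * (exp (\<Lambda> * t0 + g \<sigma> x0) * ((g' \<sigma> x0)\<^sup>2 + 2 * N))"
      by (rule second_derivative_nonneg_at_local_min(2)[OF e d1 d2 m])
    then have zxx: "zxx \<ge> - E * ((g' \<sigma> x0)\<^sup>2 + 2 * N)" by (simp add: E_def algebra_simps)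
    have "zt + \<epsilon> * (exp (\<Lambda> * t0 + g \<sigma> x0) * \<Lambda>) \<le> 0"
    proof (rule derivative_nonpos_at_right_end_min[OF t0'(1), where f = "\<lambda>s. Y \<sigma> x0 s"])
      show "(Y \<sigma> x0 has_real_derivative zt + \<epsilon> * (exp (\<Lambda> * t0 + g \<sigma> x0) * \<Lambda>)) (at t0 within {0..t0})"
        unfolding Y_def[abs_def] by (rule derivative_eq_intros has_field_derivative_at_within[OF k(2)] refl)+ simp
      show "Y \<sigma> x0 t0 \<le> Y \<sigma> x0 y" if "y \<in> {0..t0}" for y
        using Y_nonneg[OF s1 x0, of y] that t0 Y_zero(2)[OF s] by auto
    qed
    then have "zt \<le> - (\<Lambda> * E)" by (simp add: E_def algebra_simps)
    moreover have "d * zxx \<ge> d * (- E * ((g' \<sigma> x0)\<^sup>2 + 2 * N))"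
      using zxx \<open>d \<ge> 0\<close> by (rule mult_left_mono)
    ultimately have "\<Lambda> * E \<le> d * (E * ((g' \<sigma> x0)\<^sup>2 + 2 * N)) - a * (E * g' \<sigma> x0) + k * E"
      using k(4) unfolding zx zE by linarith
    then have "\<Lambda> * E \<le> (d * ((g' \<sigma> x0)\<^sup>2 + 2 * N) - a * g' \<sigma> x0 + k) * E"
      by (simp add: algebra_simps)
    then have "\<Lambda> \<le> d * ((g' \<sigma> x0)\<^sup>2 + 2 * N) - a * g' \<sigma> x0 + k"
      using \<open>E > 0\<close> by simp
    moreover have gG: "\<bar>g' \<sigma> x0\<bar> \<le> G"
    proof -
      have "\<bar>x0 - l/2\<bar> \<le> l/2" using x0 by (simp add: abs_if)
      then have "\<bar>2 * N * (x0 - l/2)\<bar> \<le> 2 * N * (l/2)"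
        unfolding abs_mult using \<open>N > 0\<close> by (intro mult_mono) auto
      then show ?thesis using Nl s1 by (simp add: g'_def G_def)
    qed
    moreover have "(g' \<sigma> x0)\<^sup>2 \<le> G\<^sup>2"
      using gG by (intro abs_le_square_iff[THEN iffD1]) simp
    then have "d * ((g' \<sigma> x0)\<^sup>2 + 2 * N) \<le> d * (G\<^sup>2 + 2 * N)" using \<open>d \<ge> 0\<close> by (intro mult_left_mono) auto
    moreover have "- (a * g' \<sigma> x0) \<le> \<bar>a\<bar> * G"
      using mult_left_mono[OF gG, of "\<bar>a\<bar>"] by (simp add: abs_mult[symmetric] abs_le_iff)
    ultimately show False using k(3) unfolding \<Lambda>_def by linarith
  qed
qed

lemma elliptic_comparison:
  fixes v v' v'' :: "real \<Rightarrow> real"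
  assumes "d > 0" "q > 0" "0 < l"
    and dv: "\<And>x. x \<in> {0..l} \<Longrightarrow> (v has_real_derivative v' x) (at x within {0..l})"
    and dv': "\<And>x. x \<in> {0<..<l} \<Longrightarrow> (v' has_real_derivative v'' x) (at x)"
    and ineq: "\<And>x. x \<in> {0<..<l} \<Longrightarrow> d * v'' x - a * v' x - q * v x \<le> 0"
    and bc: "d * v' 0 - a * v 0 \<le> 0" "d * v' l - a * v l \<ge> 0"
    and x: "x \<in> {0..l}"
  shows "0 \<le> v x"
proof -
  define \<kappa> where "\<kappa> = a / d"
  have v_cont: "continuous_on {0..l} v" using dv by (rule DERIV_continuous_on)
  obtain M where M: "\<And>x. x \<in> {0..l} \<Longrightarrow> \<bar>v x\<bar> \<le> M"
    using continuous_on_Icc_bounded[OF v_cont] by blast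
  define C where "C = M * exp (\<bar>\<kappa>\<bar> * l)"
  have "M \<ge> 0" using M[OF x] by auto
  have dE: "((\<lambda>y. C * exp (- q * t) * exp (\<kappa> * y)) has_real_derivative \<kappa> * (C * exp (- q * t) * exp (\<kappa> * y)))
      (at y within S)" for t y S
    by (rule derivative_eq_intros refl)+ simp
  have "0 \<le> v x + C * exp (- q * t) * exp (\<kappa> * x)" if "t \<ge> 0" for t
  proof (rule parabolic_comparison[where z = "\<lambda>x t. v x + C * exp (- q * t) * exp (\<kappa> * x)" and T = t
        and zx = "\<lambda>x t. v' x + \<kappa> * (C * exp (- q * t) * exp (\<kappa> * x))" and l = l and c = l and d = d and a = a
        and K = q and ?b0.0 = \<kappa> and ?b1.0 = \<kappa>])
    show "continuous_on ({0..l} \<times> {0..t}) (\<lambda>(x, t). v x + C * exp (- q * t) * exp (\<kappa> * x))"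
      unfolding case_prod_beta
      by (intro continuous_intros continuous_on_compose2[OF v_cont]) auto
    show "0 \<le> v y + C * exp (- q * 0) * exp (\<kappa> * y)" if y: "y \<in> {0..l}" for y
    proof -
      have "\<bar>\<kappa> * y\<bar> \<le> \<bar>\<kappa>\<bar> * l" unfolding abs_mult using y by (intro mult_mono) auto
      then have "1 \<le> exp (\<bar>\<kappa>\<bar> * l + \<kappa> * y)" by simp
      then have "M * 1 \<le> M * exp (\<bar>\<kappa>\<bar> * l + \<kappa> * y)" using \<open>M \<ge> 0\<close> by (rule mult_left_mono)
      then show ?thesis using M[OF y] by (simp add: C_def exp_add)
    qed
    show "((\<lambda>y. v y + C * exp (- q * s) * exp (\<kappa> * y)) has_real_derivative
        v' y + \<kappa> * (C * exp (- q * s) * exp (\<kappa> * y))) (at y within {0..l})" if "y \<in> {0..l}" for y s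
      by (rule derivative_intros dv that dE)+
    show "v' 0 + \<kappa> * (C * exp (- q * s) * exp (\<kappa> * 0)) \<le> \<kappa> * (v 0 + C * exp (- q * s) * exp (\<kappa> * 0))" for s
      using bc(1) \<open>d > 0\<close> by (simp add: \<kappa>_def field_simps)
    show "v' l + \<kappa> * (C * exp (- q * s) * exp (\<kappa> * l)) \<ge> \<kappa> * (v l + C * exp (- q * s) * exp (\<kappa> * l))" for s
      using bc(2) \<open>d > 0\<close> by (simp add: \<kappa>_def field_simps)
    fix y s assume "y \<in> {0<..<l} - {l}"
    then have y: "y \<in> {0<..<l}" by auto
    define e where "e = C * exp (- q * s) * exp (\<kappa> * y)"
    have 1: "((\<lambda>y. v' y + \<kappa> * (C * exp (- q * s) * exp (\<kappa> * y))) has_real_derivative v'' y + \<kappa> * (\<kappa> * e)) (at y)"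
      unfolding e_def by (rule derivative_intros dv' y dE DERIV_cmult)+
    have 2: "((\<lambda>s. v y + C * exp (- q * s) * exp (\<kappa> * y)) has_real_derivative - q * e) (at s)"
      unfolding e_def by (rule derivative_eq_intros refl)+ simp
    have "d * \<kappa> = a" using \<open>d > 0\<close> by (simp add: \<kappa>_def)
    then have "d * (v'' y + \<kappa> * (\<kappa> * e)) - a * (v' y + \<kappa> * e) + (- q) * (v y + e)
        = (d * v'' y - a * v' y - q * v y) - q * e"
      by (simp add: algebra_simps)
    then have 3: "- q * e \<ge> d * (v'' y + \<kappa> * (\<kappa> * e)) - a * (v' y + \<kappa> * e) + (- q) * (v y + e)"
      using ineq[OF y] by simp
    show "\<exists>zxx zt k. ((\<lambda>y. v' y + \<kappa> * (C * exp (- q * s) * exp (\<kappa> * y))) has_real_derivative zxx) (at y)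
       \<and> ((\<lambda>s. v y + C * exp (- q * s) * exp (\<kappa> * y)) has_real_derivative zt) (at s)
       \<and> \<bar>k\<bar> \<le> q \<and> zt \<ge> d * zxx - a * (v' y + \<kappa> * (C * exp (- q * s) * exp (\<kappa> * y)))
           + k * (v y + C * exp (- q * s) * exp (\<kappa> * y))"
      by (rule exI[of _ "v'' y + \<kappa> * (\<kappa> * e)"], rule exI[of _ "- q * e"], rule exI[of _ "- q"], intro conjI 1 2)
        (use 3 \<open>q > 0\<close> in \<open>simp_all add: e_def\<close>)
  qed (use assms x that in auto)
  then have ev: "eventually (\<lambda>t. 0 \<le> v x + C * exp (- q * t) * exp (\<kappa> * x)) at_top"
    using eventually_ge_at_top[of 0] by (rule eventually_mono[rotated])
  have "((\<lambda>t. v x + C * exp (- q * t) * exp (\<kappa> * x)) \<longlongrightarrow> v x + C * 0 * exp (\<kappa> * x)) at_top"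
    using \<open>q > 0\<close>
    by (intro tendsto_intros filterlim_compose[OF exp_at_bot]
        filterlim_tendsto_neg_mult_at_bot[OF tendsto_const _ filterlim_ident]) auto
  then show ?thesis using tendsto_lowerbound[OF _ ev] by simp
qed

section \<open>The predator steady state\<close>

lemma is_wsteadyD:
  assumes "is_wsteady d a h q l w"
  obtains w' w'' where
    "\<And>x. x \<in> {0..l} \<Longrightarrow> (w has_real_derivative w' x) (at x within {0..l})"
    "\<And>x. x \<in> {0<..<l} \<Longrightarrow> (w' has_real_derivative w'' x) (at x)"
    "\<And>x. x \<in> {0<..<l} \<Longrightarrow> d * w'' x - a * w' x + h - q * w x = 0"
    "d * w' 0 - a * w 0 = 0" "d * w' l - a * w l = 0"
    "\<And>x. x \<in> {0..l} \<Longrightarrow> w x > 0"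
proof -
  obtain w' w'' where w: "\<forall>x\<in>{0..l}. (w has_real_derivative w' x) (at x within {0..l})
                 \<and> (w' has_real_derivative w'' x) (at x within {0..l}) \<and> w x > 0"
    "\<forall>x\<in>{0<..<l}. d * w'' x - a * w' x + h - q * w x = 0"
    "d * w' 0 - a * w 0 = 0" "d * w' l - a * w l = 0"
    using assms unfolding is_wsteady_def by blast
  have "(w' has_real_derivative w'' x) (at x)" if "x \<in> {0<..<l}" for x
  proof -
    have "at x within {0..l} = at x" using that by (auto intro!: at_within_interior)
    then show ?thesis using bspec[OF w(1), of x] that by auto
  qed
  with w show ?thesis by (intro that[of w' w'']) auto
qed

lemma steady_bounds:
  fixes w w' w'' :: "real \<Rightarrow> real"
  assumes "d > 0" "q > 0" "0 < l" "a \<ge> 0" "h > 0"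
    and dw: "\<And>x. x \<in> {0..l} \<Longrightarrow> (w has_real_derivative w' x) (at x within {0..l})"
    and dw': "\<And>x. x \<in> {0<..<l} \<Longrightarrow> (w' has_real_derivative w'' x) (at x)"
    and ode: "\<And>x. x \<in> {0<..<l} \<Longrightarrow> d * w'' x - a * w' x + h - q * w x = 0"
    and bc: "d * w' 0 - a * w 0 = 0" "d * w' l - a * w l = 0"
    and x: "x \<in> {0..l}"
  shows "h / q * exp (- (a/d) * l) \<le> w x" "w x \<le> h / q * exp ((a/d) * l)"
proof -
  define \<kappa> where "\<kappa> = a / d"
  have a: "a = d * \<kappa>" and "\<kappa> \<ge> 0" using assms(1,4) by (auto simp: \<kappa>_def)
  have bc': "w' 0 = \<kappa> * w 0" "w' l = \<kappa> * w l"
    using bc \<open>d > 0\<close> by (auto simp: \<kappa>_def field_simps)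
  have dE: "((\<lambda>y. C * exp (\<kappa> * y)) has_real_derivative \<kappa> * (C * exp (\<kappa> * y))) (at y within S)" for C y S
    by (rule derivative_eq_intros refl)+ simp
  define C where "C = h / q * exp (- \<kappa> * l)"
  have "0 \<le> w x - C * exp (\<kappa> * x)"
  proof (rule elliptic_comparison[OF assms(1-3), where a = a and x = x and v = "\<lambda>x. w x - C * exp (\<kappa> * x)"
        and v' = "\<lambda>x. w' x - \<kappa> * (C * exp (\<kappa> * x))" and v'' = "\<lambda>x. w'' x - \<kappa> * (\<kappa> * (C * exp (\<kappa> * x)))"])
    show "((\<lambda>x. w x - C * exp (\<kappa> * x)) has_real_derivative w' y - \<kappa> * (C * exp (\<kappa> * y))) (at y within {0..l})"
      if "y \<in> {0..l}" for y by (rule derivative_intros dw dE that)+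
    fix y assume y: "y \<in> {0<..<l}"
    show "((\<lambda>y. w' y - \<kappa> * (C * exp (\<kappa> * y))) has_real_derivative w'' y - \<kappa> * (\<kappa> * (C * exp (\<kappa> * y)))) (at y)"
      by (rule derivative_intros dw' y DERIV_cmult dE)+
    have "exp (\<kappa> * y - \<kappa> * l) \<le> 1" using y \<open>\<kappa> \<ge> 0\<close> by (simp add: mult_left_mono)
    then have "h * exp (\<kappa> * y - \<kappa> * l) \<le> h" using \<open>h > 0\<close> by simp
    moreover have "q * (C * exp (\<kappa> * y)) = h * exp (\<kappa> * y - \<kappa> * l)"
      using \<open>q > 0\<close> by (simp add: C_def exp_diff exp_minus field_simps)
    moreover have "d * (w'' y - \<kappa> * (\<kappa> * (C * exp (\<kappa> * y)))) - a * (w' y - \<kappa> * (C * exp (\<kappa> * y)))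
        - q * (w y - C * exp (\<kappa> * y)) = q * (C * exp (\<kappa> * y)) - h + (d * w'' y - a * w' y + h - q * w y)"
      unfolding a by (simp add: algebra_simps)
    ultimately show "d * (w'' y - \<kappa> * (\<kappa> * (C * exp (\<kappa> * y)))) - a * (w' y - \<kappa> * (C * exp (\<kappa> * y)))
        - q * (w y - C * exp (\<kappa> * y)) \<le> 0"
      using ode[OF y] by linarith
  qed (use bc' x in \<open>simp_all add: a algebra_simps\<close>)
  moreover have "C * exp (\<kappa> * 0) \<le> C * exp (\<kappa> * x)"
    using x \<open>\<kappa> \<ge> 0\<close> \<open>h > 0\<close> \<open>q > 0\<close> by (intro mult_left_mono) (auto simp: C_def)
  ultimately show "h / q * exp (- (a/d) * l) \<le> w x" unfolding C_def \<kappa>_def by simp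
  define D where "D = h / q"
  have "0 \<le> D * exp (\<kappa> * x) - w x"
  proof (rule elliptic_comparison[OF assms(1-3), where a = a and x = x and v = "\<lambda>x. D * exp (\<kappa> * x) - w x"
        and v' = "\<lambda>x. \<kappa> * (D * exp (\<kappa> * x)) - w' x" and v'' = "\<lambda>x. \<kappa> * (\<kappa> * (D * exp (\<kappa> * x))) - w'' x"])
    show "((\<lambda>x. D * exp (\<kappa> * x) - w x) has_real_derivative \<kappa> * (D * exp (\<kappa> * y)) - w' y) (at y within {0..l})"
      if "y \<in> {0..l}" for y by (rule derivative_intros dw dE that)+
    fix y assume y: "y \<in> {0<..<l}"
    show "((\<lambda>y. \<kappa> * (D * exp (\<kappa> * y)) - w' y) has_real_derivative \<kappa> * (\<kappa> * (D * exp (\<kappa> * y))) - w'' y) (at y)"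
      by (rule derivative_intros dw' y DERIV_cmult dE)+
    have "1 \<le> exp (\<kappa> * y)" using y \<open>\<kappa> \<ge> 0\<close> by simp
    then have "h \<le> h * exp (\<kappa> * y)" using \<open>h > 0\<close> by simp
    moreover have "q * (D * exp (\<kappa> * y)) = h * exp (\<kappa> * y)"
      using \<open>q > 0\<close> by (simp add: D_def)
    moreover have "d * (\<kappa> * (\<kappa> * (D * exp (\<kappa> * y))) - w'' y) - a * (\<kappa> * (D * exp (\<kappa> * y)) - w' y)
        - q * (D * exp (\<kappa> * y) - w y) = h - q * (D * exp (\<kappa> * y)) - (d * w'' y - a * w' y + h - q * w y)"
      unfolding a by (simp add: algebra_simps)
    ultimately show "d * (\<kappa> * (\<kappa> * (D * exp (\<kappa> * y))) - w'' y) - a * (\<kappa> * (D * exp (\<kappa> * y)) - w' y)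
        - q * (D * exp (\<kappa> * y) - w y) \<le> 0"
      using ode[OF y] by linarith
  qed (use bc' x in \<open>simp_all add: a algebra_simps\<close>)
  moreover have "D * exp (\<kappa> * x) \<le> D * exp (\<kappa> * l)"
    using x \<open>\<kappa> \<ge> 0\<close> \<open>h > 0\<close> \<open>q > 0\<close> by (intro mult_left_mono) (auto simp: D_def mult_left_mono)
  ultimately show "w x \<le> h / q * exp ((a/d) * l)" unfolding D_def \<kappa>_def by simp
qed

lemma is_wsteady_exists:
  assumes "d > 0" "q > 0" "0 < l" "a \<ge> 0" "h > 0"
  shows "\<exists>w. is_wsteady d a h q l w"
proof -
  define \<Delta> where "\<Delta> = sqrt (a\<^sup>2 + 4 * d * q)"
  have D2: "\<Delta>\<^sup>2 = a\<^sup>2 + 4 * d * q" using assms by (simp add: \<Delta>_def)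
  have "\<Delta> > a" unfolding \<Delta>_def using assms by (intro real_less_rsqrt) simp
  define \<mu> where "\<mu> = (a + \<Delta>) / (2 * d)"
  define \<nu> where "\<nu> = (a - \<Delta>) / (2 * d)"
  have root: "d * (y * y) - a * y = q" if "(2 * d * y - a)\<^sup>2 = \<Delta>\<^sup>2" for y
  proof -
    have "4 * d * (d * (y * y) - a * y) = (2 * d * y - a)\<^sup>2 - a\<^sup>2"
      by (simp add: power2_eq_square algebra_simps)
    then have "4 * d * (d * (y * y) - a * y) = 4 * d * q" using that D2 by simp
    then show ?thesis using \<open>d > 0\<close> by simp
  qed
  have roots: "d * (\<mu> * \<mu>) - a * \<mu> = q" "d * (\<nu> * \<nu>) - a * \<nu> = q"
    by (rule root, use \<open>d > 0\<close> in \<open>simp add: \<mu>_def \<nu>_def\<close>)+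
  have nz: "d * \<mu> - a \<noteq> 0" "d * \<nu> - a \<noteq> 0"
  proof -
    have "d * \<mu> = (a + \<Delta>) / 2" "d * \<nu> = (a - \<Delta>) / 2" using \<open>d > 0\<close> by (simp_all add: \<mu>_def \<nu>_def)
    then have "d * \<mu> - a > 0" "d * \<nu> - a < 0" using \<open>\<Delta> > a\<close> \<open>a \<ge> 0\<close> by simp_all
    then show "d * \<mu> - a \<noteq> 0" "d * \<nu> - a \<noteq> 0" by simp_all
  qed
  have "\<nu> < \<mu>" using \<open>\<Delta> > a\<close> \<open>a \<ge> 0\<close> \<open>d > 0\<close> by (simp add: \<mu>_def \<nu>_def divide_strict_right_mono)
  define k where "k = a * h / q"
  define P where "P = k * (1 - exp (\<nu> * l)) / (exp (\<mu> * l) - exp (\<nu> * l))"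
  define R where "R = k - P"
  have "P * (exp (\<mu> * l) - exp (\<nu> * l)) = k * (1 - exp (\<nu> * l))"
    using \<open>\<nu> < \<mu>\<close> \<open>0 < l\<close> by (simp add: P_def)
  then have PR: "P * exp (\<mu> * l) + R * exp (\<nu> * l) = k" by (simp add: R_def algebra_simps)
  define A where "A = P / (d * \<mu> - a)"
  define B where "B = R / (d * \<nu> - a)"
  have AB: "A * (d * \<mu> - a) = P" "B * (d * \<nu> - a) = R" using nz by (simp_all add: A_def B_def)
  define w where "w x = h / q + A * exp (\<mu> * x) + B * exp (\<nu> * x)" for x
  define w' where "w' x = A * \<mu> * exp (\<mu> * x) + B * \<nu> * exp (\<nu> * x)" for x
  define w'' where "w'' x = A * (\<mu> * \<mu>) * exp (\<mu> * x) + B * (\<nu> * \<nu>) * exp (\<nu> * x)" for x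
  have dw: "(w has_real_derivative w' x) (at x within S)" for x S
    unfolding w_def w'_def by (rule derivative_eq_intros refl)+ simp
  have dw': "(w' has_real_derivative w'' x) (at x within S)" for x S
    unfolding w'_def w''_def by (rule derivative_eq_intros refl)+ simp
  have ode: "d * w'' x - a * w' x + h - q * w x = 0" for x
  proof -
    have "d * w'' x - a * w' x + h - q * w x
      = A * exp (\<mu> * x) * (d * (\<mu> * \<mu>) - a * \<mu> - q) + B * exp (\<nu> * x) * (d * (\<nu> * \<nu>) - a * \<nu> - q) + (h - q * (h / q))"
      unfolding w_def w'_def w''_def by (simp only: algebra_simps)
    then show ?thesis using roots \<open>q > 0\<close> by simp
  qed
  have bc: "d * w' x - a * w x = P * exp (\<mu> * x) + R * exp (\<nu> * x) - k" for x
    unfolding w_def w'_def k_def AB[symmetric] by (simp add: algebra_simps)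
  have bc0: "d * w' 0 - a * w 0 = 0" and bcl: "d * w' l - a * w l = 0"
    unfolding bc by (simp_all add: PR, simp add: R_def)
  have "w x > 0" if "x \<in> {0..l}" for x
  proof -
    have "0 < h / q * exp (- (a/d) * l)" using assms by simp
    also have "\<dots> \<le> w x" by (rule steady_bounds(1)[OF assms dw dw' ode bc0 bcl that])
    finally show ?thesis .
  qed
  moreover have "continuous_on {0..l} w''" unfolding w''_def by (intro continuous_intros)
  ultimately have "is_wsteady d a h q l w"
    unfolding is_wsteady_def using dw dw' ode bc0 bcl by blast
  then show ?thesis by blast
qed

lemma is_wsteady_unique:
  assumes "d > 0" "q > 0" "0 < l" "is_wsteady d a h q l w" "is_wsteady d a h q l v" "x \<in> {0..l}"
  shows "w x = v x"
proof -
  have le: "v x \<le> w x" if wv: "is_wsteady d a h q l w" "is_wsteady d a h q l v" for w v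
  proof -
    obtain w' w'' where w: "\<And>x. x \<in> {0..l} \<Longrightarrow> (w has_real_derivative w' x) (at x within {0..l})"
      "\<And>x. x \<in> {0<..<l} \<Longrightarrow> (w' has_real_derivative w'' x) (at x)"
      "\<And>x. x \<in> {0<..<l} \<Longrightarrow> d * w'' x - a * w' x + h - q * w x = 0"
      "d * w' 0 - a * w 0 = 0" "d * w' l - a * w l = 0" "\<And>x. x \<in> {0..l} \<Longrightarrow> w x > 0"
      by (rule is_wsteadyD[OF wv(1)]) blast
    obtain v' v'' where v: "\<And>x. x \<in> {0..l} \<Longrightarrow> (v has_real_derivative v' x) (at x within {0..l})"
      "\<And>x. x \<in> {0<..<l} \<Longrightarrow> (v' has_real_derivative v'' x) (at x)"
      "\<And>x. x \<in> {0<..<l} \<Longrightarrow> d * v'' x - a * v' x + h - q * v x = 0"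
      "d * v' 0 - a * v 0 = 0" "d * v' l - a * v l = 0" "\<And>x. x \<in> {0..l} \<Longrightarrow> v x > 0"
      by (rule is_wsteadyD[OF wv(2)]) blast
    have "0 \<le> w x - v x"
    proof (rule elliptic_comparison[OF assms(1-3), where a = a and x = x
          and v = "\<lambda>x. w x - v x" and v' = "\<lambda>x. w' x - v' x" and v'' = "\<lambda>x. w'' x - v'' x"])
      show "d * (w'' x - v'' x) - a * (w' x - v' x) - q * (w x - v x) \<le> 0" if "x \<in> {0<..<l}" for x
        using w(3)[OF that] v(3)[OF that] by (simp add: algebra_simps)
    qed (use w(4,5) v(4,5) assms(6) in \<open>auto intro!: derivative_intros w(1,2) v(1,2) simp: algebra_simps\<close>)
    then show ?thesis by simp
  qed
  show ?thesis using le[OF assms(4,5)] le[OF assms(5,4)] by simp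
qed

lemma is_wsteady_cong:
  assumes "is_wsteady d a h q l w" "\<And>x. x \<in> {0..l} \<Longrightarrow> v x = w x" "0 < l"
  shows "is_wsteady d a h q l v"
proof -
  obtain w' w'' where w: "\<forall>x\<in>{0..l}. (w has_real_derivative w' x) (at x within {0..l})
                 \<and> (w' has_real_derivative w'' x) (at x within {0..l}) \<and> w x > 0"
    "continuous_on {0..l} w''"
    "\<forall>x\<in>{0<..<l}. d * w'' x - a * w' x + h - q * w x = 0"
    "d * w' 0 - a * w 0 = 0" "d * w' l - a * w l = 0"
    using assms(1) unfolding is_wsteady_def by blast
  have v: "(v has_real_derivative w' x) (at x within {0..l})" if "x \<in> {0..l}" for x
    by (rule has_field_derivative_transform_within[of w _ _ _ 1]) (use w(1) that assms(2) in auto)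
  show ?thesis
    unfolding is_wsteady_def
    by (intro exI[of _ w'] exI[of _ w''] conjI ballI v w(2)) (use w assms in auto)
qed

lemma wbar_is_wsteady:
  assumes "d > 0" "q > 0" "0 < l" "a \<ge> 0" "h > 0"
  shows "is_wsteady d a h q l (wbar d a h q l)"
proof -
  obtain w where w: "is_wsteady d a h q l w" using is_wsteady_exists[OF assms] by blast
  have "\<exists>!w. is_wsteady d a h q l w \<and> (\<forall>x. x \<notin> {0..l} \<longrightarrow> w x = 0)"
  proof (rule ex_ex1I)
    show "\<exists>w. is_wsteady d a h q l w \<and> (\<forall>x. x \<notin> {0..l} \<longrightarrow> w x = 0)"
      by (rule exI[of _ "\<lambda>x. if x \<in> {0..l} then w x else 0"], intro conjI is_wsteady_cong[OF w]) (use assms in auto)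
    fix v w assume "is_wsteady d a h q l v \<and> (\<forall>x. x \<notin> {0..l} \<longrightarrow> v x = 0)"
      "is_wsteady d a h q l w \<and> (\<forall>x. x \<notin> {0..l} \<longrightarrow> w x = 0)"
    then have "v x = w x" for x
      using is_wsteady_unique[OF assms(1-3), of a h v w x] by (cases "x \<in> {0..l}") auto
    then show "v = w" ..
  qed
  from theI'[OF this] show ?thesis unfolding wbar_def by (rule conjunct1)
qed

lemma wbar_bounds:
  assumes "d > 0" "q > 0" "0 < l" "a \<ge> 0" "h > 0" "x \<in> {0..l}"
  shows "h / q * exp (- (a/d) * l) \<le> wbar d a h q l x" "wbar d a h q l x \<le> h / q * exp ((a/d) * l)"
    "0 < wbar d a h q l x"
proof -
  obtain w' w'' where w:
    "\<And>x. x \<in> {0..l} \<Longrightarrow> (wbar d a h q l has_real_derivative w' x) (at x within {0..l})"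
    "\<And>x. x \<in> {0<..<l} \<Longrightarrow> (w' has_real_derivative w'' x) (at x)"
    "\<And>x. x \<in> {0<..<l} \<Longrightarrow> d * w'' x - a * w' x + h - q * wbar d a h q l x = 0"
    "d * w' 0 - a * wbar d a h q l 0 = 0" "d * w' l - a * wbar d a h q l l = 0"
    "\<And>x. x \<in> {0..l} \<Longrightarrow> wbar d a h q l x > 0"
    by (rule is_wsteadyD[OF wbar_is_wsteady[OF assms(1-5)]]) blast
  show "h / q * exp (- (a/d) * l) \<le> wbar d a h q l x" "wbar d a h q l x \<le> h / q * exp ((a/d) * l)"
    by (rule steady_bounds[OF assms(1-5) w(1-5) assms(6)]; assumption)+
  show "0 < wbar d a h q l x" by (rule w(6)[OF assms(6)])
qed

lemma wbar_continuous:
  assumes "d > 0" "q > 0" "0 < l" "a \<ge> 0" "h > 0"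
  shows "continuous_on {0..l} (wbar d a h q l)"
  using is_wsteadyD[OF wbar_is_wsteady[OF assms]] DERIV_continuous_on by metis

lemma wbar_strict_antimono:
  assumes "d > 0" "0 < q1" "q1 < q2" "0 < l" "a \<ge> 0" "h > 0" "x \<in> {0..l}"
  shows "wbar d a h q2 l x < wbar d a h q1 l x"
proof -
  have q2: "q2 > 0" using assms by simp
  define w where "w = wbar d a h q1 l"
  define v where "v = wbar d a h q2 l"
  obtain w' w'' where w: "\<And>x. x \<in> {0..l} \<Longrightarrow> (w has_real_derivative w' x) (at x within {0..l})"
      "\<And>x. x \<in> {0<..<l} \<Longrightarrow> (w' has_real_derivative w'' x) (at x)"
      "\<And>x. x \<in> {0<..<l} \<Longrightarrow> d * w'' x - a * w' x + h - q1 * w x = 0"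
      "d * w' 0 - a * w 0 = 0" "d * w' l - a * w l = 0" "\<And>x. x \<in> {0..l} \<Longrightarrow> w x > 0"
    unfolding w_def by (rule is_wsteadyD[OF wbar_is_wsteady[OF assms(1,2,4-6)]]) blast
  obtain v' v'' where v: "\<And>x. x \<in> {0..l} \<Longrightarrow> (v has_real_derivative v' x) (at x within {0..l})"
      "\<And>x. x \<in> {0<..<l} \<Longrightarrow> (v' has_real_derivative v'' x) (at x)"
      "\<And>x. x \<in> {0<..<l} \<Longrightarrow> d * v'' x - a * v' x + h - q2 * v x = 0"
      "d * v' 0 - a * v 0 = 0" "d * v' l - a * v l = 0" "\<And>x. x \<in> {0..l} \<Longrightarrow> v x > 0"
    unfolding v_def by (rule is_wsteadyD[OF wbar_is_wsteady[OF assms(1) q2 assms(4-6)]]) blast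
  define c where "c = h / q2 * exp (- (a/d) * l)"
  have "c > 0" using assms q2 by (simp add: c_def)
  have vc: "c \<le> v x" if "x \<in> {0..l}" for x
    unfolding c_def v_def by (rule wbar_bounds(1)[OF assms(1) q2 assms(4-6) that])
  define e where "e = (q2 - q1) * c / h"
  have "e > 0" using \<open>c > 0\<close> assms by (simp add: e_def)
  have "0 \<le> w x - (1 + e) * v x"
  proof (rule elliptic_comparison[OF assms(1,2,4), where a = a and x = x
        and v = "\<lambda>x. w x - (1 + e) * v x" and v' = "\<lambda>x. w' x - (1 + e) * v' x"
        and v'' = "\<lambda>x. w'' x - (1 + e) * v'' x"])
    fix y assume y: "y \<in> {0<..<l}"
    have "c \<le> (1 + e) * v y" using mult_mono[of 1 "1 + e" c "v y"] vc[of y] y \<open>c > 0\<close> \<open>e > 0\<close> by auto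
    then have "(q2 - q1) * c \<le> (q2 - q1) * ((1 + e) * v y)" using assms(3) by (intro mult_left_mono) auto
    moreover have "e * h = (q2 - q1) * c" using \<open>h > 0\<close> by (simp add: e_def)
    moreover have "d * (w'' y - (1 + e) * v'' y) - a * (w' y - (1 + e) * v' y) - q1 * (w y - (1 + e) * v y)
        = (d * w'' y - a * w' y + h - q1 * w y) - (1 + e) * (d * v'' y - a * v' y + h - q2 * v y)
          + e * h - (q2 - q1) * ((1 + e) * v y)"
      by (simp add: algebra_simps)
    ultimately show "d * (w'' y - (1 + e) * v'' y) - a * (w' y - (1 + e) * v' y) - q1 * (w y - (1 + e) * v y) \<le> 0"
      using w(3)[OF y] v(3)[OF y] by simp
  next
    show "d * (w' 0 - (1 + e) * v' 0) - a * (w 0 - (1 + e) * v 0) \<le> 0"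
    proof -
      have "d * (w' 0 - (1 + e) * v' 0) - a * (w 0 - (1 + e) * v 0)
          = (d * w' 0 - a * w 0) - (1 + e) * (d * v' 0 - a * v 0)" by (simp add: algebra_simps)
      then show ?thesis using w(4) v(4) by simp
    qed
    show "0 \<le> d * (w' l - (1 + e) * v' l) - a * (w l - (1 + e) * v l)"
    proof -
      have "d * (w' l - (1 + e) * v' l) - a * (w l - (1 + e) * v l)
          = (d * w' l - a * w l) - (1 + e) * (d * v' l - a * v l)" by (simp add: algebra_simps)
      then show ?thesis using w(5) v(5) by simp
    qed
  qed (use assms(7) in \<open>auto intro!: derivative_intros DERIV_cmult w(1,2) v(1,2)\<close>)
  moreover have "v x < (1 + e) * v x" using vc[OF assms(7)] \<open>c > 0\<close> \<open>e > 0\<close> by simp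
  ultimately show ?thesis unfolding v_def w_def by simp
qed

section \<open>Global asymptotic stability\<close>

lemma continuous_on_strip_bounded:
  fixes f :: "real \<Rightarrow> real \<Rightarrow> real"
  assumes "continuous_on ({0..l} \<times> {0..}) (\<lambda>(x,t). f x t)"
  shows "\<exists>M\<ge>0. \<forall>x\<in>{0..l}. \<forall>t\<in>{0..T}. \<bar>f x t\<bar> \<le> M"
proof -
  have "continuous_on ({0..l} \<times> {0..T}) (\<lambda>(x,t). f x t)"
    by (rule continuous_on_subset[OF assms]) auto
  then have "bounded ((\<lambda>(x,t). f x t) ` ({0..l} \<times> {0..T}))"
    by (intro compact_imp_bounded compact_continuous_image compact_Times compact_Icc)
  then obtain M where "\<forall>y\<in>(\<lambda>(x,t). f x t) ` ({0..l} \<times> {0..T}). norm y \<le> M"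
    unfolding bounded_iff by blast
  then show ?thesis by (intro exI[of _ "max M 0"]) (auto simp: le_max_iff_disj)
qed

lemma glob_asym_stable_if_supersolution:
  fixes d1 d2 r m p q h L a1 a2 x2 \<delta> :: real
  assumes pos: "d1 > 0" "d2 > 0" "r > 0" "m > 0" "p > 0" "q > 0" "h > 0" "L > 0"
    "a1 > 0" "a2 \<ge> 0" "0 < x2" "x2 \<le> L"
    and "\<delta> > 0"
    and d\<Phi>: "\<And>x. (\<Phi> has_real_derivative \<Phi>' x) (at x)"
    and d\<Phi>': "\<And>x. (\<Phi>' has_real_derivative \<Phi>'' x) (at x)"
    and \<Phi>_pos: "\<And>x. x \<in> {0..L} \<Longrightarrow> \<Phi> x > 0"
    and \<Phi>_ode: "\<And>x. d1 * \<Phi>'' x - a1 * \<Phi>' x + r * \<Phi> x = - \<delta> * \<Phi> x"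
    and \<Phi>_bc: "d1 * \<Phi>' 0 - a1 * \<Phi> 0 = 0" "\<Phi>' L \<ge> 0"
  shows "glob_asym_stable d1 d2 a1 a2 r m p q h L x2"
  unfolding glob_asym_stable_def
proof (intro allI impI)
  fix u0 w0 u w and \<epsilon> :: real
  assume asm: "continuous_on {0..L} u0 \<and> (\<forall>x\<in>{0..L}. u0 x \<ge> 0) \<and> (\<exists>x\<in>{0..L}. u0 x \<noteq> 0)
      \<and> continuous_on {0..x2} w0 \<and> (\<forall>x\<in>{0..x2}. w0 x \<ge> 0) \<and> (\<exists>x\<in>{0..x2}. w0 x \<noteq> 0)
      \<and> is_solution d1 d2 a1 a2 r m p q h L x2 u0 w0 u w" and "\<epsilon> > 0"
  have u0: "continuous_on {0..L} u0" "\<And>x. x \<in> {0..L} \<Longrightarrow> u0 x \<ge> 0"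
    and w0: "continuous_on {0..x2} w0" "\<And>x. x \<in> {0..x2} \<Longrightarrow> w0 x \<ge> 0"
    and sol: "is_solution d1 d2 a1 a2 r m p q h L x2 u0 w0 u w"
    using asm by blast+
  have u_cont: "continuous_on ({0..L} \<times> {0..}) (\<lambda>(x,t). u x t)"
    and w_cont: "continuous_on ({0..x2} \<times> {0..}) (\<lambda>(x,t). w x t)"
    and u_init: "\<And>x. x \<in> {0..L} \<Longrightarrow> u x 0 = u0 x" and w_init: "\<And>x. x \<in> {0..x2} \<Longrightarrow> w x 0 = w0 x"
    using sol unfolding is_solution_def by blast+
  obtain ux uxx ut where
    u_dx: "\<forall>t>0. \<forall>x\<in>{0..L}. ((\<lambda>y. u y t) has_real_derivative ux x t) (at x within {0..L})"
    and u_pde: "\<forall>t>0. \<forall>x\<in>{0<..<L} - {x2}.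
               ((\<lambda>y. ux y t) has_real_derivative uxx x t) (at x)
             \<and> ((\<lambda>s. u x s) has_real_derivative ut x t) (at t)
             \<and> ut x t = d1 * uxx x t - a1 * ux x t + u x t * (r - u x t - m * chi x2 x * w x t)"
    and u_bc: "\<forall>t>0. d1 * ux 0 t - a1 * u 0 t = 0 \<and> ux L t = 0"
    using sol unfolding is_solution_def by blast
  obtain wx wxx wt where
    w_dx: "\<forall>t>0. \<forall>x\<in>{0..x2}. ((\<lambda>y. w y t) has_real_derivative wx x t) (at x within {0..x2})"
    and w_pde: "\<forall>t>0. \<forall>x\<in>{0<..<x2}.
               ((\<lambda>y. wx y t) has_real_derivative wxx x t) (at x)
             \<and> ((\<lambda>s. w x s) has_real_derivative wt x t) (at t)
             \<and> wt x t = d2 * wxx x t - a2 * wx x t + h - q * w x t - p * u x t * w x t"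
    and w_bc: "\<forall>t>0. d2 * wx 0 t - a2 * w 0 t = 0 \<and> d2 * wx x2 t - a2 * w x2 t = 0"
    using sol unfolding is_solution_def by blast
  note u_dx = u_dx[rule_format] and w_dx = w_dx[rule_format]
  have u_dxx: "((\<lambda>y. ux y t) has_real_derivative uxx x t) (at x)"
    and u_dt: "((\<lambda>s. u x s) has_real_derivative ut x t) (at t)"
    and u_eq: "ut x t = d1 * uxx x t - a1 * ux x t + u x t * (r - u x t - m * chi x2 x * w x t)"
    if "0 < t" "x \<in> {0<..<L} - {x2}" for x t
    using u_pde[rule_format, OF that] by blast+
  have w_dxx: "((\<lambda>y. wx y t) has_real_derivative wxx x t) (at x)"
    and w_dt: "((\<lambda>s. w x s) has_real_derivative wt x t) (at t)"
    and w_eq: "wt x t = d2 * wxx x t - a2 * wx x t + h - q * w x t - p * u x t * w x t"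
    if "0 < t" "x \<in> {0<..<x2}" for x t
    using w_pde[rule_format, OF that] by blast+
  define \<kappa> where "\<kappa> = a2 / d2"
  have a2: "a2 = d2 * \<kappa>" and "\<kappa> \<ge> 0" using pos by (auto simp: \<kappa>_def)
  have ux0: "ux 0 t = a1 / d1 * u 0 t" if "t > 0" for t
    using u_bc that pos by (auto simp: field_simps)
  have wx0: "wx 0 t = \<kappa> * w 0 t" "wx x2 t = \<kappa> * w x2 t" if "t > 0" for t
    using w_bc that pos by (auto simp: \<kappa>_def field_simps)
  have strip: "continuous_on ({0..l} \<times> {0..T}) (\<lambda>p. f (fst p) (snd p))"
    if "continuous_on ({0..l} \<times> {0..}) (\<lambda>(x,t). f x t)" for l T and f :: "real \<Rightarrow> real \<Rightarrow> real"
  proof -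
    have "{0..l} \<times> {0..T} \<subseteq> {0..l} \<times> {0..}" by auto
    from continuous_on_subset[OF that this] show ?thesis by (simp add: case_prod_beta)
  qed

  have u_nonneg: "0 \<le> u x t" if "x \<in> {0..L}" "t \<ge> 0" for x t
  proof -
    obtain MU where MU: "MU \<ge> 0" "\<forall>x\<in>{0..L}. \<forall>s\<in>{0..t}. \<bar>u x s\<bar> \<le> MU"
      using continuous_on_strip_bounded[OF u_cont] by blast
    obtain MW where MW: "MW \<ge> 0" "\<forall>x\<in>{0..x2}. \<forall>s\<in>{0..t}. \<bar>w x s\<bar> \<le> MW"
      using continuous_on_strip_bounded[OF w_cont] by blast
    show ?thesis
    proof (rule parabolic_comparison[where z = u and zx = ux and d = d1 and a = a1 and l = L and c = x2
          and T = t and K = "r + MU + m * MW" and ?b0.0 = "a1 / d1" and ?b1.0 = 0])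
      show "continuous_on ({0..L} \<times> {0..t}) (\<lambda>(x, t). u x t)"
        unfolding case_prod_beta by (rule strip[OF u_cont])
      show "((\<lambda>y. u y s) has_real_derivative ux y s) (at y within {0..L})" if "0 < s" "y \<in> {0..L}" for y s
        by (rule u_dx[OF that])
      fix y s assume s: "0 < s" "s \<le> t" and y: "y \<in> {0<..<L} - {x2}"
      have "\<bar>chi x2 y * w y s\<bar> \<le> MW" using MW y s by (auto simp: chi_def)
      then have "m * \<bar>chi x2 y * w y s\<bar> \<le> m * MW" using pos by simp
      moreover have "\<bar>u y s\<bar> \<le> MU" using MU y s by auto
      moreover have "\<bar>m * chi x2 y * w y s\<bar> = m * \<bar>chi x2 y * w y s\<bar>"
        using pos by (simp add: abs_mult)
      ultimately have "\<bar>r - u y s - m * chi x2 y * w y s\<bar> \<le> r + MU + m * MW"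
        using pos(3) by linarith
      then show "\<exists>zxx zt k. ((\<lambda>y. ux y s) has_real_derivative zxx) (at y)
          \<and> ((\<lambda>s. u y s) has_real_derivative zt) (at s)
          \<and> \<bar>k\<bar> \<le> r + MU + m * MW \<and> zt \<ge> d1 * zxx - a1 * ux y s + k * u y s"
      proof (intro exI conjI)
        show "((\<lambda>y. ux y s) has_real_derivative uxx y s) (at y)" by (rule u_dxx[OF s(1) y])
        show "((\<lambda>s. u y s) has_real_derivative ut y s) (at s)" by (rule u_dt[OF s(1) y])
        show "d1 * uxx y s - a1 * ux y s + (r - u y s - m * chi x2 y * w y s) * u y s \<le> ut y s"
          by (simp add: u_eq[OF s(1) y])
      qed
    qed (use pos that u_init u0(2) u_bc ux0 in simp_all)
  qed
  have w_nonneg: "0 \<le> w x t" if "x \<in> {0..x2}" "t \<ge> 0" for x t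
  proof -
    obtain MU where MU: "MU \<ge> 0" "\<forall>x\<in>{0..L}. \<forall>s\<in>{0..t}. \<bar>u x s\<bar> \<le> MU"
      using continuous_on_strip_bounded[OF u_cont] by blast
    show ?thesis
    proof (rule parabolic_comparison[where z = w and zx = wx and d = d2 and a = a2 and l = x2 and c = x2
          and T = t and K = "q + p * MU" and ?b0.0 = \<kappa> and ?b1.0 = \<kappa>])
      show "continuous_on ({0..x2} \<times> {0..t}) (\<lambda>(x, t). w x t)"
        unfolding case_prod_beta by (rule strip[OF w_cont])
      show "((\<lambda>y. w y s) has_real_derivative wx y s) (at y within {0..x2})" if "0 < s" "y \<in> {0..x2}" for y s
        by (rule w_dx[OF that])
      fix y s assume s: "0 < s" "s \<le> t" and "y \<in> {0<..<x2} - {x2}"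
      then have y: "y \<in> {0<..<x2}" by auto
      have "\<bar>u y s\<bar> \<le> MU" using MU y s pos by auto
      then have "p * \<bar>u y s\<bar> \<le> p * MU" using pos by simp
      moreover have "\<bar>p * u y s\<bar> = p * \<bar>u y s\<bar>" using pos by (simp add: abs_mult)
      ultimately have "\<bar>- q - p * u y s\<bar> \<le> q + p * MU" using pos(6) by linarith
      then show "\<exists>zxx zt k. ((\<lambda>y. wx y s) has_real_derivative zxx) (at y)
          \<and> ((\<lambda>s. w y s) has_real_derivative zt) (at s)
          \<and> \<bar>k\<bar> \<le> q + p * MU \<and> zt \<ge> d2 * zxx - a2 * wx y s + k * w y s"
      proof (intro exI conjI)
        show "((\<lambda>y. wx y s) has_real_derivative wxx y s) (at y)" by (rule w_dxx[OF s(1) y])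
        show "((\<lambda>s. w y s) has_real_derivative wt y s) (at s)" by (rule w_dt[OF s(1) y])
        show "d2 * wxx y s - a2 * wx y s + (- q - p * u y s) * w y s \<le> wt y s"
          using pos(7) by (simp add: w_eq[OF s(1) y] algebra_simps)
      qed
    qed (use pos that w_init w0(2) wx0 in simp_all)
  qed

  have \<Phi>_cont: "continuous_on {0..L} \<Phi>"
    using d\<Phi> by (meson DERIV_continuous continuous_at_imp_continuous_on)
  obtain \<phi>M where \<phi>M: "\<And>x. x \<in> {0..L} \<Longrightarrow> \<bar>\<Phi> x\<bar> \<le> \<phi>M" using continuous_on_Icc_bounded[OF \<Phi>_cont] by blast
  obtain y0 where y0: "y0 \<in> {0..L}" "\<And>x. x \<in> {0..L} \<Longrightarrow> \<Phi> y0 \<le> \<Phi> x"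
    using continuous_attains_inf[OF compact_Icc _ \<Phi>_cont] pos by fastforce
  obtain UM where UM: "\<And>x. x \<in> {0..L} \<Longrightarrow> \<bar>u0 x\<bar> \<le> UM" using continuous_on_Icc_bounded[OF u0(1)] by blast
  have "UM \<ge> 0" "\<phi>M \<ge> 0" using UM[OF y0(1)] \<phi>M[OF y0(1)] by linarith+
  define C where "C = UM / \<Phi> y0"
  have "C \<ge> 0" using \<open>UM \<ge> 0\<close> \<Phi>_pos[OF y0(1)] by (simp add: C_def)
  have u_le: "u x t \<le> C * exp (- \<delta> * t) * \<Phi> x" if "x \<in> {0..L}" "t \<ge> 0" for x t
  proof -
    have "0 \<le> C * exp (- \<delta> * t) * \<Phi> x - u x t"
    proof (rule parabolic_comparison[where z = "\<lambda>x t. C * exp (- \<delta> * t) * \<Phi> x - u x t"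
          and zx = "\<lambda>x t. C * exp (- \<delta> * t) * \<Phi>' x - ux x t" and d = d1 and a = a1 and l = L and c = x2
          and T = t and K = r and ?b0.0 = "a1 / d1" and ?b1.0 = 0])
      show "continuous_on ({0..L} \<times> {0..t}) (\<lambda>(x, t). C * exp (- \<delta> * t) * \<Phi> x - u x t)"
        unfolding case_prod_beta
        by (intro continuous_intros strip[OF u_cont] continuous_on_compose2[OF \<Phi>_cont]) auto
      show "0 \<le> C * exp (- \<delta> * 0) * \<Phi> y - u y 0" if y: "y \<in> {0..L}" for y
      proof -
        have "UM = C * \<Phi> y0" using \<Phi>_pos[OF y0(1)] by (simp add: C_def)
        also have "\<dots> \<le> C * \<Phi> y" using y0(2)[OF y] \<open>C \<ge> 0\<close> by (rule mult_left_mono)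
        finally show ?thesis using UM[OF y] u_init[OF y] by simp
      qed
      show "((\<lambda>y. C * exp (- \<delta> * s) * \<Phi> y - u y s) has_real_derivative
          C * exp (- \<delta> * s) * \<Phi>' y - ux y s) (at y within {0..L})" if "0 < s" "y \<in> {0..L}" for y s
        by (rule derivative_intros DERIV_cmult has_field_derivative_at_within[OF d\<Phi>] u_dx that)+
      show "C * exp (- \<delta> * s) * \<Phi>' 0 - ux 0 s \<le> a1 / d1 * (C * exp (- \<delta> * s) * \<Phi> 0 - u 0 s)" if "0 < s" for s
      proof -
        have "\<Phi>' 0 = a1 / d1 * \<Phi> 0" using \<Phi>_bc(1) pos by (simp add: field_simps)
        then show ?thesis using ux0[OF that] by (simp add: right_diff_distrib mult_ac)
      qed
      show "0 * (C * exp (- \<delta> * s) * \<Phi> L - u L s) \<le> C * exp (- \<delta> * s) * \<Phi>' L - ux L s" if "0 < s" for s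
        using \<Phi>_bc(2) \<open>C \<ge> 0\<close> u_bc that by simp
      fix y s assume s: "0 < s" "s \<le> t" and y: "y \<in> {0<..<L} - {x2}"
      define e where "e = C * exp (- \<delta> * s)"
      have 1: "((\<lambda>y. C * exp (- \<delta> * s) * \<Phi>' y - ux y s) has_real_derivative e * \<Phi>'' y - uxx y s) (at y)"
        unfolding e_def by (rule derivative_intros DERIV_cmult d\<Phi>' u_dxx s(1) y)+
      have "((\<lambda>s. C * exp (- \<delta> * s) * \<Phi> y) has_real_derivative - \<delta> * e * \<Phi> y) (at s)"
        unfolding e_def by (rule derivative_eq_intros refl)+ simp
      then have 2: "((\<lambda>s. C * exp (- \<delta> * s) * \<Phi> y - u y s) has_real_derivative - \<delta> * e * \<Phi> y - ut y s) (at s)"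
        by (rule DERIV_diff[OF _ u_dt[OF s(1) y]])
      have "0 \<le> m * (chi x2 y * w y s)" using w_nonneg[of y s] y s pos by (auto simp: chi_def)
      then have "0 \<le> u y s * (u y s + m * chi x2 y * w y s)"
        using u_nonneg[of y s] y s by (auto simp: mult.assoc)
      moreover have "ut y s = d1 * uxx y s - a1 * ux y s + u y s * (r - u y s - m * chi x2 y * w y s)"
        by (rule u_eq[OF s(1) y])
      moreover have "e * (d1 * \<Phi>'' y - a1 * \<Phi>' y + r * \<Phi> y) = e * (- \<delta> * \<Phi> y)"
        using \<Phi>_ode[of y] by simp
      ultimately have 3: "- \<delta> * e * \<Phi> y - ut y s
          \<ge> d1 * (e * \<Phi>'' y - uxx y s) - a1 * (e * \<Phi>' y - ux y s) + r * (e * \<Phi> y - u y s)"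
        by (simp add: algebra_simps)
      show "\<exists>zxx zt k. ((\<lambda>y. C * exp (- \<delta> * s) * \<Phi>' y - ux y s) has_real_derivative zxx) (at y)
          \<and> ((\<lambda>s. C * exp (- \<delta> * s) * \<Phi> y - u y s) has_real_derivative zt) (at s)
          \<and> \<bar>k\<bar> \<le> r \<and> zt \<ge> d1 * zxx - a1 * (C * exp (- \<delta> * s) * \<Phi>' y - ux y s) + k * (C * exp (- \<delta> * s) * \<Phi> y - u y s)"
        using 1 2
      proof (intro exI conjI)
        show "- \<delta> * e * \<Phi> y - ut y s \<ge> d1 * (e * \<Phi>'' y - uxx y s)
            - a1 * (C * exp (- \<delta> * s) * \<Phi>' y - ux y s) + r * (C * exp (- \<delta> * s) * \<Phi> y - u y s)"
          using 3 unfolding e_def .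
      qed (use pos in simp_all)
    qed (use pos that in simp_all)
    then show ?thesis by simp
  qed

  define wb where "wb = wbar d2 a2 h q x2"
  obtain w1 w2 where wb: "\<And>x. x \<in> {0..x2} \<Longrightarrow> (wb has_real_derivative w1 x) (at x within {0..x2})"
    "\<And>x. x \<in> {0<..<x2} \<Longrightarrow> (w1 has_real_derivative w2 x) (at x)"
    "\<And>x. x \<in> {0<..<x2} \<Longrightarrow> d2 * w2 x - a2 * w1 x + h - q * wb x = 0"
    "d2 * w1 0 - a2 * wb 0 = 0" "d2 * w1 x2 - a2 * wb x2 = 0" "\<And>x. x \<in> {0..x2} \<Longrightarrow> wb x > 0"
    unfolding wb_def by (rule is_wsteadyD[OF wbar_is_wsteady[of d2 q x2 a2 h]]) (use pos in blast)+
  have w1: "w1 0 = \<kappa> * wb 0" "w1 x2 = \<kappa> * wb x2"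
    using wb(4,5) pos by (auto simp: \<kappa>_def field_simps)
  have wb_cont: "continuous_on {0..x2} wb" using wb(1) by (rule DERIV_continuous_on)
  obtain BM where BM: "\<And>x. x \<in> {0..x2} \<Longrightarrow> \<bar>wb x\<bar> \<le> BM" using continuous_on_Icc_bounded[OF wb_cont] by blast
  obtain WM where WM: "\<And>x. x \<in> {0..x2} \<Longrightarrow> \<bar>w0 x\<bar> \<le> WM" using continuous_on_Icc_bounded[OF w0(1)] by blast
  have "BM \<ge> 0" "WM \<ge> 0" using BM[of 0] WM[of 0] pos by auto
  have E_ge: "1 \<le> exp (\<kappa> * x)" "exp (\<kappa> * x) \<le> exp (\<kappa> * x2)" if "x \<in> {0..x2}" for x
    using that \<open>\<kappa> \<ge> 0\<close> by (auto simp: mult_left_mono)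

  \<comment> \<open>\<open>exp (\<kappa> * x)\<close> has zero flux, so the diffusion-advection terms and both boundary conditions vanish on it.\<close>
  have barrier: "0 \<le> \<sigma> * (w x t - wb x) + D * exp (- \<eta> * t) * exp (\<kappa> * x)"
    if "x \<in> {0..x2}" "t \<ge> 0" "\<bar>\<sigma>\<bar> = 1" "BM + WM \<le> D"
      and src: "\<And>y s. y \<in> {0<..<x2} \<Longrightarrow> 0 < s \<Longrightarrow>
        \<sigma> * (p * u y s * w y s) \<le> (q - \<eta>) * (D * exp (- \<eta> * s) * exp (\<kappa> * y))"
    for x t \<sigma> D \<eta>
  proof (rule parabolic_comparison[where z = "\<lambda>x t. \<sigma> * (w x t - wb x) + D * exp (- \<eta> * t) * exp (\<kappa> * x)"
        and zx = "\<lambda>x t. \<sigma> * (wx x t - w1 x) + \<kappa> * (D * exp (- \<eta> * t) * exp (\<kappa> * x))"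
        and d = d2 and a = a2 and l = x2 and c = x2 and T = t and K = q and ?b0.0 = \<kappa> and ?b1.0 = \<kappa>])
    have dE: "((\<lambda>y. c * exp (\<kappa> * y)) has_real_derivative \<kappa> * (c * exp (\<kappa> * y))) (at y within S)" for c y S
      by (rule derivative_eq_intros refl)+ simp
    show "continuous_on ({0..x2} \<times> {0..t}) (\<lambda>(x, t). \<sigma> * (w x t - wb x) + D * exp (- \<eta> * t) * exp (\<kappa> * x))"
      unfolding case_prod_beta
      by (intro continuous_intros strip[OF w_cont] continuous_on_compose2[OF wb_cont]) auto
    show "0 \<le> \<sigma> * (w y 0 - wb y) + D * exp (- \<eta> * 0) * exp (\<kappa> * y)" if y: "y \<in> {0..x2}" for y
    proof -
      have "\<bar>\<sigma> * (w y 0 - wb y)\<bar> \<le> BM + WM"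
        using BM[OF y] WM[OF y] w_init[OF y] \<open>\<bar>\<sigma>\<bar> = 1\<close> by (simp add: abs_mult)
      moreover have "D * 1 \<le> D * exp (\<kappa> * y)"
        using E_ge(1)[OF y] \<open>BM + WM \<le> D\<close> \<open>BM \<ge> 0\<close> \<open>WM \<ge> 0\<close> by (intro mult_left_mono) auto
      ultimately show ?thesis using \<open>BM + WM \<le> D\<close> by simp
    qed
    show "((\<lambda>y. \<sigma> * (w y s - wb y) + D * exp (- \<eta> * s) * exp (\<kappa> * y)) has_real_derivative
        \<sigma> * (wx y s - w1 y) + \<kappa> * (D * exp (- \<eta> * s) * exp (\<kappa> * y))) (at y within {0..x2})"
      if "0 < s" "y \<in> {0..x2}" for y s
      by (rule derivative_intros DERIV_cmult dE wb(1) w_dx that)+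
    show "\<sigma> * (wx 0 s - w1 0) + \<kappa> * (D * exp (- \<eta> * s) * exp (\<kappa> * 0))
        \<le> \<kappa> * (\<sigma> * (w 0 s - wb 0) + D * exp (- \<eta> * s) * exp (\<kappa> * 0))" if "0 < s" for s
      using wx0(1)[OF that] w1(1) by (simp add: algebra_simps)
    show "\<kappa> * (\<sigma> * (w x2 s - wb x2) + D * exp (- \<eta> * s) * exp (\<kappa> * x2))
        \<le> \<sigma> * (wx x2 s - w1 x2) + \<kappa> * (D * exp (- \<eta> * s) * exp (\<kappa> * x2))" if "0 < s" for s
      using wx0(2)[OF that] w1(2) by (simp add: algebra_simps)
    fix y s assume s: "0 < s" "s \<le> t" and "y \<in> {0<..<x2} - {x2}"
    then have y: "y \<in> {0<..<x2}" by auto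
    define e where "e = D * exp (- \<eta> * s) * exp (\<kappa> * y)"
    have 1: "((\<lambda>y. \<sigma> * (wx y s - w1 y) + \<kappa> * (D * exp (- \<eta> * s) * exp (\<kappa> * y))) has_real_derivative
        \<sigma> * (wxx y s - w2 y) + \<kappa> * (\<kappa> * e)) (at y)"
      unfolding e_def by (rule derivative_intros DERIV_cmult dE wb(2) w_dxx s(1) y)+
    have "((\<lambda>s. D * exp (- \<eta> * s) * exp (\<kappa> * y)) has_real_derivative - \<eta> * e) (at s)"
      unfolding e_def by (rule derivative_eq_intros refl)+ simp
    moreover have "((\<lambda>s. \<sigma> * (w y s - wb y)) has_real_derivative \<sigma> * (wt y s - 0)) (at s)"
      by (rule DERIV_cmult derivative_intros w_dt s(1) y)+
    ultimately have 2: "((\<lambda>s. \<sigma> * (w y s - wb y) + D * exp (- \<eta> * s) * exp (\<kappa> * y)) has_real_derivative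
        \<sigma> * wt y s - \<eta> * e) (at s)"
      using DERIV_add[of _ "\<sigma> * (wt y s - 0)"] by fastforce
    have eq: "d2 * (\<sigma> * (wxx y s - w2 y) + \<kappa> * (\<kappa> * e)) - a2 * (\<sigma> * (wx y s - w1 y) + \<kappa> * e)
        + (- q) * (\<sigma> * (w y s - wb y) + e)
        = \<sigma> * (wt y s + p * u y s * w y s) - \<sigma> * (d2 * w2 y - a2 * w1 y + h - q * wb y) - q * e"
      unfolding w_eq[OF s(1) y] a2 by (simp add: algebra_simps)
    have "\<sigma> * (d2 * w2 y - a2 * w1 y + h - q * wb y) = 0" using wb(3)[OF y] by simp
    moreover have "\<sigma> * (p * u y s * w y s) \<le> q * e - \<eta> * e"
      using src[OF y s(1)] unfolding e_def left_diff_distrib .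
    ultimately have 3: "\<sigma> * wt y s - \<eta> * e \<ge> d2 * (\<sigma> * (wxx y s - w2 y) + \<kappa> * (\<kappa> * e))
        - a2 * (\<sigma> * (wx y s - w1 y) + \<kappa> * e) + (- q) * (\<sigma> * (w y s - wb y) + e)"
      using eq distrib_left[of \<sigma> "wt y s" "p * u y s * w y s"] by linarith
    show "\<exists>zxx zt k.
        ((\<lambda>y. \<sigma> * (wx y s - w1 y) + \<kappa> * (D * exp (- \<eta> * s) * exp (\<kappa> * y))) has_real_derivative zxx) (at y)
        \<and> ((\<lambda>s. \<sigma> * (w y s - wb y) + D * exp (- \<eta> * s) * exp (\<kappa> * y)) has_real_derivative zt) (at s)
        \<and> \<bar>k\<bar> \<le> q \<and> zt \<ge> d2 * zxx - a2 * (\<sigma> * (wx y s - w1 y) + \<kappa> * (D * exp (- \<eta> * s) * exp (\<kappa> * y)))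
            + k * (\<sigma> * (w y s - wb y) + D * exp (- \<eta> * s) * exp (\<kappa> * y))"
      using 1 2
    proof (intro exI conjI)
      show "\<sigma> * wt y s - \<eta> * e \<ge> d2 * (\<sigma> * (wxx y s - w2 y) + \<kappa> * (\<kappa> * e))
          - a2 * (\<sigma> * (wx y s - w1 y) + \<kappa> * (D * exp (- \<eta> * s) * exp (\<kappa> * y)))
          + (- q) * (\<sigma> * (w y s - wb y) + D * exp (- \<eta> * s) * exp (\<kappa> * y))"
        using 3 unfolding e_def .
    qed (use pos in simp_all)
  qed (use pos that in simp_all)

  define D1 where "D1 = BM + WM"
  have "D1 \<ge> 0" using \<open>BM \<ge> 0\<close> \<open>WM \<ge> 0\<close> by (simp add: D1_def)
  have upper: "w x t - wb x \<le> D1 * exp (- q * t) * exp (\<kappa> * x)" if "x \<in> {0..x2}" "t \<ge> 0" for x t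
  proof -
    have "0 \<le> (-1) * (w x t - wb x) + D1 * exp (- q * t) * exp (\<kappa> * x)"
    proof (rule barrier[OF that])
      fix y s :: real assume "y \<in> {0<..<x2}" "0 < s"
      then have "0 \<le> p * u y s * w y s" using u_nonneg[of y s] w_nonneg[of y s] pos by simp
      then show "- 1 * (p * u y s * w y s) \<le> (q - q) * (D1 * exp (- q * s) * exp (\<kappa> * y))" by simp
    qed (auto simp: D1_def)
    then show ?thesis by simp
  qed
  define W where "W = BM + D1 * exp (\<kappa> * x2)"
  have "W \<ge> 0" using \<open>BM \<ge> 0\<close> \<open>D1 \<ge> 0\<close> by (simp add: W_def)
  have w_le: "w x t \<le> W" if "x \<in> {0..x2}" "t \<ge> 0" for x t
  proof -
    have "exp (- q * t) * exp (\<kappa> * x) \<le> 1 * exp (\<kappa> * x2)"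
      using E_ge(2)[OF that(1)] that(2) pos by (intro mult_mono) auto
    then have "D1 * (exp (- q * t) * exp (\<kappa> * x)) \<le> D1 * (1 * exp (\<kappa> * x2))"
      using \<open>D1 \<ge> 0\<close> by (rule mult_left_mono)
    then show ?thesis using upper[OF that] BM[OF that(1)] by (simp add: W_def mult.assoc)
  qed
  define \<eta> where "\<eta> = min \<delta> (q/2)"
  have \<eta>: "0 < \<eta>" "\<eta> \<le> \<delta>" "q / 2 \<le> q - \<eta>" using pos \<open>\<delta> > 0\<close> by (auto simp: \<eta>_def)
  define S where "S = p * (C * \<phi>M) * W"
  have "S \<ge> 0" using pos \<open>C \<ge> 0\<close> \<open>\<phi>M \<ge> 0\<close> \<open>W \<ge> 0\<close> by (simp add: S_def)
  define D2 where "D2 = D1 + 2 * S / q"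
  have "D2 \<ge> 0" using \<open>D1 \<ge> 0\<close> \<open>S \<ge> 0\<close> pos by (simp add: D2_def)
  have u_le2: "u x t \<le> C * \<phi>M * exp (- \<eta> * t)" if "x \<in> {0..L}" "t \<ge> 0" for x t
  proof -
    have "u x t \<le> (C * exp (- \<delta> * t)) * \<Phi> x" by (rule u_le[OF that])
    also have "\<dots> \<le> (C * exp (- \<eta> * t)) * \<phi>M"
      using \<phi>M[OF that(1)] \<open>C \<ge> 0\<close> \<eta> that(2) \<Phi>_pos[OF that(1)]
      by (intro mult_mono) (auto simp: mult_right_mono)
    finally show ?thesis by (simp add: mult_ac)
  qed
  have lower: "- (D2 * exp (- \<eta> * t) * exp (\<kappa> * x)) \<le> w x t - wb x" if "x \<in> {0..x2}" "t \<ge> 0" for x t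
  proof -
    have "0 \<le> 1 * (w x t - wb x) + D2 * exp (- \<eta> * t) * exp (\<kappa> * x)"
    proof (rule barrier[OF that])
      show "BM + WM \<le> D2" using \<open>S \<ge> 0\<close> pos by (simp add: D2_def D1_def)
      fix y s :: real assume y: "y \<in> {0<..<x2}" and s: "0 < s"
      have "p * u y s \<le> p * (C * \<phi>M * exp (- \<eta> * s))"
        using u_le2[of y s] y s pos by (intro mult_left_mono) auto
      then have "p * u y s * w y s \<le> p * (C * \<phi>M * exp (- \<eta> * s)) * W"
        using w_le[of y s] w_nonneg[of y s] u_nonneg[of y s] y s pos \<open>C \<ge> 0\<close> \<open>\<phi>M \<ge> 0\<close>
        by (intro mult_mono) auto
      also have "\<dots> = (q / 2) * ((2 * S / q * exp (- \<eta> * s)) * 1)"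
        using pos by (simp add: S_def field_simps)
      also have "\<dots> \<le> (q - \<eta>) * ((D2 * exp (- \<eta> * s)) * exp (\<kappa> * y))"
        using \<eta> pos \<open>S \<ge> 0\<close> \<open>D1 \<ge> 0\<close> \<open>D2 \<ge> 0\<close> E_ge(1)[of y] y
        by (intro mult_mono mult_right_mono) (auto simp: D2_def)
      finally show "1 * (p * u y s * w y s) \<le> (q - \<eta>) * (D2 * exp (- \<eta> * s) * exp (\<kappa> * y))" by simp
    qed simp
    then show ?thesis by simp
  qed
  define Z where "Z = C * \<phi>M + D2 * exp (\<kappa> * x2)"
  have u_Z: "\<bar>u x t\<bar> \<le> Z * exp (- \<eta> * t)" if "x \<in> {0..L}" "t \<ge> 0" for x t
  proof -
    have "C * \<phi>M * exp (- \<eta> * t) \<le> Z * exp (- \<eta> * t)"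
      using \<open>D2 \<ge> 0\<close> by (intro mult_right_mono) (auto simp: Z_def)
    then show ?thesis using u_le2[OF that] unfolding abs_of_nonneg[OF u_nonneg[OF that]] by linarith
  qed
  have w_Z: "\<bar>w x t - wb x\<bar> \<le> Z * exp (- \<eta> * t)" if "x \<in> {0..x2}" "t \<ge> 0" for x t
  proof -
    have "D2 * exp (- \<eta> * t) * exp (\<kappa> * x) \<le> D2 * exp (- \<eta> * t) * exp (\<kappa> * x2)"
      using E_ge(2)[OF that(1)] \<open>D2 \<ge> 0\<close> by (intro mult_left_mono) auto
    also have "\<dots> = (D2 * exp (\<kappa> * x2)) * exp (- \<eta> * t)" by simp
    also have "\<dots> \<le> Z * exp (- \<eta> * t)"
      using \<open>C \<ge> 0\<close> \<open>\<phi>M \<ge> 0\<close> by (intro mult_right_mono) (auto simp: Z_def)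
    finally have *: "D2 * exp (- \<eta> * t) * exp (\<kappa> * x) \<le> Z * exp (- \<eta> * t)" .
    have "exp (- q * t) \<le> exp (- \<eta> * t)"
      using \<eta> pos that(2) by (simp add: mult_right_mono)
    then have "D1 * exp (- q * t) * exp (\<kappa> * x) \<le> D2 * exp (- \<eta> * t) * exp (\<kappa> * x)"
      using \<open>D1 \<ge> 0\<close> \<open>D2 \<ge> 0\<close> \<open>S \<ge> 0\<close> pos by (intro mult_right_mono mult_mono) (auto simp: D2_def)
    then show ?thesis using upper[OF that] lower[OF that] * unfolding abs_le_iff by linarith
  qed
  have "((\<lambda>t. Z * exp (- \<eta> * t)) \<longlongrightarrow> Z * 0) at_top"
    using \<eta>(1)
    by (intro tendsto_intros filterlim_compose[OF exp_at_bot]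
        filterlim_tendsto_neg_mult_at_bot[OF tendsto_const _ filterlim_ident]) auto
  then have "eventually (\<lambda>t. Z * exp (- \<eta> * t) < \<epsilon>) at_top"
    using \<open>\<epsilon> > 0\<close> by (intro order_tendstoD(2)[where a = \<epsilon>]) auto
  then obtain T where T: "\<And>t. t \<ge> T \<Longrightarrow> Z * exp (- \<eta> * t) < \<epsilon>"
    unfolding eventually_at_top_linorder by blast
  show "\<exists>T. \<forall>t\<ge>T. (\<forall>x\<in>{0..L}. \<bar>u x t\<bar> < \<epsilon>) \<and> (\<forall>x\<in>{0..x2}. \<bar>w x t - wbar d2 a2 h q x2 x\<bar> < \<epsilon>)"
  proof (intro exI[of _ "max T 0"] allI impI conjI ballI)
    fix t x assume t: "max T 0 \<le> t"
    show "\<bar>u x t\<bar> < \<epsilon>" if "x \<in> {0..L}" using u_Z[OF that, of t] T[of t] t by simp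
    show "\<bar>w x t - wbar d2 a2 h q x2 x\<bar> < \<epsilon>" if "x \<in> {0..x2}"
      using w_Z[OF that, of t] T[of t] t unfolding wb_def by simp
  qed
qed

section \<open>Explicit test functions and critical lengths\<close>

lemma sign_threshold:
  fixes f :: "real \<Rightarrow> real"
  assumes mono: "\<And>x y. 0 < x \<Longrightarrow> x < y \<Longrightarrow> f x < f y" and ex: "\<exists>x>0. f x > 0"
  shows "\<exists>c. \<forall>x>0. (x > c \<longrightarrow> f x > 0) \<and> (x < c \<longrightarrow> f x < 0)"
proof -
  define S where "S = {x. 0 < x \<and> f x > 0}"
  have ne: "S \<noteq> {}" and bdd: "bdd_below S" using ex by (auto simp: S_def bdd_below_def intro: less_imp_le)
  show ?thesis
  proof (intro exI[of _ "Inf S"] allI impI conjI)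
    fix x :: real assume "0 < x"
    show "f x > 0" if x: "Inf S < x"
    proof -
      obtain y where "y \<in> S" "y < x" using cInf_lessD[OF ne x] by blast
      then show ?thesis using mono[of y x] by (auto simp: S_def)
    qed
    show "f x < 0" if x: "x < Inf S"
    proof -
      define y where "y = (x + Inf S) / 2"
      have "x < y" "y < Inf S" using x by (auto simp: y_def)
      have "y \<notin> S"
      proof
        assume "y \<in> S"
        then have "Inf S \<le> y" by (rule cInf_lower[OF _ bdd])
        then show False using \<open>y < Inf S\<close> by simp
      qed
      then have "f y \<le> 0" using \<open>0 < x\<close> \<open>x < y\<close> by (auto simp: S_def)
      then show ?thesis using mono[OF \<open>0 < x\<close> \<open>x < y\<close>] by simp
    qed
  qed
qed

definition exp_cos :: "real \<Rightarrow> real \<Rightarrow> real \<Rightarrow> real \<Rightarrow> real" where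
  "exp_cos \<alpha> \<omega> \<theta> x = exp (\<alpha> * x) * cos (\<omega> * x - \<theta>)"

definition exp_cos' :: "real \<Rightarrow> real \<Rightarrow> real \<Rightarrow> real \<Rightarrow> real" where
  "exp_cos' \<alpha> \<omega> \<theta> x = exp (\<alpha> * x) * (\<alpha> * cos (\<omega> * x - \<theta>) - \<omega> * sin (\<omega> * x - \<theta>))"

definition exp_cos'' :: "real \<Rightarrow> real \<Rightarrow> real \<Rightarrow> real \<Rightarrow> real" where
  "exp_cos'' \<alpha> \<omega> \<theta> x =
     exp (\<alpha> * x) * ((\<alpha>\<^sup>2 - \<omega>\<^sup>2) * cos (\<omega> * x - \<theta>) - 2 * \<alpha> * \<omega> * sin (\<omega> * x - \<theta>))"

lemma exp_cos_derivative: "(exp_cos \<alpha> \<omega> \<theta> has_real_derivative exp_cos' \<alpha> \<omega> \<theta> x) (at x)"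
  unfolding exp_cos_def[abs_def] exp_cos'_def
  by (rule derivative_eq_intros refl)+ (simp add: algebra_simps)

lemma exp_cos'_derivative: "(exp_cos' \<alpha> \<omega> \<theta> has_real_derivative exp_cos'' \<alpha> \<omega> \<theta> x) (at x)"
  unfolding exp_cos'_def[abs_def] exp_cos''_def
  by (rule derivative_eq_intros refl)+ (simp add: algebra_simps power2_eq_square)

lemma exp_cos_ode:
  assumes "d > 0" "\<alpha> = a / (2 * d)"
  shows "d * exp_cos'' \<alpha> \<omega> \<theta> x - a * exp_cos' \<alpha> \<omega> \<theta> x + d * (\<omega>\<^sup>2 + \<alpha>\<^sup>2) * exp_cos \<alpha> \<omega> \<theta> x = 0"
proof -
  have a: "a = 2 * d * \<alpha>" using assms by simp
  show ?thesis unfolding a exp_cos_def exp_cos'_def exp_cos''_def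
    by (simp add: algebra_simps power2_eq_square)
qed

lemma exp_cos_solves_ode:
  assumes "d > 0" "\<alpha> = a / (2 * d)"
  shows "solves_ode d a (\<lambda>_. d * (\<omega>\<^sup>2 + \<alpha>\<^sup>2)) y1 y2 (exp_cos \<alpha> \<omega> \<theta>) (exp_cos' \<alpha> \<omega> \<theta>)"
  by (rule solves_ode_smooth[OF exp_cos_derivative exp_cos'_derivative exp_cos_ode[OF assms]])

lemma exp_cos'_arctan_phase:
  assumes "\<omega> > 0" "\<theta> = arctan (\<alpha> / \<omega>)"
  shows "exp_cos' \<alpha> \<omega> \<theta> x = exp (\<alpha> * x) * (\<omega> / cos \<theta>) * sin (2 * \<theta> - \<omega> * x)"
proof -
  have c: "cos \<theta> \<noteq> 0" using assms(2) cos_arctan_not_zero by simp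
  have "tan \<theta> = \<alpha> / \<omega>" using assms(2) by (simp add: tan_arctan)
  then have \<alpha>: "\<alpha> = \<omega> * sin \<theta> / cos \<theta>" using assms(1) by (simp add: tan_def field_simps)
  have "2 * \<theta> - \<omega> * x = \<theta> - (\<omega> * x - \<theta>)" by simp
  then have s: "sin (2 * \<theta> - \<omega> * x) = sin \<theta> * cos (\<omega> * x - \<theta>) - cos \<theta> * sin (\<omega> * x - \<theta>)"
    by (simp only: sin_diff)
  have "(\<omega> * sin \<theta> / cos \<theta>) * cos (\<omega> * x - \<theta>) - \<omega> * sin (\<omega> * x - \<theta>)
      = \<omega> / cos \<theta> * sin (2 * \<theta> - \<omega> * x)"
    unfolding s using c by (simp add: field_simps)
  then show ?thesis unfolding exp_cos'_def using \<alpha> by (metis mult.assoc)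
qed

lemma exp_cos_arctan_phase_robin:
  assumes "d > 0" "\<omega> > 0" "\<alpha> = a / (2 * d)" "\<theta> = arctan (\<alpha> / \<omega>)"
  shows "d * exp_cos' \<alpha> \<omega> \<theta> 0 - a * exp_cos \<alpha> \<omega> \<theta> 0 = 0"
proof -
  have "tan \<theta> = \<alpha> / \<omega>" using assms(4) by (simp add: tan_arctan)
  moreover have "cos \<theta> \<noteq> 0" using assms(4) cos_arctan_not_zero by simp
  ultimately have "\<omega> * sin \<theta> = \<alpha> * cos \<theta>" using assms(2) by (simp add: tan_def field_simps)
  then have "exp_cos' \<alpha> \<omega> \<theta> 0 = 2 * \<alpha> * cos \<theta>" by (simp add: exp_cos'_def)
  then show ?thesis using assms(1,3) by (simp add: exp_cos_def)
qed

lemma exp_cos_arctan_phase_pos: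
  assumes "\<theta> = arctan (\<alpha> / \<omega>)" "0 < \<omega>" "0 \<le> x" "\<omega> * x \<le> 2 * \<theta>"
  shows "exp_cos \<alpha> \<omega> \<theta> x > 0"
proof -
  have "\<theta> < pi / 2" using assms(1) arctan_bounded by blast
  moreover have "0 \<le> \<omega> * x" using assms by simp
  ultimately have "0 < cos (\<omega> * x - \<theta>)" using assms(4) by (intro cos_gt_zero_pi) linarith+
  then show ?thesis by (simp add: exp_cos_def)
qed

lemma critical_lengths:
  assumes "d > 0" "r > 0" "a > 0" "a < sqrt (4*d*r)"
  defines "\<alpha> \<equiv> a / (2 * d)" and "\<omega> \<equiv> sqrt (4*d*r - a\<^sup>2) / (2 * d)"
  shows "\<omega> > 0" "d * (\<omega>\<^sup>2 + \<alpha>\<^sup>2) = r"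
    "L1star d r a = 2 * arctan (\<alpha> / \<omega>) / \<omega>" "Lstar d r a = (pi - arctan (\<omega> / \<alpha>)) / \<omega>"
proof -
  define s where "s = sqrt (4*d*r - a\<^sup>2)"
  have "a\<^sup>2 < 4*d*r" using assms(3,4) by (metis less_eq_real_def real_less_lsqrt real_sqrt_less_iff real_sqrt_unique)
  then have "s > 0" and s2: "s\<^sup>2 = 4*d*r - a\<^sup>2" by (simp_all add: s_def)
  have \<omega>: "\<omega> = s / (2 * d)" by (simp add: \<omega>_def s_def)
  show "\<omega> > 0" using \<open>s > 0\<close> assms(1) by (simp add: \<omega>)
  have "\<omega>\<^sup>2 + \<alpha>\<^sup>2 = (s\<^sup>2 + a\<^sup>2) / (4 * d\<^sup>2)"
    by (simp add: \<omega> \<alpha>_def power_divide power_mult_distrib add_divide_distrib)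
  also have "s\<^sup>2 + a\<^sup>2 = 4*d*r" by (simp add: s2)
  finally show "d * (\<omega>\<^sup>2 + \<alpha>\<^sup>2) = r" using assms(1) by (simp only:) (simp add: power2_eq_square)
  have ratio: "\<alpha> / \<omega> = a / s" "\<omega> / \<alpha> = s / a" using assms(1) by (simp_all add: \<omega> \<alpha>_def)
  have inv: "y / \<omega> = 2 * d * y / s" for y using \<open>s > 0\<close> assms(1) by (simp add: \<omega> field_simps)
  show "Lstar d r a = (pi - arctan (\<omega> / \<alpha>)) / \<omega>"
    unfolding ratio unfolding inv Lstar_def by (simp add: s_def)
  have diff: "2*d*r - a\<^sup>2 = (s\<^sup>2 - a\<^sup>2) / 2" by (simp add: s2)
  consider "a < s" | "a = s" | "s < a" by linarith
  then show "L1star d r a = 2 * arctan (\<alpha> / \<omega>) / \<omega>"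
  proof cases
    case 1
    then have "a\<^sup>2 < s\<^sup>2" using assms(3) by (simp add: power_strict_mono)
    then have "a < sqrt (2*d*r)" using diff by (intro real_less_rsqrt) simp
    moreover have "2 * arctan (a / s) = arctan (2 * (a / s) / (1 - (a / s)\<^sup>2))"
      using 1 assms(3) \<open>s > 0\<close> by (intro arctan_double) simp
    moreover have "2 * (a / s) / (1 - (a / s)\<^sup>2) = a * s / (2*d*r - a\<^sup>2)"
      unfolding diff using \<open>a\<^sup>2 < s\<^sup>2\<close> \<open>s > 0\<close> by (simp add: field_simps power2_eq_square)
    ultimately show ?thesis unfolding ratio unfolding inv L1star_def s_def[symmetric] by simp
  next
    case 2
    then have "2*d*r = a\<^sup>2" using diff by simp
    then have "a = sqrt (2*d*r)" using assms(3) by simp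
    then show ?thesis unfolding ratio unfolding inv L1star_def s_def[symmetric] using 2 assms(3) by simp
  next
    case 3
    then have "s\<^sup>2 < a\<^sup>2" using \<open>s > 0\<close> by (simp add: power_strict_mono)
    then have "sqrt (2*d*r) < a" using diff assms(3) by (intro real_less_lsqrt) simp_all
    moreover have "arctan (a / s) = pi / 2 - arctan (s / a)"
      using arctan_inverse[of "s / a"] assms(3) \<open>s > 0\<close> by simp
    moreover have "2 * arctan (s / a) = arctan (2 * (s / a) / (1 - (s / a)\<^sup>2))"
      using 3 assms(3) \<open>s > 0\<close> by (intro arctan_double) simp
    moreover have "2 * (s / a) / (1 - (s / a)\<^sup>2) = - (a * s / (2*d*r - a\<^sup>2))"
      unfolding diff using \<open>s\<^sup>2 < a\<^sup>2\<close> assms(3) by (simp add: field_simps power2_eq_square)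
    ultimately have "2 * arctan (a / s) = pi + arctan (a * s / (2*d*r - a\<^sup>2))"
      by (simp add: arctan_minus)
    then show ?thesis unfolding ratio unfolding inv L1star_def s_def[symmetric] using \<open>sqrt (2*d*r) < a\<close> by simp
  qed
qed

lemma isCont_arctan_length:
  "\<omega> > 0 \<Longrightarrow> isCont (\<lambda>\<omega>. 2 * arctan (\<alpha> / \<omega>) / \<omega>) (\<omega>::real)"
  by (intro continuous_intros) auto

lemma supersolution_frequency:
  assumes "d > 0" "r > 0" "a > 0" "L > 0"
    and "a \<ge> sqrt (4*d*r) \<or> (a < sqrt (4*d*r) \<and> L < L1star d r a)"
  defines "\<alpha> \<equiv> a / (2 * d)"
  shows "\<exists>\<omega>>0. r < d * (\<omega>\<^sup>2 + \<alpha>\<^sup>2) \<and> \<omega> * L \<le> 2 * arctan (\<alpha> / \<omega>)"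
  using assms(5)
proof
  have "\<alpha> > 0" using assms by (simp add: \<alpha>_def)
  assume "a \<ge> sqrt (4*d*r)"
  then have "4*d*r \<le> a\<^sup>2" using assms(1-3) by (simp add: real_sqrt_le_iff' sqrt_le_D)
  then have "r \<le> d * \<alpha>\<^sup>2" using assms(1) by (simp add: \<alpha>_def field_simps power2_eq_square)
  define \<omega> where "\<omega> = min \<alpha> (pi / (2 * L))"
  have "\<omega> > 0" "\<omega> \<le> \<alpha>" "\<omega> * L \<le> pi / 2"
    using \<open>\<alpha> > 0\<close> assms(4) by (auto simp: \<omega>_def min_def field_simps)
  have "1 \<le> \<alpha> / \<omega>" using \<open>\<omega> > 0\<close> \<open>\<omega> \<le> \<alpha>\<close> by simp
  then have "pi / 4 \<le> arctan (\<alpha> / \<omega>)" using arctan_le_iff[of 1 "\<alpha> / \<omega>"] by (simp add: arctan_one)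
  then have "\<omega> * L \<le> 2 * arctan (\<alpha> / \<omega>)" using \<open>\<omega> * L \<le> pi / 2\<close> by simp
  moreover have "0 < d * \<omega>\<^sup>2" using \<open>\<omega> > 0\<close> assms(1) by simp
  then have "r < d * (\<omega>\<^sup>2 + \<alpha>\<^sup>2)" using \<open>r \<le> d * \<alpha>\<^sup>2\<close> by (simp add: distrib_left)
  ultimately show ?thesis using \<open>\<omega> > 0\<close> by blast
next
  assume *: "a < sqrt (4*d*r) \<and> L < L1star d r a"
  define \<omega>0 where "\<omega>0 = sqrt (4*d*r - a\<^sup>2) / (2 * d)"
  have cl: "\<omega>0 > 0" "d * (\<omega>0\<^sup>2 + \<alpha>\<^sup>2) = r" "L1star d r a = 2 * arctan (\<alpha> / \<omega>0) / \<omega>0"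
    using critical_lengths[OF assms(1-3)] * unfolding \<alpha>_def \<omega>0_def by blast+
  have "((\<lambda>\<omega>. 2 * arctan (\<alpha> / \<omega>) / \<omega>) \<longlongrightarrow> 2 * arctan (\<alpha> / \<omega>0) / \<omega>0) (at_right \<omega>0)"
    using isCont_arctan_length[OF cl(1), of \<alpha>] unfolding isCont_def
    by (rule tendsto_within_subset) simp
  then have "eventually (\<lambda>\<omega>. L < 2 * arctan (\<alpha> / \<omega>) / \<omega>) (at_right \<omega>0)"
    using * cl(3) by (intro order_tendstoD(1)) auto
  then obtain b where b: "b > \<omega>0" "\<And>\<omega>. \<omega>0 < \<omega> \<Longrightarrow> \<omega> < b \<Longrightarrow> L < 2 * arctan (\<alpha> / \<omega>) / \<omega>"
    unfolding eventually_at_right_field by blast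
  obtain \<omega> where \<omega>: "\<omega>0 < \<omega>" "\<omega> < b" using dense b(1) by blast
  have "\<omega>0\<^sup>2 < \<omega>\<^sup>2" using \<omega>(1) cl(1) by (simp add: power_strict_mono)
  then have "r < d * (\<omega>\<^sup>2 + \<alpha>\<^sup>2)" using assms(1) by (simp flip: cl(2))
  moreover have "\<omega> * L \<le> 2 * arctan (\<alpha> / \<omega>)"
    using b(2)[OF \<omega>] \<omega>(1) cl(1) by (simp add: field_simps)
  ultimately show ?thesis using \<omega>(1) cl(1) by (intro exI[of _ \<omega>]) simp
qed

lemma subsolution_frequency:
  assumes "d > 0" "r > 0" "a > 0" "a < sqrt (4*d*r)" "L1star d r a < L"
  defines "\<alpha> \<equiv> a / (2 * d)"
  shows "\<exists>\<omega>>0. d * (\<omega>\<^sup>2 + \<alpha>\<^sup>2) < r \<and> 2 * arctan (\<alpha> / \<omega>) < \<omega> * L"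
proof -
  define \<omega>0 where "\<omega>0 = sqrt (4*d*r - a\<^sup>2) / (2 * d)"
  have cl: "\<omega>0 > 0" "d * (\<omega>0\<^sup>2 + \<alpha>\<^sup>2) = r" "L1star d r a = 2 * arctan (\<alpha> / \<omega>0) / \<omega>0"
    using critical_lengths[OF assms(1-4)] unfolding \<alpha>_def \<omega>0_def by blast+
  have "((\<lambda>\<omega>. 2 * arctan (\<alpha> / \<omega>) / \<omega>) \<longlongrightarrow> 2 * arctan (\<alpha> / \<omega>0) / \<omega>0) (at_left \<omega>0)"
    using isCont_arctan_length[OF cl(1), of \<alpha>] unfolding isCont_def
    by (rule tendsto_within_subset) simp
  then have "eventually (\<lambda>\<omega>. 2 * arctan (\<alpha> / \<omega>) / \<omega> < L) (at_left \<omega>0)"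
    using assms(5) cl(3) by (intro order_tendstoD(2)) auto
  then obtain b where b: "b < \<omega>0" "\<And>\<omega>. b < \<omega> \<Longrightarrow> \<omega> < \<omega>0 \<Longrightarrow> 2 * arctan (\<alpha> / \<omega>) / \<omega> < L"
    unfolding eventually_at_left_field by blast
  obtain \<omega> where \<omega>: "max b 0 < \<omega>" "\<omega> < \<omega>0" using dense[of "max b 0" \<omega>0] b(1) cl(1) by auto
  have "\<omega>\<^sup>2 < \<omega>0\<^sup>2" using \<omega> by (simp add: power_strict_mono)
  then have "d * (\<omega>\<^sup>2 + \<alpha>\<^sup>2) < r" using assms(1) by (simp flip: cl(2))
  moreover have "2 * arctan (\<alpha> / \<omega>) < \<omega> * L"
    using b(2)[of \<omega>] \<omega> by (simp add: field_simps)
  ultimately show ?thesis using \<omega>(1) by (intro exI[of _ \<omega>]) simp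
qed

section \<open>Sign of the principal eigenvalue\<close>

lemma lam_sst_eigenfunction:
  fixes d1 d2 a1 a2 r m h q L x2 :: real
  assumes "d1 > 0" "d2 > 0" "a1 > 0" "a2 \<ge> 0" "h > 0" "q > 0" "L > 0" "0 < x2" "x2 \<le> L"
  obtains phi phi' where
    "solves_ode d1 a1 (\<lambda>x. r - m * chi x2 x * wbar d2 a2 h q x2 x - lam_sst d1 d2 a1 a2 r m h q L x2) 0 L phi phi'"
    "\<And>x. x \<in> {0..L} \<Longrightarrow> phi x > 0" "d1 * phi' 0 - a1 * phi 0 = 0" "phi' L = 0"
proof -
  let ?s = "\<lambda>x. r - m * chi x2 x * wbar d2 a2 h q x2 x"
  have "\<exists>phi. is_pos_eigenpair d1 a1 ?s 0 L (lambda1 d1 a1 ?s 0 L) phi"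
  proof (rule lambda1_eigenpair[where c = x2 and ?s1.0 = "\<lambda>x. r - m * wbar d2 a2 h q x2 (min x x2)" and ?s2.0 = "\<lambda>_. r"])
    show "continuous_on {0..L} (\<lambda>x. r - m * wbar d2 a2 h q x2 (min x x2))"
      using assms
      by (intro continuous_intros continuous_on_compose2[OF wbar_continuous[of d2 q x2 a2 h]]) auto
    show "?s x = (if x < x2 then r - m * wbar d2 a2 h q x2 (min x x2) else r)" if "x \<in> {0..L}" for x
      using that by (auto simp: chi_def)
  qed (use assms in auto)
  then show ?thesis
    unfolding is_pos_eigenpair_iff lam_sst_def[symmetric] using that by blast
qed

lemma lam_sst_strict_mono:
  fixes d1 d2 a1 a2 r L x2 :: real
  assumes "d1 > 0" "d2 > 0" "a1 > 0" "a2 \<ge> 0" "L > 0" "0 < x2" "x2 \<le> L"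
    and "h > 0" "q > 0" "h' > 0" "q' > 0"
    and less: "\<And>x. x \<in> {0..x2} \<Longrightarrow> m' * wbar d2 a2 h' q' x2 x < m * wbar d2 a2 h q x2 x"
  shows "lam_sst d1 d2 a1 a2 r m h q L x2 < lam_sst d1 d2 a1 a2 r m' h' q' L x2" (is "?lam < ?mu")
proof (rule ccontr)
  assume "\<not> ?lam < ?mu"
  obtain f f' where f: "solves_ode d1 a1 (\<lambda>x. r - m * chi x2 x * wbar d2 a2 h q x2 x - ?lam) 0 L f f'"
    "\<And>x. x \<in> {0..L} \<Longrightarrow> f x > 0" "d1 * f' 0 - a1 * f 0 = 0" "f' L = 0"
    using lam_sst_eigenfunction[of d1 d2 a1 a2 h q L x2 r m] assms by blast
  obtain g g' where g: "solves_ode d1 a1 (\<lambda>x. r - m' * chi x2 x * wbar d2 a2 h' q' x2 x - ?mu) 0 L g g'"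
    "\<And>x. x \<in> {0..L} \<Longrightarrow> g x > 0" "d1 * g' 0 - a1 * g 0 = 0" "g' L = 0"
    using lam_sst_eigenfunction[of d1 d2 a1 a2 h' q' L x2 r m'] assms by blast
  have "weighted_wronskian d1 a1 f f' g g' 0 < weighted_wronskian d1 a1 f f' g g' x2"
  proof (rule sturm_comparison_strict[OF assms(1,6)])
    show "solves_ode d1 a1 (\<lambda>x. r - m * wbar d2 a2 h q x2 x - ?lam) 0 x2 f f'"
      by (rule solves_ode_subinterval[OF f(1)]) (use assms in \<open>auto simp: chi_def\<close>)
    show "solves_ode d1 a1 (\<lambda>x. r - m' * wbar d2 a2 h' q' x2 x - ?mu) 0 x2 g g'"
      by (rule solves_ode_subinterval[OF g(1)]) (use assms in \<open>auto simp: chi_def\<close>)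
    fix x assume "0 < x" "x < x2"
    then show "0 < f x \<and> 0 < g x \<and>
        r - m * wbar d2 a2 h q x2 x - ?lam < r - m' * wbar d2 a2 h' q' x2 x - ?mu"
      using less[of x] f(2)[of x] g(2)[of x] \<open>\<not> ?lam < ?mu\<close> assms(7) by simp
  qed
  moreover have "weighted_wronskian d1 a1 f f' g g' x2 \<le> weighted_wronskian d1 a1 f f' g g' L"
  proof (rule sturm_comparison[OF assms(1,7)])
    show "solves_ode d1 a1 (\<lambda>x. r - ?lam) x2 L f f'"
      by (rule solves_ode_subinterval[OF f(1)]) (use assms in \<open>auto simp: chi_def\<close>)
    show "solves_ode d1 a1 (\<lambda>x. r - ?mu) x2 L g g'"
      by (rule solves_ode_subinterval[OF g(1)]) (use assms in \<open>auto simp: chi_def\<close>)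
    fix x assume "x2 < x" "x < L"
    then show "0 \<le> f x \<and> 0 \<le> g x \<and> r - ?lam \<le> r - ?mu"
      using f(2)[of x] g(2)[of x] \<open>\<not> ?lam < ?mu\<close> assms(6) by simp
  qed
  moreover have "weighted_wronskian d1 a1 f f' g g' L = 0" using f(4) g(4) by (simp add: weighted_wronskian_def)
  moreover have "weighted_wronskian d1 a1 f f' g g' 0 = 0"
    using robin_wronskian_zero[of d1 f' 0 a1 f g' g] assms(1) f(3) g(3) by simp
  ultimately show False by simp
qed

lemma dirichlet_profile:
  fixes d r a L :: real
  assumes "d > 0" "r > 0" "a > 0" "a < sqrt (4*d*r)"
  obtains f f' where "\<And>y1 y2. solves_ode d a (\<lambda>_. r) y1 y2 f f'" "f' L = 0"
    "f (L - Lstar d r a) = 0" "f' (L - Lstar d r a) > 0"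
    "\<And>x. L - Lstar d r a < x \<Longrightarrow> x \<le> L \<Longrightarrow> f x > 0" "Lstar d r a > 0"
proof -
  define \<alpha> where "\<alpha> = a / (2 * d)"
  define \<omega> where "\<omega> = sqrt (4*d*r - a\<^sup>2) / (2 * d)"
  note cl = critical_lengths[OF assms, folded \<alpha>_def \<omega>_def]
  have "\<alpha> > 0" using assms by (simp add: \<alpha>_def)
  define \<psi> where "\<psi> = arctan (\<omega> / \<alpha>)"
  have \<psi>: "0 < \<psi>" "\<psi> < pi / 2" unfolding \<psi>_def using cl(1) \<open>\<alpha> > 0\<close> arctan_bounded by auto
  define y where "y = L - Lstar d r a"
  have Ly: "\<omega> * (L - y) = pi - \<psi>" using cl(1) by (simp add: y_def cl(4) \<psi>_def)
  define \<theta> where "\<theta> = \<omega> * y + pi / 2"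
  have ph: "\<omega> * x - \<theta> = \<omega> * (x - y) - pi / 2" for x by (simp add: \<theta>_def algebra_simps)
  have f: "exp_cos \<alpha> \<omega> \<theta> x = exp (\<alpha> * x) * sin (\<omega> * (x - y))" for x
    unfolding exp_cos_def ph by (simp add: cos_diff)
  have f': "exp_cos' \<alpha> \<omega> \<theta> x = exp (\<alpha> * x) * (\<alpha> * sin (\<omega> * (x - y)) + \<omega> * cos (\<omega> * (x - y)))" for x
    unfolding exp_cos'_def ph by (simp add: cos_diff sin_diff)
  show ?thesis
  proof
    show "solves_ode d a (\<lambda>_. r) y1 y2 (exp_cos \<alpha> \<omega> \<theta>) (exp_cos' \<alpha> \<omega> \<theta>)" for y1 y2
      using exp_cos_solves_ode[OF assms(1) \<alpha>_def, of \<omega> y1 y2 \<theta>] unfolding cl(2) .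
    have "tan \<psi> = \<omega> / \<alpha>" "cos \<psi> \<noteq> 0" by (simp_all add: \<psi>_def tan_arctan)
    then have "\<alpha> * sin \<psi> = \<omega> * cos \<psi>" using \<open>\<alpha> > 0\<close> by (simp add: tan_def field_simps)
    then show "exp_cos' \<alpha> \<omega> \<theta> L = 0" unfolding f' Ly by (simp add: sin_diff cos_diff)
    show "exp_cos \<alpha> \<omega> \<theta> (L - Lstar d r a) = 0" "exp_cos' \<alpha> \<omega> \<theta> (L - Lstar d r a) > 0"
      unfolding y_def[symmetric] f f' using cl(1) by simp_all
    show "Lstar d r a > 0" unfolding cl(4) \<psi>_def[symmetric] using \<psi> cl(1) by (intro divide_pos_pos) linarith+
    fix x assume x: "L - Lstar d r a < x" "x \<le> L"
    have "0 < \<omega> * (x - y)" using x(1) cl(1) by (simp add: y_def)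
    moreover have "\<omega> * (x - y) \<le> \<omega> * (L - y)" using x(2) cl(1) by simp
    ultimately have "0 < sin (\<omega> * (x - y))" using Ly \<psi> by (intro sin_gt_zero) auto
    then show "exp_cos \<alpha> \<omega> \<theta> x > 0" unfolding f by simp
  qed
qed

lemma unstable_large_zone:
  fixes d1 d2 a1 a2 r m h q L x2 :: real
  assumes "d1 > 0" "d2 > 0" "r > 0" "a1 > 0" "a2 \<ge> 0" "h > 0" "q > 0" "L > 0" "0 < x2" "x2 \<le> L"
    and "a1 < sqrt (4*d1*r)" "L - x2 \<ge> Lstar d1 r a1"
  shows "unstable d1 d2 a1 a2 r m h q L x2"
proof (rule ccontr)
  let ?lam = "lam_sst d1 d2 a1 a2 r m h q L x2"
  assume "\<not> unstable d1 d2 a1 a2 r m h q L x2"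
  then have "?lam \<le> 0" by (simp add: unstable_def)
  obtain g g' where g: "solves_ode d1 a1 (\<lambda>x. r - m * chi x2 x * wbar d2 a2 h q x2 x - ?lam) 0 L g g'"
    "\<And>x. x \<in> {0..L} \<Longrightarrow> g x > 0" "d1 * g' 0 - a1 * g 0 = 0" "g' L = 0"
    using lam_sst_eigenfunction[of d1 d2 a1 a2 h q L x2 r m] assms by blast
  define y where "y = L - Lstar d1 r a1"
  obtain f f' where f: "\<And>y1 y2. solves_ode d1 a1 (\<lambda>_. r) y1 y2 f f'" "f' L = 0"
    "f y = 0" "f' y > 0" "\<And>x. y < x \<Longrightarrow> x \<le> L \<Longrightarrow> f x > 0" "Lstar d1 r a1 > 0"
    unfolding y_def by (rule dirichlet_profile[OF assms(1,3,4,11), of L]) blast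
  have y: "x2 \<le> y" "y \<le> L" using assms(12) f(6) by (auto simp: y_def)
  have "weighted_wronskian d1 a1 f f' g g' y \<le> weighted_wronskian d1 a1 f f' g g' L"
  proof (rule sturm_comparison[OF assms(1) y(2) f(1)])
    show "solves_ode d1 a1 (\<lambda>x. r - ?lam) y L g g'"
      by (rule solves_ode_subinterval[OF g(1)]) (use assms(9) y in \<open>auto simp: chi_def\<close>)
    fix x assume "y < x" "x < L"
    then show "0 \<le> f x \<and> 0 \<le> g x \<and> r \<le> r - ?lam"
      using f(5)[of x] g(2)[of x] \<open>?lam \<le> 0\<close> assms(9) y by simp
  qed
  moreover have "weighted_wronskian d1 a1 f f' g g' L = 0" using f(2) g(4) by (simp add: weighted_wronskian_def)
  moreover have "0 < f' y * g y" using f(4) g(2)[of y] y assms(9) by simp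
  then have "0 < weighted_wronskian d1 a1 f f' g g' y" using f(3) by (simp add: weighted_wronskian_def)
  ultimately show False by simp
qed

lemma lin_stable_large_m:
  fixes d1 d2 a1 a2 r h q L x2 :: real
  assumes "d1 > 0" "d2 > 0" "r > 0" "a1 > 0" "a2 \<ge> 0" "h > 0" "q > 0" "L > 0" "0 < x2" "x2 \<le> L"
    and "a1 < sqrt (4*d1*r)" "L - x2 < Lstar d1 r a1"
  shows "\<exists>m>0. lin_stable d1 d2 a1 a2 r m h q L x2"
proof -
  obtain f f' where f: "\<And>y1 y2. solves_ode d1 a1 (\<lambda>_. r) y1 y2 f f'" "f' L = 0"
    "\<And>x. L - Lstar d1 r a1 < x \<Longrightarrow> x \<le> L \<Longrightarrow> f x > 0"
    by (rule dirichlet_profile[OF assms(1,3,4,11), of L]) blast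
  have fpos: "f x > 0" if "x2 \<le> x" "x \<le> L" for x using f(3)[of x] that assms(12) by simp
  define k where "k = f' x2 / f x2 / (2 * x2)"
  have k: "2 * k * x2 = f' x2 / f x2" using assms(9) by (simp add: k_def)
  define e where "e x = exp (k * x\<^sup>2)" for x :: real
  define e' where "e' x = 2 * k * x * exp (k * x\<^sup>2)" for x :: real
  define K where "K x = - (d1 * (2 * k + (2 * k * x)\<^sup>2) - a1 * (2 * k * x))" for x
  have e: "solves_ode d1 a1 K 0 x2 e e'"
  proof (rule solves_ode_smooth)
    show "(e has_real_derivative e' x) (at x)" for x
      unfolding e_def[abs_def] e'_def by (rule derivative_eq_intros refl)+ simp
    show "(e' has_real_derivative (2 * k + (2 * k * x)\<^sup>2) * exp (k * x\<^sup>2)) (at x)" for x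
      unfolding e'_def[abs_def] by (rule derivative_eq_intros refl)+ (simp add: algebra_simps power2_eq_square)
    show "d1 * ((2 * k + (2 * k * x)\<^sup>2) * exp (k * x\<^sup>2)) - a1 * e' x + K x * e x = 0" for x
      unfolding e_def e'_def K_def by (simp add: algebra_simps)
  qed
  have "continuous_on {0..x2} K" unfolding K_def by (intro continuous_intros)
  then obtain MK where MK: "\<And>x. x \<in> {0..x2} \<Longrightarrow> \<bar>K x\<bar> \<le> MK" using continuous_on_Icc_bounded by blast
  define c where "c = h / q * exp (- (a2/d2) * x2)"
  have "c > 0" using assms by (simp add: c_def)
  define m where "m = (r + \<bar>MK\<bar>) / c"
  have "m > 0" using \<open>c > 0\<close> assms(3) by (simp add: m_def add_pos_nonneg)
  have mw: "r + MK \<le> m * wbar d2 a2 h q x2 x" if "x \<in> {0..x2}" for x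
  proof -
    have "c \<le> wbar d2 a2 h q x2 x" unfolding c_def by (rule wbar_bounds(1)) (use assms that in auto)
    then have "m * c \<le> m * wbar d2 a2 h q x2 x" using \<open>m > 0\<close> by simp
    moreover have "m * c = r + \<bar>MK\<bar>" using \<open>c > 0\<close> by (simp add: m_def)
    ultimately show ?thesis by linarith
  qed
  let ?lam = "lam_sst d1 d2 a1 a2 r m h q L x2"
  have "?lam < 0"
  proof (rule ccontr)
    assume lam: "\<not> ?lam < 0"
    obtain g g' where g: "solves_ode d1 a1 (\<lambda>x. r - m * chi x2 x * wbar d2 a2 h q x2 x - ?lam) 0 L g g'"
      "\<And>x. x \<in> {0..L} \<Longrightarrow> g x > 0" "d1 * g' 0 - a1 * g 0 = 0" "g' L = 0"
      using lam_sst_eigenfunction[of d1 d2 a1 a2 h q L x2 r m] assms by blast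
    have "weighted_wronskian d1 a1 g g' e e' 0 \<le> weighted_wronskian d1 a1 g g' e e' x2"
    proof (rule sturm_comparison[OF assms(1) less_imp_le[OF assms(9)] _ e])
      show "solves_ode d1 a1 (\<lambda>x. r - m * wbar d2 a2 h q x2 x - ?lam) 0 x2 g g'"
        by (rule solves_ode_subinterval[OF g(1)]) (use assms in \<open>auto simp: chi_def\<close>)
      fix x assume "0 < x" "x < x2"
      then show "0 \<le> g x \<and> 0 \<le> e x \<and> r - m * wbar d2 a2 h q x2 x - ?lam \<le> K x"
        using g(2)[of x] lam mw[of x] MK[of x] assms(10) by (simp add: e_def)
    qed
    moreover have "0 < d1 * g' 0" using g(2)[of 0] g(3) assms(4,8) by simp
    then have "0 < g' 0" using assms(1) by (simp add: zero_less_mult_iff)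
    ultimately have "0 < weighted_wronskian d1 a1 g g' e e' x2"
      by (simp add: weighted_wronskian_def e_def e'_def)
    then have "0 < g' x2 * e x2 - g x2 * e' x2"
      by (simp add: weighted_wronskian_def zero_less_mult_iff)
    moreover have "e' x2 = f' x2 / f x2 * e x2" unfolding e'_def e_def k ..
    ultimately have "0 < (g' x2 - g x2 * (f' x2 / f x2)) * e x2" by (simp add: algebra_simps)
    then have "0 < g' x2 - g x2 * (f' x2 / f x2)" by (simp add: e_def zero_less_mult_iff)
    then have "0 < (g' x2 - g x2 * (f' x2 / f x2)) * f x2" using fpos[of x2] assms(10) by simp
    then have "0 < g' x2 * f x2 - g x2 * f' x2"
      using fpos[of x2] assms(10) by (simp add: left_diff_distrib)
    then have "0 < weighted_wronskian d1 a1 g g' f f' x2" by (simp add: weighted_wronskian_def)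
    also have "\<dots> \<le> weighted_wronskian d1 a1 g g' f f' L"
    proof (rule sturm_comparison[OF assms(1,10) _ f(1)])
      show "solves_ode d1 a1 (\<lambda>x. r - ?lam) x2 L g g'"
        by (rule solves_ode_subinterval[OF g(1)]) (use assms in \<open>auto simp: chi_def\<close>)
      fix x assume "x2 < x" "x < L"
      then show "0 \<le> g x \<and> 0 \<le> f x \<and> r - ?lam \<le> r"
        using g(2)[of x] fpos[of x] lam assms(9) by simp
    qed
    finally show False using f(2) g(4) by (simp add: weighted_wronskian_def)
  qed
  then show ?thesis using \<open>m > 0\<close> unfolding lin_stable_def by blast
qed

lemma unstable_large_q:
  fixes d1 d2 a1 a2 r m h L x2 :: real
  assumes "d1 > 0" "d2 > 0" "r > 0" "m > 0" "a1 > 0" "a2 \<ge> 0" "h > 0" "L > 0" "0 < x2" "x2 \<le> L"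
    and "a1 < sqrt (4*d1*r)" "L1star d1 r a1 < L"
  shows "\<exists>q>0. unstable d1 d2 a1 a2 r m h q L x2"
proof -
  define \<alpha> where "\<alpha> = a1 / (2 * d1)"
  have "\<alpha> > 0" using assms by (simp add: \<alpha>_def)
  obtain \<omega> where \<omega>: "\<omega> > 0" "d1 * (\<omega>\<^sup>2 + \<alpha>\<^sup>2) < r" "2 * arctan (\<alpha> / \<omega>) < \<omega> * L"
    using subsolution_frequency[OF assms(1,3,5,11,12)] unfolding \<alpha>_def by blast
  define \<theta> where "\<theta> = arctan (\<alpha> / \<omega>)"
  have "\<theta> > 0" using \<open>\<alpha> > 0\<close> \<omega>(1) by (simp add: \<theta>_def)
  define y where "y = 2 * \<theta> / \<omega>"
  have y: "0 < y" "y < L" "\<omega> * y = 2 * \<theta>"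
    using \<omega> \<open>\<theta> > 0\<close> by (auto simp: y_def \<theta>_def field_simps)
  let ?f = "exp_cos \<alpha> \<omega> \<theta>" and ?f' = "exp_cos' \<alpha> \<omega> \<theta>"
  define k where "k = d1 * (\<omega>\<^sup>2 + \<alpha>\<^sup>2)"
  have "k > 0" using assms(1) \<omega>(1) by (simp add: k_def add_pos_nonneg)
  define E where "E = m * (h * exp ((a2/d2) * x2))"
  have "E > 0" using assms by (simp add: E_def)
  define q where "q = 2 * E / (r - k)"
  have "q > 0" using \<open>E > 0\<close> \<omega>(2) by (simp add: q_def k_def)
  have small: "m * wbar d2 a2 h q x2 x < r - k" if "x \<in> {0..x2}" for x
  proof -
    have "wbar d2 a2 h q x2 x \<le> h / q * exp ((a2/d2) * x2)"
      by (rule wbar_bounds(2)) (use assms that \<open>q > 0\<close> in auto)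
    then have "m * wbar d2 a2 h q x2 x \<le> m * (h / q * exp ((a2/d2) * x2))"
      using assms(4) by (intro mult_left_mono) auto
    also have "\<dots> = E / q" by (simp add: E_def)
    also have "\<dots> = (r - k) / 2" using \<open>E > 0\<close> \<omega>(2) by (simp add: q_def k_def)
    finally show ?thesis using \<omega>(2) by (simp add: k_def)
  qed
  let ?lam = "lam_sst d1 d2 a1 a2 r m h q L x2"
  have "?lam > 0"
  proof (rule ccontr)
    assume lam: "\<not> ?lam > 0"
    obtain g g' where g: "solves_ode d1 a1 (\<lambda>x. r - m * chi x2 x * wbar d2 a2 h q x2 x - ?lam) 0 L g g'"
      "\<And>x. x \<in> {0..L} \<Longrightarrow> g x > 0" "d1 * g' 0 - a1 * g 0 = 0" "g' L = 0"
      using lam_sst_eigenfunction[of d1 d2 a1 a2 h q L x2 r m] assms \<open>q > 0\<close> by blast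
    have s: "k < r - m * chi x2 x * wbar d2 a2 h q x2 x - ?lam" if "0 < x" for x
      using small[of x] lam \<omega>(2) that by (auto simp: chi_def k_def)
    have "weighted_wronskian d1 a1 ?f ?f' g g' 0 < weighted_wronskian d1 a1 ?f ?f' g g' y"
    proof (rule sturm_comparison_strict[OF assms(1) y(1)])
      show "solves_ode d1 a1 (\<lambda>_. k) 0 y ?f ?f'"
        unfolding k_def by (rule exp_cos_solves_ode[OF assms(1) \<alpha>_def])
      show "solves_ode d1 a1 (\<lambda>x. r - m * chi x2 x * wbar d2 a2 h q x2 x - ?lam) 0 y g g'"
        by (rule solves_ode_subinterval[OF g(1)]) (use y in auto)
      fix x assume x: "0 < x" "x < y"
      have "\<omega> * x \<le> 2 * \<theta>" using x \<omega>(1) by (simp flip: y(3))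
      then have "0 < ?f x" using x(1) by (intro exp_cos_arctan_phase_pos[OF \<theta>_def \<omega>(1)]) auto
      then show "0 < ?f x \<and> 0 < g x \<and> k < r - m * chi x2 x * wbar d2 a2 h q x2 x - ?lam"
        using g(2)[of x] s[OF x(1)] x y by simp
    qed
    moreover have "weighted_wronskian d1 a1 ?f ?f' g g' 0 = 0"
      using robin_wronskian_zero[of d1 ?f' 0 a1 ?f g' g] assms(1) g(3)
        exp_cos_arctan_phase_robin[OF assms(1) \<omega>(1) \<alpha>_def \<theta>_def] by simp
    moreover have "?f' y = 0" using exp_cos'_arctan_phase[OF \<omega>(1) \<theta>_def, of y] y(3) by simp
    moreover have "0 < ?f y" using y by (intro exp_cos_arctan_phase_pos[OF \<theta>_def \<omega>(1)]) auto
    ultimately have "0 < - g' y" by (simp add: weighted_wronskian_def mult_less_0_iff)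
    \<comment> \<open>Beyond its maximum at \<open>y\<close> the test function is continued by a constant.\<close>
    moreover have "weighted_wronskian d1 a1 (\<lambda>_. 1) (\<lambda>_. 0) g g' y \<le> weighted_wronskian d1 a1 (\<lambda>_. 1) (\<lambda>_. 0) g g' L"
    proof (rule sturm_comparison[OF assms(1) less_imp_le[OF y(2)]])
      show "solves_ode d1 a1 (\<lambda>_. 0) y L (\<lambda>_. 1) (\<lambda>_. 0)"
        by (rule solves_ode_smooth[where f'' = "\<lambda>_. 0"]) auto
      show "solves_ode d1 a1 (\<lambda>x. r - m * chi x2 x * wbar d2 a2 h q x2 x - ?lam) y L g g'"
        by (rule solves_ode_subinterval[OF g(1)]) (use y in auto)
      fix x assume x: "y < x" "x < L"
      then show "(0::real) \<le> 1 \<and> 0 \<le> g x \<and> 0 \<le> r - m * chi x2 x * wbar d2 a2 h q x2 x - ?lam"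
        using s[of x] g(2)[of x] y \<open>k > 0\<close> by simp
    qed
    ultimately show False using g(4) by (simp add: weighted_wronskian_def zero_le_mult_iff)
  qed
  then show ?thesis using \<open>q > 0\<close> unfolding unstable_def by blast
qed

theorem theorem2p5:
  fixes d1 d2 r m p q h L a1 a2 x2 :: real
  assumes "d1 > 0" "d2 > 0" "r > 0" "m > 0" "p > 0" "q > 0" "h > 0" "L > 0"
    and "a1 > 0" "a2 \<ge> 0" "0 < x2" "x2 \<le> L"
  shows
    "((a1 \<ge> sqrt (4*d1*r) \<or> (a1 < sqrt (4*d1*r) \<and> L < L1star d1 r a1))
       \<longrightarrow> glob_asym_stable d1 d2 a1 a2 r m p q h L x2)
   \<and> (a1 < sqrt (4*d1*r) \<and> L > L1star d1 r a1 \<longrightarrow>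
       (L - x2 \<ge> Lstar d1 r a1 \<longrightarrow> unstable d1 d2 a1 a2 r m h q L x2)
     \<and> (L - x2 < Lstar d1 r a1 \<longrightarrow>
          (\<exists>mbar :: real \<Rightarrow> real. \<forall>h' m'. h' > 0 \<and> m' > 0 \<longrightarrow>
              (m' > mbar h' \<longrightarrow> lin_stable d1 d2 a1 a2 r m' h' q L x2)
            \<and> (m' < mbar h' \<longrightarrow> unstable d1 d2 a1 a2 r m' h' q L x2))
        \<and> (\<exists>qbar :: real \<Rightarrow> real. \<forall>q' m'. q' > 0 \<and> m' > 0 \<longrightarrow>
              (q' < qbar m' \<longrightarrow> lin_stable d1 d2 a1 a2 r m' h q' L x2)
            \<and> (q' > qbar m' \<longrightarrow> unstable d1 d2 a1 a2 r m' h q' L x2))))"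
proof (intro conjI impI)
  assume "a1 \<ge> sqrt (4*d1*r) \<or> (a1 < sqrt (4*d1*r) \<and> L < L1star d1 r a1)"
  define \<alpha> where "\<alpha> = a1 / (2 * d1)"
  obtain \<omega> where \<omega>: "\<omega> > 0" "r < d1 * (\<omega>\<^sup>2 + \<alpha>\<^sup>2)" "\<omega> * L \<le> 2 * arctan (\<alpha> / \<omega>)"
    using supersolution_frequency[of d1 r a1 L] assms
      \<open>a1 \<ge> sqrt (4*d1*r) \<or> (a1 < sqrt (4*d1*r) \<and> L < L1star d1 r a1)\<close> unfolding \<alpha>_def by blast
  define \<theta> where "\<theta> = arctan (\<alpha> / \<omega>)"
  have range: "\<omega> * x \<le> 2 * \<theta>" if "x \<le> L" for x
    using \<omega> mult_left_mono[OF that, of \<omega>] unfolding \<theta>_def by linarith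
  show "glob_asym_stable d1 d2 a1 a2 r m p q h L x2"
  proof (rule glob_asym_stable_if_supersolution[OF assms _ exp_cos_derivative exp_cos'_derivative])
    show "0 < d1 * (\<omega>\<^sup>2 + \<alpha>\<^sup>2) - r" using \<omega>(2) by simp
    show "exp_cos \<alpha> \<omega> \<theta> x > 0" if "x \<in> {0..L}" for x
      using that range by (intro exp_cos_arctan_phase_pos[OF \<theta>_def \<omega>(1)]) auto
    show "d1 * exp_cos'' \<alpha> \<omega> \<theta> x - a1 * exp_cos' \<alpha> \<omega> \<theta> x + r * exp_cos \<alpha> \<omega> \<theta> x
        = - (d1 * (\<omega>\<^sup>2 + \<alpha>\<^sup>2) - r) * exp_cos \<alpha> \<omega> \<theta> x" for x
      using exp_cos_ode[OF assms(1) \<alpha>_def, of \<omega> \<theta> x] by (simp add: algebra_simps)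
    show "d1 * exp_cos' \<alpha> \<omega> \<theta> 0 - a1 * exp_cos \<alpha> \<omega> \<theta> 0 = 0"
      by (rule exp_cos_arctan_phase_robin[OF assms(1) \<omega>(1) \<alpha>_def \<theta>_def])
    have "0 < cos \<theta>" "\<theta> < pi / 2" unfolding \<theta>_def using arctan_bounded by (auto intro: cos_gt_zero_pi)
    moreover have "0 < \<omega> * L" using \<omega>(1) assms(8) by simp
    ultimately have "0 \<le> sin (2 * \<theta> - \<omega> * L)" using range[of L] by (intro sin_ge_zero) auto
    then show "exp_cos' \<alpha> \<omega> \<theta> L \<ge> 0"
      unfolding exp_cos'_arctan_phase[OF \<omega>(1) \<theta>_def] using \<omega>(1) \<open>0 < cos \<theta>\<close> by simp
  qed
next
  assume "a1 < sqrt (4*d1*r) \<and> L > L1star d1 r a1" "L - x2 \<ge> Lstar d1 r a1"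
  then show "unstable d1 d2 a1 a2 r m h q L x2" using assms by (intro unstable_large_zone) auto
next
  assume lt: "a1 < sqrt (4*d1*r) \<and> L > L1star d1 r a1" and small: "L - x2 < Lstar d1 r a1"
  have "\<exists>c. \<forall>x>0. (x > c \<longrightarrow> - lam_sst d1 d2 a1 a2 r x h' q L x2 > 0)
      \<and> (x < c \<longrightarrow> - lam_sst d1 d2 a1 a2 r x h' q L x2 < 0)" if "h' > 0" for h'
  proof (rule sign_threshold)
    fix x y :: real assume "0 < x" "x < y"
    then have "x * wbar d2 a2 h' q x2 z < y * wbar d2 a2 h' q x2 z" if "z \<in> {0..x2}" for z
      using wbar_bounds(3)[of d2 q x2 a2 h' z] assms \<open>h' > 0\<close> that by simp
    then have "lam_sst d1 d2 a1 a2 r y h' q L x2 < lam_sst d1 d2 a1 a2 r x h' q L x2"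
      using assms \<open>h' > 0\<close> by (intro lam_sst_strict_mono) auto
    then show "- lam_sst d1 d2 a1 a2 r x h' q L x2 < - lam_sst d1 d2 a1 a2 r y h' q L x2" by simp
  next
    show "\<exists>x>0. - lam_sst d1 d2 a1 a2 r x h' q L x2 > 0"
      using lin_stable_large_m[of d1 d2 r a1 a2 h' q L x2] assms lt small \<open>h' > 0\<close>
      by (auto simp: lin_stable_def)
  qed
  then obtain mbar where "\<And>h' x. h' > 0 \<Longrightarrow> x > 0 \<Longrightarrow>
      (x > mbar h' \<longrightarrow> - lam_sst d1 d2 a1 a2 r x h' q L x2 > 0)
      \<and> (x < mbar h' \<longrightarrow> - lam_sst d1 d2 a1 a2 r x h' q L x2 < 0)"
    by metis
  then show "\<exists>mbar :: real \<Rightarrow> real. \<forall>h' m'. h' > 0 \<and> m' > 0 \<longrightarrow>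
        (m' > mbar h' \<longrightarrow> lin_stable d1 d2 a1 a2 r m' h' q L x2)
      \<and> (m' < mbar h' \<longrightarrow> unstable d1 d2 a1 a2 r m' h' q L x2)"
    unfolding lin_stable_def unstable_def by (intro exI[of _ mbar]) auto
next
  assume lt: "a1 < sqrt (4*d1*r) \<and> L > L1star d1 r a1"
  have "\<exists>c. \<forall>x>0. (x > c \<longrightarrow> lam_sst d1 d2 a1 a2 r m' h x L x2 > 0)
      \<and> (x < c \<longrightarrow> lam_sst d1 d2 a1 a2 r m' h x L x2 < 0)" if "m' > 0" for m'
  proof (rule sign_threshold)
    fix x y :: real assume xy: "0 < x" "x < y"
    then have "m' * wbar d2 a2 h y x2 z < m' * wbar d2 a2 h x x2 z" if "z \<in> {0..x2}" for z
      using wbar_strict_antimono[of d2 x y x2 a2 h z] assms \<open>m' > 0\<close> that by simp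
    then show "lam_sst d1 d2 a1 a2 r m' h x L x2 < lam_sst d1 d2 a1 a2 r m' h y L x2"
      using assms xy by (intro lam_sst_strict_mono) auto
  next
    show "\<exists>x>0. lam_sst d1 d2 a1 a2 r m' h x L x2 > 0"
      using unstable_large_q[of d1 d2 r m' a1 a2 h L x2] assms lt \<open>m' > 0\<close>
      by (auto simp: unstable_def)
  qed
  then obtain qbar where "\<And>m' x. m' > 0 \<Longrightarrow> x > 0 \<Longrightarrow>
      (x > qbar m' \<longrightarrow> lam_sst d1 d2 a1 a2 r m' h x L x2 > 0)
      \<and> (x < qbar m' \<longrightarrow> lam_sst d1 d2 a1 a2 r m' h x L x2 < 0)"
    by metis
  then show "\<exists>qbar :: real \<Rightarrow> real. \<forall>q' m'. q' > 0 \<and> m' > 0 \<longrightarrow>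
        (q' < qbar m' \<longrightarrow> lin_stable d1 d2 a1 a2 r m' h q' L x2)
      \<and> (q' > qbar m' \<longrightarrow> unstable d1 d2 a1 a2 r m' h q' L x2)"
    unfolding lin_stable_def unstable_def by (intro exI[of _ qbar]) auto
qed

end
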